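(* Let $0<q_1<q_2<\infty$ and $A>0$. Then there is a constant $C>0$, depending only on $d,q_1,q_2,A$, such that for every $\mu\in\mathbb{Z}$ and every sequence $\mathbf{f}=\{f_k\}_{k\in\mathbb{Z}}$ with $f_k\in\mathcal{E}(A2^k)$ for all $k\in\mathbb{Z}$, $$\mathcal{V}_{\mu,q_2}[\mathbf{f}]\le C\,\mathcal{V}_{\mu,q_1}[\mathbf{f}],$$ where for $0<q<\infty$ $$\mathcal{V}_{\mu,q}[\mathbf{f}]:=\sup_{P\in\mathcal{D},\,l(P)\le2^{-\mu}}\Big(\frac{1}{|P|}\int_P\sum_{k=-\log_2 l(P)}^{\infty}|f_k(x)|^q\,dx\Big)^{1/q}.$$
   Context: Everything is on $\mathbb{R}^d$, and the Fourier transform is $\widehat{f}(\xi)=\int_{\mathbb{R}^d}f(x)e^{-2\pi i\langle x,\xi\rangle}dx$. For $\rho>0$, $\mathcal{E}(\rho)$ is the space of tempered distributions on $\mathbb{R}^d$ whose Fourier transforms are supported in $\{\xi:|\xi|\le 2\rho\}$ (such distributions are identified with smooth functions). $\mathcal{D}$ is the set of all dyadic cubes in $\mathbb{R}^d$ and $l(P)$ is the side length of $P\in\mathcal{D}$. The quantities $\mathcal{V}_{\mu,q}[\mathbf{f}]$ take values in $[0,\infty]$. *)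

theory Defs
  imports "HOL-Analysis.Analysis"
begin

text \<open>A list of basis vectors plays the role of a multi-index.\<close>

fun iter_partial ::
  "'a::euclidean_space list \<Rightarrow> ('a \<Rightarrow> complex) \<Rightarrow> 'a \<Rightarrow> complex" where
  "iter_partial [] f = f"
| "iter_partial (b # bs) f = (\<lambda>x. frechet_derivative (iter_partial bs f) (at x) b)"

definition smooth :: "('a::euclidean_space \<Rightarrow> complex) \<Rightarrow> bool" where
  "smooth f \<longleftrightarrow>
     (\<forall>bs. set bs \<subseteq> Basis \<longrightarrow> (\<forall>x. iter_partial bs f differentiable (at x)))"

definition test_functions :: "('a::euclidean_space \<Rightarrow> complex) set" where
  "test_functions = {\<phi>. smooth \<phi> \<and> compact (closure {x. \<phi> x \<noteq> 0})}"

definition schwartz :: "('a::euclidean_space \<Rightarrow> complex) set" where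
  "schwartz = {\<phi>. smooth \<phi> \<and>
     (\<forall>n bs. set bs \<subseteq> Basis \<longrightarrow>
        bounded (range (\<lambda>x. (1 + norm x) ^ n * norm (iter_partial bs \<phi> x))))}"

definition schwartz_seminorm :: "nat \<Rightarrow> ('a::euclidean_space \<Rightarrow> complex) \<Rightarrow> real" where
  "schwartz_seminorm N \<phi> =
     (SUP (bs, x) \<in> {bs. set bs \<subseteq> Basis \<and> length bs \<le> N} \<times> UNIV.
        (1 + norm x) ^ N * norm (iter_partial bs \<phi> x))"

text \<open>Functionals are total on all functions, but only their values on \<^const>\<open>schwartz\<close> matter.
  The seminorms increase with \<open>N\<close> and generate the Schwartz topology, so continuity
  is the existence of a bound by a multiple of one of them.\<close>

definition tempered_distribution ::
  "(('a::euclidean_space \<Rightarrow> complex) \<Rightarrow> complex) \<Rightarrow> bool" where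
  "tempered_distribution T \<longleftrightarrow>
     (\<forall>\<phi>\<in>schwartz. \<forall>\<psi>\<in>schwartz. T (\<lambda>x. \<phi> x + \<psi> x) = T \<phi> + T \<psi>) \<and>
     (\<forall>c. \<forall>\<phi>\<in>schwartz. T (\<lambda>x. c * \<phi> x) = c * T \<phi>) \<and>
     (\<exists>C N. \<forall>\<phi>\<in>schwartz. norm (T \<phi>) \<le> C * schwartz_seminorm N \<phi>)"

definition distribution_support ::
  "(('a::euclidean_space \<Rightarrow> complex) \<Rightarrow> complex) \<Rightarrow> 'a set" where
  "distribution_support T =
     - \<Union>{U. open U \<and> (\<forall>\<phi>\<in>test_functions. closure {x. \<phi> x \<noteq> 0} \<subseteq> U \<longrightarrow> T \<phi> = 0)}"

definition fourier :: "('a::euclidean_space \<Rightarrow> complex) \<Rightarrow> 'a \<Rightarrow> complex" where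
  "fourier \<phi> \<xi> =
     (LINT x|lborel. \<phi> x * exp (- 2 * of_real pi * \<i> * of_real (inner x \<xi>)))"

definition fourier_distribution ::
  "(('a::euclidean_space \<Rightarrow> complex) \<Rightarrow> complex) \<Rightarrow> ('a \<Rightarrow> complex) \<Rightarrow> complex" where
  "fourier_distribution T = (\<lambda>\<phi>. T (fourier \<phi>))"

definition distribution_of ::
  "('a::euclidean_space \<Rightarrow> complex) \<Rightarrow> ('a \<Rightarrow> complex) \<Rightarrow> complex" where
  "distribution_of f = (\<lambda>\<phi>. LINT x|lborel. f x * \<phi> x)"

text \<open>By the Paley--Wiener--Schwartz theorem a tempered distribution whose Fourier transform has
  compact support is \<open>distribution_of f\<close> for a unique smooth \<open>f\<close>, which together with
  all its derivatives has polynomial growth; the space below consists of these functions.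
  The integrability condition is needed because the Bochner integral of a nonintegrable
  function is \<open>0\<close>.\<close>

definition bandlimited :: "real \<Rightarrow> ('a::euclidean_space \<Rightarrow> complex) set" where
  "bandlimited \<rho> = {f. smooth f \<and>
     (\<forall>\<phi>\<in>schwartz. integrable lborel (\<lambda>x. f x * \<phi> x)) \<and>
     tempered_distribution (distribution_of f) \<and>
     distribution_support (fourier_distribution (distribution_of f)) \<subseteq> {\<xi>. norm \<xi> \<le> 2 * \<rho>}}"

definition half_open_cube :: "'a::euclidean_space \<Rightarrow> real \<Rightarrow> 'a set" where
  "half_open_cube a l = {x. \<forall>b\<in>Basis. a \<bullet> b \<le> x \<bullet> b \<and> x \<bullet> b < a \<bullet> b + l}"

definition dyadic_cubes :: "'a::euclidean_space set set" where
  "dyadic_cubes = {P. \<exists>(j::int) (m::'a \<Rightarrow> int).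
     P = half_open_cube (\<Sum>b\<in>Basis. (2 powi (- j) * of_int (m b)) *\<^sub>R b) (2 powi (- j))}"

definition side_length :: "'a::euclidean_space set \<Rightarrow> real" where
  "side_length P = (THE l. l > 0 \<and> (\<exists>a. P = half_open_cube a l))"

lemma side_length_half_open_cube:
  fixes a :: "'a::euclidean_space"
  assumes "l > 0"
  shows "side_length (half_open_cube a l) = l"
proof -
  have le: "r \<le> s" if eq: "half_open_cube a r = half_open_cube c s" and "r > 0" "s > 0"
    for a c :: 'a and r s :: real
  proof (rule ccontr)
    assume "\<not> r \<le> s"
    obtain b :: 'a where b: "b \<in> Basis" using nonempty_Basis by blast
    have inner_b: "(a + t *\<^sub>R b) \<bullet> i = a \<bullet> i + (if i = b then t else 0)"
      if "i \<in> Basis" for t i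
      using that b by (simp add: inner_add_left inner_Basis)
    have "a + 0 *\<^sub>R b \<in> half_open_cube a r" "a + s *\<^sub>R b \<in> half_open_cube a r"
      using \<open>\<not> r \<le> s\<close> \<open>s > 0\<close> \<open>r > 0\<close> unfolding half_open_cube_def
      by (auto simp only: inner_b mem_Collect_eq split: if_splits)
    then have "c \<bullet> b \<le> a \<bullet> b" "(a + s *\<^sub>R b) \<bullet> b < c \<bullet> b + s"
      using b unfolding eq by (auto simp: half_open_cube_def)
    then show False using inner_b[OF b, of s] by simp
  qed
  show ?thesis
    unfolding side_length_def
  proof (rule the_equality)
    show "l > 0 \<and> (\<exists>c. half_open_cube a l = half_open_cube c l)" using assms by blast
  next
    fix r assume "r > 0 \<and> (\<exists>c. half_open_cube a l = half_open_cube c r)"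
    then obtain c where "r > 0" "half_open_cube a l = half_open_cube c r" by blast
    then show "r = l" using le[of a l c r] le[of c r a l] assms by simp
  qed
qed

definition ennreal_powr :: "ennreal \<Rightarrow> real \<Rightarrow> ennreal" where
  "ennreal_powr t r = (if t = \<infinity> then \<infinity> else ennreal (enn2real t powr r))"
  \<comment> \<open>used for \<open>r > 0\<close> only\<close>

definition V :: "int \<Rightarrow> real \<Rightarrow> (int \<Rightarrow> 'a::euclidean_space \<Rightarrow> complex) \<Rightarrow> ennreal" where
  "V \<mu> q f =
     (SUP P \<in> {P \<in> dyadic_cubes. side_length P \<le> 2 powi (- \<mu>)}.
        ennreal_powr
          (1 / emeasure lborel P *
             (\<integral>\<^sup>+x\<in>P. (\<Sum>\<^sub>\<infinity>k\<in>{k. - log 2 (side_length P) \<le> real_of_int k}.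
                          ennreal (norm (f k x) powr q)) \<partial>lborel))
          (1 / q))"

end

theory Submission
  imports Defs
begin

text \<open>If \<open>\<bar>f\<^sub>k\<bar> \<le> C V\<^sub>1\<close> everywhere for \<open>k \<ge> \<mu>\<close>, where \<open>V\<^sub>1\<close> is the quantity with exponent \<open>q\<^sub>1\<close>, then
  \<open>\<bar>f\<^sub>k\<bar> powr q\<^sub>2 \<le> (C V\<^sub>1) powr (q\<^sub>2 - q\<^sub>1) * \<bar>f\<^sub>k\<bar> powr q\<^sub>1\<close> and averaging finishes the proof. The
  pointwise bound is an inequality of Plancherel--Polya type: \<open>f\<^sub>k\<close> equals its convolution with a
  Schwartz kernel of scale \<open>2 powi (-k)\<close>, and its averages over cubes of that side length are controlled
  by \<open>V\<^sub>1\<close> because such cubes occur in the supremum. The convolution identity avoids Fourier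
  inversion: dilates \<open>R^d K(R x)\<close> of one kernel all act in the same way on \<open>f\<^sub>k\<close> once \<open>R\<close> is large,
  and they form an approximate identity up to the factor \<open>\<integral>K\<close>, which only has to be nonzero.\<close>

section \<open>Smooth functions and test functions\<close>

text \<open>The constant is free of \<open>k\<close> because kernels of frequency scale
  \<open>R = (2 * A + 1) * 2 powi k\<close> meet cubes of side \<open>2 powi (- k)\<close>, and the
  constants that survive depend on these numbers only through their product. It is free of
  \<open>\<mu>\<close> because the inner sum over a cube of side \<open>2 powi (- j)\<close> starts
  at \<open>j\<close>: an admissible cube has \<open>\<mu> \<le> j\<close>, so only indices to which
  the pointwise bound applies occur.

  The exponent shapes the rest. For \<open>q1 \<ge> 1\<close> a mean of |f| is controlled by the
  mean of its power at once. For \<open>q1 < 1\<close> this fails for general functions, and a part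
  of |f| is absorbed into a weighted supremum of |f| itself. That supremum has to be finite
  beforehand, while membership in \<open>bandlimited\<close> speaks of growth only indirectly,
  through the continuity of a functional. Testing the functional on translates of the reproducing
  kernel gives polynomial growth, but with an exponent depending on f. So the absorption is run
  twice: once to learn that f is bounded, once with the trivial weight to get a constant independent
  of f.\<close>

definition partial_deriv ::
  "'a::euclidean_space \<Rightarrow> ('a \<Rightarrow> complex) \<Rightarrow> 'a \<Rightarrow> complex" where
  "partial_deriv b f = (\<lambda>x. frechet_derivative f (at x) b)"

lemma partial_deriv_eqI:
  assumes "\<And>x. (f has_derivative D x) (at x)"
  shows "partial_deriv b f = (\<lambda>x. D x b)"
  unfolding partial_deriv_def frechet_derivative_at[OF assms, symmetric] ..

lemma iter_partial_append: "iter_partial (bs @ cs) f = iter_partial bs (iter_partial cs f)"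
  by (induction bs) auto

lemma iter_partial_in_family:
  assumes "\<And>f b. f \<in> F \<Longrightarrow> b \<in> Basis \<Longrightarrow> partial_deriv b f \<in> F"
    and "f \<in> F" "set bs \<subseteq> Basis"
  shows "iter_partial bs f \<in> F"
  using assms(3)
proof (induction bs)
  case (Cons b bs)
  then show ?case using assms(1)[of "iter_partial bs f" b] by (simp add: partial_deriv_def)
qed (use assms(2) in simp)

text \<open>Iterated partial derivatives never leave a family that is closed under partial
  differentiation. Each smoothness proof below thus consists of one first derivative and the choice
  of such a family; higher derivatives are never written down.\<close>

lemma smooth_coinduct:
  assumes "f \<in> F"
    and "\<And>f. f \<in> F \<Longrightarrow>
      \<exists>D. (\<forall>x. (f has_derivative D x) (at x)) \<and> (\<forall>b\<in>Basis. (\<lambda>x. D x b) \<in> F)"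
  shows "smooth f"
  unfolding smooth_def
proof (intro allI impI)
  fix bs :: "'a list" and x :: 'a
  assume bs: "set bs \<subseteq> Basis"
  have "iter_partial bs f \<in> F"
  proof (rule iter_partial_in_family[OF _ assms(1) bs])
    fix g b assume "g \<in> F" "b \<in> (Basis :: 'a set)"
    then obtain D where D: "\<And>x. (g has_derivative D x) (at x)" "(\<lambda>x. D x b) \<in> F"
      using assms(2)[of g] by blast
    show "partial_deriv b g \<in> F" unfolding partial_deriv_eqI[OF D(1)] by (rule D(2))
  qed
  then show "iter_partial bs f differentiable at x"
    using assms(2)[of "iter_partial bs f"] unfolding differentiable_def by blast
qed

lemma smooth_has_derivative:
  assumes "smooth f"
  shows "(f has_derivative frechet_derivative f (at x)) (at x)"
proof -
  have "iter_partial [] f differentiable at x"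
    using assms unfolding smooth_def by (auto dest: spec[of _ "[]"])
  then show ?thesis by (simp add: frechet_derivative_works)
qed

lemma smooth_iter_partial:
  assumes "smooth f" "set cs \<subseteq> Basis"
  shows "smooth (iter_partial cs f)"
  unfolding smooth_def iter_partial_append[symmetric]
  using assms by (auto simp: smooth_def)

lemma smooth_partial_deriv:
  assumes "smooth f" "b \<in> Basis"
  shows "smooth (partial_deriv b f)"
  using smooth_iter_partial[of f "[b]"] assms by (simp add: partial_deriv_def)

lemma smooth_continuous_on: "smooth f \<Longrightarrow> continuous_on UNIV f"
  by (meson smooth_has_derivative has_derivative_continuous continuous_at_imp_continuous_on)

lemma smooth_borel_measurable: "smooth f \<Longrightarrow> f \<in> borel_measurable borel"
  by (simp add: borel_measurable_continuous_onI smooth_continuous_on)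

lemma smooth_const [simp, intro]: "smooth (\<lambda>x::'a::euclidean_space. c)"
proof (rule smooth_coinduct[where F = "range (\<lambda>c (x::'a). c)"])
  show "\<exists>D. (\<forall>x. (f has_derivative D x) (at x)) \<and> (\<forall>b\<in>Basis. (\<lambda>x. D x b) \<in> range (\<lambda>c x. c))"
    if "f \<in> range (\<lambda>c x. c)" for f :: "'a \<Rightarrow> complex"
    using that by (intro exI[of _ "\<lambda>x v. 0"]) auto
qed auto

lemma smooth_add [intro]:
  assumes "smooth f" "smooth g"
  shows "smooth (\<lambda>x. f x + g x)"
proof (rule smooth_coinduct[where F = "{h. \<exists>f g. smooth f \<and> smooth g \<and> h = (\<lambda>x. f x + g x)}"])
  fix h assume "h \<in> {h. \<exists>f g. smooth f \<and> smooth g \<and> h = (\<lambda>x::'a. f x + g x)}"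
  then obtain f g where fg: "smooth f" "smooth g" and h: "h = (\<lambda>x. f x + g x)" by blast
  have "(\<lambda>x. frechet_derivative f (at x) b + frechet_derivative g (at x) b)
      \<in> {h. \<exists>f g. smooth f \<and> smooth g \<and> h = (\<lambda>x. f x + g x)}" if "b \<in> Basis" for b
    using fg[THEN smooth_partial_deriv[OF _ that]] unfolding partial_deriv_def by blast
  then show "\<exists>D. (\<forall>x. (h has_derivative D x) (at x)) \<and>
    (\<forall>b\<in>Basis. (\<lambda>x. D x b) \<in> {h. \<exists>f g. smooth f \<and> smooth g \<and> h = (\<lambda>x. f x + g x)})"
    unfolding h using fg
    by (intro exI[of _ "\<lambda>x v. frechet_derivative f (at x) v + frechet_derivative g (at x) v"])
      (auto intro!: has_derivative_add smooth_has_derivative simp del: mem_Collect_eq)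
qed (use assms in blast)

text \<open>By the Leibniz rule one derivative of a product is a sum of two products, so products
  alone are not closed under differentiation; their finite sums are.\<close>

inductive_set product_sums :: "('a::euclidean_space \<Rightarrow> complex) set" where
  product: "smooth f \<Longrightarrow> smooth g \<Longrightarrow> (\<lambda>x. f x * g x) \<in> product_sums"
| plus: "f \<in> product_sums \<Longrightarrow> g \<in> product_sums \<Longrightarrow> (\<lambda>x. f x + g x) \<in> product_sums"

lemma smooth_mult [intro]:
  assumes "smooth f" "smooth g"
  shows "smooth (\<lambda>x. f x * g x)"
proof (rule smooth_coinduct[where F = product_sums])
  fix h :: "'a \<Rightarrow> complex" assume "h \<in> product_sums"
  then show "\<exists>D. (\<forall>x. (h has_derivative D x) (at x)) \<and> (\<forall>b\<in>Basis. (\<lambda>x. D x b) \<in> product_sums)"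
  proof induction
    case (product f g)
    have "(\<lambda>x. f x * frechet_derivative g (at x) b + frechet_derivative f (at x) b * g x)
        \<in> product_sums" if "b \<in> Basis" for b
      using that product smooth_partial_deriv[of _ b] unfolding partial_deriv_def
      by (intro product_sums.intros) auto
    then show ?case using product
      by (intro exI[of _ "\<lambda>x v. f x * frechet_derivative g (at x) v +
            frechet_derivative f (at x) v * g x"])
        (auto intro!: has_derivative_mult smooth_has_derivative)
  next
    case (plus f g)
    then obtain D E where "\<forall>x. (f has_derivative D x) (at x)" "\<forall>b\<in>Basis. (\<lambda>x. D x b) \<in> product_sums"
      "\<forall>x. (g has_derivative E x) (at x)" "\<forall>b\<in>Basis. (\<lambda>x. E x b) \<in> product_sums" by blast
    then show ?case
      by (intro exI[of _ "\<lambda>x v. D x v + E x v"]) (auto intro: has_derivative_add product_sums.plus)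
  qed
qed (use assms product_sums.product in blast)

lemma smooth_diff [intro]:
  assumes "smooth f" "smooth g"
  shows "smooth (\<lambda>x. f x - g x)"
  using smooth_add[OF assms(1) smooth_mult[OF smooth_const[of "-1"] assms(2)]] by simp

lemma smooth_affine:
  fixes f :: "'a::euclidean_space \<Rightarrow> complex"
  assumes "smooth f"
  shows "smooth (\<lambda>x. f (c *\<^sub>R x + a))"
proof (rule smooth_coinduct[where F = "{h. \<exists>f. smooth f \<and> h = (\<lambda>x. f (c *\<^sub>R x + a))}"])
  fix h assume "h \<in> {h. \<exists>f. smooth f \<and> h = (\<lambda>x. f (c *\<^sub>R x + a))}"
  then obtain f where f: "smooth f" and h: "h = (\<lambda>x. f (c *\<^sub>R x + a))" by blast
  have lin: "frechet_derivative f (at y) (c *\<^sub>R v) = c * frechet_derivative f (at y) v" for y v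
    using has_derivative_bounded_linear[OF smooth_has_derivative[OF f, of y]]
    by (simp add: linear_simps scaleR_conv_of_real)
  have "(h has_derivative (\<lambda>v. frechet_derivative f (at (c *\<^sub>R x + a)) (c *\<^sub>R v))) (at x)" for x
    unfolding h
    by (rule has_derivative_compose[of "\<lambda>x. c *\<^sub>R x + a" "\<lambda>v. c *\<^sub>R v" x UNIV f])
       (auto intro!: derivative_eq_intros smooth_has_derivative[OF f])
  moreover have "(\<lambda>x. frechet_derivative f (at (c *\<^sub>R x + a)) (c *\<^sub>R b))
      \<in> {h. \<exists>f. smooth f \<and> h = (\<lambda>x. f (c *\<^sub>R x + a))}" if "b \<in> Basis" for b
    using smooth_mult[OF smooth_const[of "of_real c"] smooth_partial_deriv[OF f that]]
    unfolding lin partial_deriv_def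
    by (intro CollectI exI[of _ "\<lambda>x. c * frechet_derivative f (at x) b"]) auto
  ultimately show "\<exists>D. (\<forall>x. (h has_derivative D x) (at x)) \<and>
    (\<forall>b\<in>Basis. (\<lambda>x. D x b) \<in> {h. \<exists>f. smooth f \<and> h = (\<lambda>x. f (c *\<^sub>R x + a))})"
    by (intro exI[of _ "\<lambda>x v. frechet_derivative f (at (c *\<^sub>R x + a)) (c *\<^sub>R v)"]) auto
qed (use assms in blast)

lemma smooth_cnj:
  assumes "smooth f"
  shows "smooth (\<lambda>x. cnj (f x))"
proof (rule smooth_coinduct[where F = "{h. \<exists>f. smooth f \<and> h = (\<lambda>x. cnj (f x))}"])
  fix h :: "'a \<Rightarrow> complex" assume "h \<in> {h. \<exists>f. smooth f \<and> h = (\<lambda>x. cnj (f x))}"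
  then obtain f where f: "smooth f" and h: "h = (\<lambda>x. cnj (f x))" by blast
  show "\<exists>D. (\<forall>x. (h has_derivative D x) (at x)) \<and>
    (\<forall>b\<in>Basis. (\<lambda>x. D x b) \<in> {h. \<exists>f. smooth f \<and> h = (\<lambda>x. cnj (f x))})"
    using f smooth_partial_deriv[OF f] unfolding h partial_deriv_def
    by (intro exI[of _ "\<lambda>x v. cnj (frechet_derivative f (at x) v)"])
      (auto intro!: has_derivative_cnj smooth_has_derivative)
qed (use assms in blast)

lemma smooth_inner: "smooth (\<lambda>x::'a::euclidean_space. of_real (x \<bullet> u))"
proof (rule smooth_coinduct[where F = "insert (\<lambda>x. of_real (x \<bullet> u)) (range (\<lambda>c (x::'a). c))"])
  fix f :: "'a \<Rightarrow> complex" assume "f \<in> insert (\<lambda>x. of_real (x \<bullet> u)) (range (\<lambda>c (x::'a). c))"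
  then show "\<exists>D. (\<forall>x. (f has_derivative D x) (at x)) \<and>
    (\<forall>b\<in>Basis. (\<lambda>x. D x b) \<in> insert (\<lambda>x. of_real (x \<bullet> u)) (range (\<lambda>c (x::'a). c)))"
  proof
    assume "f = (\<lambda>x. of_real (x \<bullet> u))"
    then show ?thesis
      by (intro exI[of _ "\<lambda>x v. of_real (v \<bullet> u)"]) (auto intro!: derivative_eq_intros)
  next
    assume "f \<in> range (\<lambda>c (x::'a). c)"
    then show ?thesis by (intro exI[of _ "\<lambda>x v. 0"]) auto
  qed
qed auto

lemma smooth_exp_inner:
  "smooth (\<lambda>x::'a::euclidean_space. exp (c * of_real (x \<bullet> u)))"
proof (rule smooth_coinduct[where F = "range (\<lambda>k (x::'a). k * exp (c * of_real (x \<bullet> u)))"])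
  show "(\<lambda>x. exp (c * of_real (x \<bullet> u))) \<in> range (\<lambda>k (x::'a). k * exp (c * of_real (x \<bullet> u)))"
    by (intro image_eqI[of _ _ 1]) auto
next
  fix f assume "f \<in> range (\<lambda>k (x::'a). k * exp (c * of_real (x \<bullet> u)))"
  then obtain k where f: "f = (\<lambda>x. k * exp (c * of_real (x \<bullet> u)))" by blast
  have "(f has_derivative (\<lambda>v. (k * c * of_real (v \<bullet> u)) * exp (c * of_real (x \<bullet> u)))) (at x)" for x
  proof -
    have "((\<lambda>x. c * of_real (x \<bullet> u)) has_derivative (\<lambda>v. c * of_real (v \<bullet> u))) (at x)"
      by (auto intro!: derivative_eq_intros)
    from has_derivative_compose[OF this has_field_derivative_imp_has_derivative[OF DERIV_exp]]
    show ?thesis unfolding f by (auto intro!: derivative_eq_intros simp: algebra_simps)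
  qed
  then show "\<exists>D. (\<forall>x. (f has_derivative D x) (at x)) \<and>
      (\<forall>b\<in>Basis. (\<lambda>x. D x b) \<in> range (\<lambda>k (x::'a). k * exp (c * of_real (x \<bullet> u))))"
    by (intro exI[of _ "\<lambda>x v. (k * c * of_real (v \<bullet> u)) * exp (c * of_real (x \<bullet> u))"]) auto
qed

section \<open>Closure properties of test functions\<close>

lemma test_functions_iff:
  "\<phi> \<in> test_functions \<longleftrightarrow> smooth \<phi> \<and> (\<exists>r. \<forall>x. norm x > r \<longrightarrow> \<phi> x = 0)"
proof -
  have "compact (closure {x. \<phi> x \<noteq> 0}) \<longleftrightarrow> (\<exists>r. \<forall>x. norm x > r \<longrightarrow> \<phi> x = 0)"
    by (auto simp: compact_closure bounded_iff) (metis linorder_not_le)+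
  then show ?thesis by (simp add: test_functions_def)
qed

lemma test_functions_smooth: "\<phi> \<in> test_functions \<Longrightarrow> smooth \<phi>"
  by (simp add: test_functions_iff)

lemma test_functions_mult:
  "\<phi> \<in> test_functions \<Longrightarrow> smooth f \<Longrightarrow> (\<lambda>x. f x * \<phi> x) \<in> test_functions"
  unfolding test_functions_iff by auto

lemma test_functions_mult':
  "\<phi> \<in> test_functions \<Longrightarrow> smooth f \<Longrightarrow> (\<lambda>x. \<phi> x * f x) \<in> test_functions"
  unfolding test_functions_iff by auto

lemma test_functions_diff:
  assumes "\<phi> \<in> test_functions" "\<psi> \<in> test_functions"
  shows "(\<lambda>x. \<phi> x - \<psi> x) \<in> test_functions"
proof -
  obtain r s where "\<forall>x. norm x > r \<longrightarrow> \<phi> x = 0" "\<forall>x. norm x > s \<longrightarrow> \<psi> x = 0"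
    using assms unfolding test_functions_iff by blast
  then show ?thesis using assms unfolding test_functions_iff
    by (auto intro!: exI[of _ "max r s"])
qed

lemma test_functions_affine:
  assumes "\<phi> \<in> test_functions" "c \<noteq> 0"
  shows "(\<lambda>x. \<phi> (c *\<^sub>R x + a)) \<in> test_functions"
proof -
  obtain r where r: "\<And>x. norm x > r \<Longrightarrow> \<phi> x = 0" using assms unfolding test_functions_iff by blast
  have "\<phi> (c *\<^sub>R x + a) = 0" if "norm x > (r + norm a) / \<bar>c\<bar>" for x
  proof (rule r)
    have "r + norm a < norm (c *\<^sub>R x)" using that assms(2) by (simp add: field_simps)
    then show "r < norm (c *\<^sub>R x + a)" using norm_diff_ineq[of "c *\<^sub>R x" a] by simp
  qed
  then show ?thesis using assms smooth_affine unfolding test_functions_iff by blast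
qed

lemma frechet_derivative_eq_0_outside_cball:
  fixes \<phi> :: "'a::euclidean_space \<Rightarrow> complex"
  assumes "\<And>x. norm x > r \<Longrightarrow> \<phi> x = 0" "norm x > r"
  shows "frechet_derivative \<phi> (at x) v = 0"
proof -
  have "((\<lambda>x. 0) has_derivative (\<lambda>v. 0)) (at x)" by simp
  then have "(\<phi> has_derivative (\<lambda>v. 0)) (at x)"
    by (rule has_derivative_transform_within_open[of _ _ _ UNIV "- cball 0 r"]) (use assms in auto)
  from frechet_derivative_at[OF this] show ?thesis by (rule fun_cong[symmetric])
qed

lemma test_functions_partial_deriv:
  assumes "\<phi> \<in> test_functions" "b \<in> Basis"
  shows "partial_deriv b \<phi> \<in> test_functions"
proof -
  obtain r where r: "\<And>x. norm x > r \<Longrightarrow> \<phi> x = 0" using assms unfolding test_functions_iff by blast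
  have "partial_deriv b \<phi> x = 0" if "norm x > r" for x
    unfolding partial_deriv_def using r that by (rule frechet_derivative_eq_0_outside_cball)
  then show ?thesis using assms smooth_partial_deriv unfolding test_functions_iff by blast
qed

lemma test_functions_bounded:
  assumes "\<phi> \<in> test_functions"
  obtains B where "B \<ge> 0" "\<And>x. norm (\<phi> x) \<le> B"
proof -
  obtain r where r: "\<And>x. norm x > r \<Longrightarrow> \<phi> x = 0" using assms unfolding test_functions_iff by blast
  have "compact (\<phi> ` cball 0 r)"
    by (rule compact_continuous_image)
      (use smooth_continuous_on[OF test_functions_smooth[OF assms]] continuous_on_subset in auto)
  from compact_imp_bounded[OF this] obtain B where "\<forall>y\<in>\<phi> ` cball 0 r. norm y \<le> B"
    unfolding bounded_iff by auto
  then have B: "norm (\<phi> x) \<le> B" if "x \<in> cball 0 r" for x using that by simp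
  then have "norm (\<phi> x) \<le> max B 0" for x
    using B[of x] r[of x] by (cases "norm x > r") (simp_all add: le_max_iff_disj)
  then show ?thesis using that[of "max B 0"] by auto
qed

lemma integrable_test_function:
  assumes "\<phi> \<in> test_functions"
  shows "integrable lborel \<phi>"
proof -
  obtain r where r: "\<And>x. norm x > r \<Longrightarrow> \<phi> x = 0" using assms unfolding test_functions_iff by blast
  have "set_integrable lborel (cball 0 r) \<phi>"
    unfolding set_integrable_def
    by (rule borel_integrable_compact) 
      (use smooth_continuous_on[OF test_functions_smooth[OF assms]] continuous_on_subset in auto)
  moreover have "(\<lambda>x. indicat_real (cball 0 r) x *\<^sub>R \<phi> x) = \<phi>"
    using r by (force simp: indicator_def)
  ultimately show ?thesis by (simp add: set_integrable_def)
qed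

section \<open>A bump function\<close>

text \<open>Differentiating exp(-1/t) brings out powers of 1/t; the index \<open>n\<close> records
  them, so that derivatives stay in the linear span of these functions.\<close>

definition bump_profile :: "nat \<Rightarrow> real \<Rightarrow> real" where
  "bump_profile n t = (if t > 0 then (1 / t) ^ n * exp (- 1 / t) else 0)"

text \<open>With y = 1/t, the single term of order n + 2 of the exponential series bounds y^(n+2) by
  (n+2)! exp(y). The two spare powers make the bound quadratic in t, so the difference quotient at 0
  tends to 0.\<close>

lemma bump_profile_le: "norm (bump_profile n t) \<le> fact (n + 2) * t\<^sup>2"
proof (cases "t > 0")
  case True
  define y where "y = 1 / t"
  have y: "y > 0" using True by (simp add: y_def)
  define F :: real where "F = fact (n + 2)"
  have F: "F > 0" by (simp add: F_def)
  have "y ^ (n + 2) / F \<le> exp y"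
    using sum_le_suminf[OF sums_summable[OF exp_converges[of y]], of "{n + 2}"] y
    unfolding F_def by (simp add: exp_def divide_inverse mult.commute del: fact_Suc)
  then have "y ^ n * y\<^sup>2 \<le> F * exp y"
    using F by (simp add: power_add power2_eq_square pos_divide_le_eq mult_ac)
  then have "y ^ n * exp (- y) \<le> F * (1 / y)\<^sup>2"
    using y by (simp add: exp_minus field_simps)
  then show ?thesis using True unfolding F_def by (simp add: bump_profile_def y_def)
qed (simp add: bump_profile_def)

lemma bump_profile_has_derivative:
  "(bump_profile n has_real_derivative
     (bump_profile (n + 2) t - of_nat n * bump_profile (n + 1) t)) (at t)"
proof -
  consider "t > 0" | "t < 0" | "t = 0" by linarith
  then show ?thesis
  proof cases
    case 1
    have "((\<lambda>t. (1 / t) ^ n * exp (- 1 / t)) has_real_derivative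
       (bump_profile (n + 2) t - of_nat n * bump_profile (n + 1) t)) (at t)"
      using 1 by (auto intro!: derivative_eq_intros simp: bump_profile_def)
         (cases n; simp add: field_simps power2_eq_square)
    then show ?thesis
      by (rule has_field_derivative_transform_within_open[of _ _ _ "{0<..}"])
        (use 1 in \<open>auto simp: bump_profile_def\<close>)
  next
    case 2
    have "((\<lambda>t. 0) has_real_derivative 0) (at t)" by simp
    then have "(bump_profile n has_real_derivative 0) (at t)"
      by (rule has_field_derivative_transform_within_open[of _ _ _ "{..<0}"])
        (use 2 in \<open>auto simp: bump_profile_def\<close>)
    then show ?thesis using 2 by (simp add: bump_profile_def)
  next
    case 3
    have "((\<lambda>y. (bump_profile n y - bump_profile n 0) / (y - 0)) \<longlongrightarrow> 0) (at 0)"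
    proof (rule Lim_null_comparison)
      have "norm ((bump_profile n y - bump_profile n 0) / (y - 0)) \<le> fact (n + 2) * \<bar>y\<bar>" for y
        using bump_profile_le[of n y] unfolding power2_abs[of y, symmetric]
        by (cases "y = 0")
          (auto simp: bump_profile_def[of n 0] power2_eq_square pos_divide_le_eq mult.assoc
            simp del: fact_Suc abs_mult_self_eq)
      then show "\<forall>\<^sub>F y in at 0. norm ((bump_profile n y - bump_profile n 0) / (y - 0)) \<le> fact (n + 2) * \<bar>y\<bar>"
        by simp
      show "((\<lambda>y. fact (n + 2) * \<bar>y\<bar>) \<longlongrightarrow> 0) (at (0::real))"
        by (rule tendsto_eq_intros refl)+ simp
    qed
    then show ?thesis using 3 by (simp add: has_field_derivative_iff bump_profile_def[of _ 0])
  qed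
qed

text \<open>Composing with 1 - |x|^2 adds a factor \<open>- 2 * (x \<bullet> b)\<close> at every
  derivative, hence the closure under multiplication by linear functions.\<close>

inductive_set bump_family :: "('a::euclidean_space \<Rightarrow> complex) set" where
  profile: "(\<lambda>x. of_real (bump_profile n (1 - x \<bullet> x))) \<in> bump_family"
| coordinate: "f \<in> bump_family \<Longrightarrow> (\<lambda>x. of_real (x \<bullet> u) * f x) \<in> bump_family"
| scale: "f \<in> bump_family \<Longrightarrow> (\<lambda>x. c * f x) \<in> bump_family"
| plus: "f \<in> bump_family \<Longrightarrow> g \<in> bump_family \<Longrightarrow> (\<lambda>x. f x + g x) \<in> bump_family"

lemma smooth_bump_profile: "smooth (\<lambda>x::'a::euclidean_space. of_real (bump_profile n (1 - x \<bullet> x)))"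
proof (rule smooth_coinduct[where F = bump_family])
  fix f :: "'a \<Rightarrow> complex" assume "f \<in> bump_family"
  then show "\<exists>D. (\<forall>x. (f has_derivative D x) (at x)) \<and> (\<forall>b\<in>Basis. (\<lambda>x. D x b) \<in> bump_family)"
  proof induction
    case (profile n)
    define g where "g = (\<lambda>t. bump_profile (n + 2) t - of_nat n * bump_profile (n + 1) t)"
    define D :: "'a \<Rightarrow> 'a \<Rightarrow> complex"
      where "D = (\<lambda>x v. of_real (- 2 * (x \<bullet> v) * g (1 - x \<bullet> x)))"
    have "((\<lambda>x::'a. complex_of_real (bump_profile n (1 - x \<bullet> x))) has_derivative D x) (at x)" for x
    proof -
      have "((\<lambda>x::'a. 1 - x \<bullet> x) has_derivative (\<lambda>v. - 2 * (x \<bullet> v))) (at x)"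
        by (auto intro!: derivative_eq_intros simp: inner_commute)
      from has_derivative_compose[OF this has_field_derivative_imp_has_derivative[OF bump_profile_has_derivative]]
      have "((\<lambda>x::'a. bump_profile n (1 - x \<bullet> x)) has_derivative
          (\<lambda>v. - 2 * (x \<bullet> v) * g (1 - x \<bullet> x))) (at x)"
        by (simp add: g_def mult_ac)
      then show ?thesis unfolding D_def by (rule has_derivative_of_real)
    qed
    moreover have "(\<lambda>x. D x b) \<in> bump_family" for b
    proof -
      have "(\<lambda>x::'a. complex_of_real (x \<bullet> b) * (- 2 * (of_real (bump_profile (n + 2) (1 - x \<bullet> x))
          + (- of_nat n) * of_real (bump_profile (n + 1) (1 - x \<bullet> x))))) \<in> bump_family"
        by (intro bump_family.intros)
      then show ?thesis by (simp add: D_def g_def algebra_simps)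
    qed
    ultimately show ?case by blast
  next
    case (coordinate f u)
    then obtain D where D: "\<And>x. (f has_derivative D x) (at x)"
      "\<And>b. b \<in> Basis \<Longrightarrow> (\<lambda>x. D x b) \<in> bump_family" by blast
    have "((\<lambda>x. of_real (x \<bullet> u) * f x) has_derivative
        (\<lambda>v. of_real (x \<bullet> u) * D x v + of_real (v \<bullet> u) * f x)) (at x)" for x
      by (rule has_derivative_mult) (auto intro!: derivative_eq_intros D)
    moreover have "(\<lambda>x. of_real (x \<bullet> u) * D x b + of_real (b \<bullet> u) * f x) \<in> bump_family"
      if "b \<in> Basis" for b using D(2)[OF that] coordinate.hyps by (intro bump_family.intros)
    ultimately show ?case
      by (intro exI[of _ "\<lambda>x v. of_real (x \<bullet> u) * D x v + of_real (v \<bullet> u) * f x"]) blast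
  next
    case (scale f c)
    then obtain D where D: "\<And>x. (f has_derivative D x) (at x)"
      "\<And>b. b \<in> Basis \<Longrightarrow> (\<lambda>x. D x b) \<in> bump_family" by blast
    then show ?case
      by (intro exI[of _ "\<lambda>x v. c * D x v"]) (auto intro!: derivative_eq_intros bump_family.scale)
  next
    case (plus f g)
    then obtain D E where "\<And>x. (f has_derivative D x) (at x)"
      "\<And>b. b \<in> Basis \<Longrightarrow> (\<lambda>x. D x b) \<in> bump_family"
      "\<And>x. (g has_derivative E x) (at x)"
      "\<And>b. b \<in> Basis \<Longrightarrow> (\<lambda>x. E x b) \<in> bump_family" by blast
    then show ?case
      by (intro exI[of _ "\<lambda>x v. D x v + E x v"]) (auto intro!: derivative_eq_intros bump_family.plus)
  qed
qed (rule bump_family.profile)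

lemma integral_pos_continuous:
  fixes g :: "'a::euclidean_space \<Rightarrow> real"
  assumes int: "integrable lborel g" and cont: "continuous_on UNIV g"
    and nonneg: "\<And>x. g x \<ge> 0" and pos: "g a > 0"
  shows "(LINT x|lborel. g x) > 0"
proof -
  have "(LINT x|lborel. g x) \<noteq> 0"
  proof
    assume "(LINT x|lborel. g x) = 0"
    then have ae: "AE x in lborel. g x = 0"
      using integral_nonneg_eq_0_iff_AE[OF int] nonneg by simp
    have "open {x. g x > 0}" using cont by (intro open_Collect_less continuous_on_const)
    then obtain e where e: "e > 0" "ball a e \<subseteq> {x. g x > 0}" using pos openE by blast
    have "AE x in lborel. x \<notin> ball a e"
      using ae by (rule eventually_mono) (use e in force)
    then have "emeasure lborel (ball a e) = 0"
      by (subst (asm) AE_iff_measurable[OF _ refl]) (auto simp: ball_def)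
    then show False using content_ball_pos[OF e(1), of a] by (simp add: measure_def)
  qed
  moreover have "(LINT x|lborel. g x) \<ge> 0" using nonneg by simp
  ultimately show ?thesis by simp
qed

lemma mollifier_exists:
  obtains h :: "'a::euclidean_space \<Rightarrow> real"
  where "(\<lambda>x. complex_of_real (h x)) \<in> test_functions" "\<And>x. h x \<ge> 0"
    "\<And>x. norm x \<ge> 1 \<Longrightarrow> h x = 0" "\<And>x. norm x < 1 \<Longrightarrow> h x > 0"
    "(LINT x|lborel. h x) = 1"
proof -
  define g where "g = (\<lambda>x::'a. bump_profile 0 (1 - x \<bullet> x))"
  have lt1: "x \<bullet> x < 1 \<longleftrightarrow> norm x < 1" for x :: 'a
    by (simp add: norm_eq_sqrt_inner)
  have g: "g x \<ge> 0" "norm x \<ge> 1 \<Longrightarrow> g x = 0" "norm x < 1 \<Longrightarrow> g x > 0" for x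
    using lt1[of x] by (auto simp: g_def bump_profile_def)
  have test: "(\<lambda>x. complex_of_real (g x)) \<in> test_functions"
    unfolding test_functions_iff using smooth_bump_profile[of 0] g(2)
    by (auto simp: g_def intro!: exI[of _ 1])
  have int: "integrable lborel g"
    using integrable_Re[OF integrable_test_function[OF test]] by simp
  have "continuous_on UNIV (\<lambda>x. Re (complex_of_real (g x)))"
    by (intro continuous_intros smooth_continuous_on test_functions_smooth test)
  then have I: "(LINT x|lborel. g x) > 0"
    by (intro integral_pos_continuous[OF int, where a = 0]) (simp_all add: g)
  define c where "c = (LINT x|lborel. g x)"
  show ?thesis
  proof (rule that[of "\<lambda>x. g x / c"])
    show "(\<lambda>x. complex_of_real (g x / c)) \<in> test_functions"
      using test_functions_mult[OF test smooth_const[of "1 / of_real c"]] by simp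
  qed (use g I in \<open>auto simp: c_def\<close>)
qed

section \<open>Integrals depending on a parameter\<close>

text \<open>The mean value inequality converts the uniform bound on \<open>D\<close> into the
  dominating function \<open>2 * B\<close> for the remainder quotients, and dominated convergence is
  applied along each sequence tending to \<open>x\<close>.\<close>

lemma has_derivative_integral:
  fixes f :: "'a::euclidean_space \<Rightarrow> 'b \<Rightarrow> complex"
  assumes D: "\<And>x y. ((\<lambda>x. f x y) has_derivative D x y) (at x)"
    and int: "\<And>x. integrable M (f x)"
    and meas: "\<And>x v. (\<lambda>y. D x y v) \<in> borel_measurable M"
    and bound: "\<And>x y v. norm (D x y v) \<le> B y * norm v" and B: "integrable M B"
  shows "((\<lambda>x. LINT y|M. f x y) has_derivative (\<lambda>v. LINT y|M. D x y v)) (at x)"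
proof -
  have intD: "integrable M (\<lambda>y. D x y v)" for x v
    by (rule Bochner_Integration.integrable_bound[of M "\<lambda>y. B y * norm v"])
      (use B meas in \<open>auto intro!: AE_I2 order_trans[OF bound]\<close>)
  have lin: "bounded_linear (D x y)" for y using D by (rule has_derivative_bounded_linear)
  have "bounded_linear (\<lambda>v. LINT y|M. D x y v)"
  proof (rule bounded_linear_intro[where K = "LINT y|M. B y"])
    fix v
    have "norm (LINT y|M. D x y v) \<le> (LINT y|M. B y * norm v)"
      by (rule order_trans[OF integral_norm_bound integral_mono]) (use intD B bound in auto)
    then show "norm (LINT y|M. D x y v) \<le> norm v * (LINT y|M. B y)" by (simp add: mult.commute)
  qed (use lin intD in \<open>simp_all add: linear_simps scaleR_conv_of_real\<close>)
  moreover have "((\<lambda>z. ((LINT y|M. f z y) - (LINT y|M. f x y)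
      - (LINT y|M. D x y (z - x))) /\<^sub>R norm (z - x)) \<longlongrightarrow> 0) (at x)"
    unfolding tendsto_at_iff_sequentially
  proof (intro allI impI)
    fix X assume X: "\<forall>i. X i \<in> UNIV - {x}" "X \<longlonglongrightarrow> x"
    define g where "g = (\<lambda>i y. (f (X i) y - f x y - D x y (X i - x)) /\<^sub>R norm (X i - x))"
    have "(\<lambda>i. LINT y|M. g i y) \<longlonglongrightarrow> (LINT y|M. 0)"
    proof (rule integral_dominated_convergence[where w = "\<lambda>y. 2 * B y"])
      show "AE y in M. (\<lambda>i. g i y) \<longlonglongrightarrow> 0"
      proof (rule AE_I2)
        fix y
        have "((\<lambda>z. (f z y - f x y - D x y (z - x)) /\<^sub>R norm (z - x)) \<longlongrightarrow> 0) (at x)"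
          using D[of y x] by (simp add: has_derivative_at_within)
        then show "(\<lambda>i. g i y) \<longlonglongrightarrow> 0"
          using X unfolding tendsto_at_iff_sequentially by (auto simp: g_def o_def)
      qed
      show "AE y in M. norm (g i y) \<le> 2 * B y" for i
      proof (rule AE_I2)
        fix y
        have "norm (f (X i) y - f x y) \<le> B y * norm (X i - x)"
          by (rule differentiable_bound[of UNIV "\<lambda>x. f x y" "\<lambda>x. D x y"])
            (auto intro!: D onorm_le bound)
        moreover have "norm (D x y (X i - x)) \<le> B y * norm (X i - x)" by (rule bound)
        ultimately have "norm (f (X i) y - f x y - D x y (X i - x)) \<le> 2 * B y * norm (X i - x)"
          using norm_triangle_ineq4[of "f (X i) y - f x y" "D x y (X i - x)"] by linarith
        moreover have "norm (X i - x) > 0" using X(1) by auto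
        ultimately show "norm (g i y) \<le> 2 * B y"
          by (simp add: g_def divide_inverse[symmetric] mult.commute[of "inverse _"] pos_divide_le_eq)
      qed
      show "(\<lambda>y. g i y) \<in> borel_measurable M" for i
        unfolding g_def using int intD by (intro borel_measurable_integrable) auto
    qed (use B in auto)
    moreover have "(LINT y|M. g i y) = ((LINT y|M. f (X i) y) - (LINT y|M. f x y)
        - (LINT y|M. D x y (X i - x))) /\<^sub>R norm (X i - x)" for i
      unfolding g_def using int intD by simp
    ultimately show "((\<lambda>z. ((LINT y|M. f z y) - (LINT y|M. f x y)
      - (LINT y|M. D x y (z - x))) /\<^sub>R norm (z - x)) \<circ> X) \<longlonglongrightarrow> 0"
      by (simp add: o_def)
  qed
  ultimately show ?thesis by (simp add: has_derivative_at_within)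
qed

section \<open>Affine changes of variables\<close>

lemma nn_integral_lborel_affine:
  fixes c :: real and t :: "'a::euclidean_space"
  assumes "c \<noteq> 0" and [measurable]: "f \<in> borel_measurable borel"
  shows "(\<integral>\<^sup>+x. f x \<partial>lborel) = ennreal (\<bar>c\<bar> ^ DIM('a)) * (\<integral>\<^sup>+x. f (t + c *\<^sub>R x) \<partial>lborel)"
  by (subst lborel_affine[OF assms(1), of t])
    (simp add: nn_integral_density nn_integral_distr nn_integral_cmult)

lemma integrable_lborel_affine:
  fixes f :: "'a::euclidean_space \<Rightarrow> 'b::{banach, second_countable_topology}"
  assumes c: "c \<noteq> 0"
  shows "integrable lborel (\<lambda>x. f (t + c *\<^sub>R x)) \<longleftrightarrow> integrable lborel f"
proof -
  have *: "integrable lborel (\<lambda>x. f (t + c *\<^sub>R x))" if f: "integrable lborel f" and "c \<noteq> 0"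
    for f :: "'a \<Rightarrow> 'b" and c t
  proof -
    have [measurable]: "f \<in> borel_measurable borel" using f by auto
    have "ennreal (\<bar>c\<bar> ^ DIM('a)) * (\<integral>\<^sup>+x. ennreal (norm (f (t + c *\<^sub>R x))) \<partial>lborel) < \<infinity>"
      using f nn_integral_lborel_affine[OF that(2), of "\<lambda>x. ennreal (norm (f x))" t]
      by (simp add: integrable_iff_bounded)
    then show ?thesis using that(2)
      by (auto simp: integrable_iff_bounded ennreal_mult_less_top)
  qed
  show ?thesis
  proof
    assume "integrable lborel (\<lambda>x. f (t + c *\<^sub>R x))"
    from *[OF this, of "1 / c" "- t /\<^sub>R c"] show "integrable lborel f"
      using c by (simp add: scaleR_diff_right)
  qed (use * c in blast)
qed

text \<open>Dilation and translation preserve integrability in both directions, and where it fails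
  both integrals have the default value 0, so the formula holds for every \<open>f\<close>.\<close>

lemma integral_lborel_affine:
  fixes f :: "'a::euclidean_space \<Rightarrow> 'b::{banach, second_countable_topology}"
  assumes c: "c \<noteq> 0"
  shows "(LINT x|lborel. f x) = (\<bar>c\<bar> ^ DIM('a)) *\<^sub>R (LINT x|lborel. f (t + c *\<^sub>R x))"
proof (cases "integrable lborel f")
  case True
  then have [measurable]: "f \<in> borel_measurable borel" by auto
  show ?thesis
    by (subst lborel_affine[OF assms(1), of t]) (simp add: integral_density integral_distr)
next
  case False
  then show ?thesis using integrable_lborel_affine[OF c, of f t] by (simp add: not_integrable_integral_eq)
qed

section \<open>Rapidly decreasing functions\<close>

text \<open>Dyadic balls replace polar coordinates: where 2^j <= 1 + |x| the integrand is at most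
  2^(-j(d+1)), and the ball of radius 2^(j+1) has volume of order 2^(jd), leaving a geometric series
  with ratio 1/2.\<close>

lemma integrable_inverse_power:
  "integrable lborel (\<lambda>x::'a::euclidean_space. 1 / (1 + norm x) ^ (DIM('a) + 1))"
proof -
  define d where "d = DIM('a)"
  define u where "u = (\<lambda>(j::nat) (x::'a). ennreal ((1 / 2) ^ (j * (d + 1))) * indicator (ball 0 (2 ^ (j + 1))) x)"
  have le: "ennreal (1 / (1 + norm x) ^ (d + 1)) \<le> (\<Sum>j. u j x)" for x :: 'a
  proof -
    obtain j :: nat where j: "norm x < 2 ^ (j + 1)" "2 ^ j \<le> 1 + norm x"
    proof -
      \<comment> \<open>If the least exponent is 0, then \<open>j = 0\<close> works because 1 <= 1 +
        |x|; otherwise minimality gives 2^j <= |x| for its predecessor.\<close>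
      define m where "m = (LEAST m::nat. norm x < 2 ^ m)"
      have ex: "\<exists>m::nat. norm x < 2 ^ m" by (rule real_arch_pow) simp
      have m: "norm x < 2 ^ m" unfolding m_def using ex by (rule LeastI_ex)
      show ?thesis
      proof (cases m)
        case 0
        then show ?thesis using m that[of 0] by simp
      next
        case (Suc j)
        have "\<not> norm x < 2 ^ j" using not_less_Least[of j "\<lambda>m. norm x < 2 ^ m"] Suc m_def by simp
        then show ?thesis using m Suc that[of j] by simp
      qed
    qed
    have "(2 ^ j) ^ (d + 1) \<le> (1 + norm x) ^ (d + 1)" using j(2) by (intro power_mono) auto
    then have "1 / (1 + norm x) ^ (d + 1) \<le> (1 / 2) ^ (j * (d + 1))"
      unfolding power_mult power_one_over[symmetric] by (simp add: power_one_over frac_le)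
    then have "ennreal (1 / (1 + norm x) ^ (d + 1)) \<le> u j x"
      using j(1) by (simp add: u_def ennreal_leI)
    also have "\<dots> \<le> (\<Sum>j. u j x)" using sum_le_suminf[of "\<lambda>j. u j x" "{j}"] by simp
    finally show ?thesis .
  qed
  have geo: "summable (\<lambda>j. (1 / 2) ^ j * (2 ^ d * unit_ball_vol (real d)))"
    by (intro summable_mult2 summable_geometric) simp
  have "(\<integral>\<^sup>+x. ennreal (1 / (1 + norm x) ^ (d + 1)) \<partial>(lborel :: 'a measure))
      \<le> (\<integral>\<^sup>+x. (\<Sum>j. u j x) \<partial>lborel)"
    by (intro nn_integral_mono le)
  also have "\<dots> = (\<Sum>j. \<integral>\<^sup>+x. u j x \<partial>lborel)"
    unfolding u_def
    by (intro nn_integral_suminf borel_measurable_times_ennreal borel_measurable_const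
        borel_measurable_indicator) (simp add: borel_open)
  also have "\<dots> = (\<Sum>j. ennreal ((1 / 2) ^ j * (2 ^ d * unit_ball_vol (real d))))"
  proof (intro suminf_cong)
    fix j :: nat
    have "(\<integral>\<^sup>+x. u j x \<partial>lborel) = ennreal ((1 / 2) ^ (j * (d + 1))) * emeasure lborel (ball (0::'a) (2 ^ (j + 1)))"
      unfolding u_def by (rule nn_integral_cmult_indicator) simp
    also have "\<dots> = ennreal ((1 / 2) ^ (j * (d + 1)) * (unit_ball_vol (real d) * (2 ^ (j + 1)) ^ d))"
      by (subst emeasure_ball) (auto simp: d_def ennreal_mult unit_ball_vol_nonneg)
    also have "(1 / 2 :: real) ^ (j * (d + 1)) * (unit_ball_vol (real d) * (2 ^ (j + 1)) ^ d)
        = (1 / 2) ^ j * (2 ^ d * unit_ball_vol (real d))"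
      by (simp add: power_mult[symmetric] power_add algebra_simps power_one_over)
    finally show "(\<integral>\<^sup>+x. u j x \<partial>lborel) = ennreal ((1 / 2) ^ j * (2 ^ d * unit_ball_vol (real d)))" .
  qed
  also have "\<dots> = ennreal (\<Sum>j. (1 / 2) ^ j * (2 ^ d * unit_ball_vol (real d)))"
    by (rule suminf_ennreal2[OF _ geo]) simp
  also have "\<dots> < \<infinity>" by simp
  finally show ?thesis
    unfolding d_def[symmetric] by (intro integrableI_nonneg) (auto intro: AE_I2)
qed

definition rapidly_decreasing :: "('a::real_normed_vector \<Rightarrow> 'b::real_normed_vector) \<Rightarrow> bool" where
  "rapidly_decreasing f \<longleftrightarrow> (\<forall>n. \<exists>C. \<forall>x. (1 + norm x) ^ n * norm (f x) \<le> C)"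

text \<open>Submultiplicativity of the weight 1 + |x|, in the spirit of Peetre's inequality: this is
  how polynomial weights are moved from one point to another throughout.\<close>

lemma one_plus_norm_le_mult: "1 + norm x \<le> (1 + norm y) * (1 + norm (x - y))"
proof -
  have "(1 + norm y) * (1 + norm (x - y)) = 1 + (norm y + norm (x - y)) + norm y * norm (x - y)"
    by (simp add: algebra_simps)
  moreover have "norm x \<le> norm y + norm (x - y)" using norm_triangle_ineq[of y "x - y"] by simp
  moreover have "0 \<le> norm y * norm (x - y)" by simp
  ultimately show ?thesis by linarith
qed

lemma rapidly_decreasingE:
  assumes "rapidly_decreasing f"
  obtains C where "C > 0" "\<And>x. (1 + norm x) ^ n * norm (f x) \<le> C"
proof -
  obtain C where C: "\<And>x. (1 + norm x) ^ n * norm (f x) \<le> C"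
    using assms unfolding rapidly_decreasing_def by blast
  have "(1 + norm x) ^ n * norm (f x) \<le> max C 1" for x using C[of x] by simp
  then show ?thesis using that[of "max C 1"] by simp
qed

lemma rapidly_decreasing_weight:
  assumes "rapidly_decreasing f"
  shows "rapidly_decreasing (\<lambda>x. (1 + norm x) ^ m * norm (f x))"
  unfolding rapidly_decreasing_def
proof
  fix n
  obtain C where "\<And>x. (1 + norm x) ^ (n + m) * norm (f x) \<le> C"
    using rapidly_decreasingE[OF assms, of "n + m"] by metis
  then show "\<exists>C. \<forall>x. (1 + norm x) ^ n * norm ((1 + norm x) ^ m * norm (f x)) \<le> C"
    by (auto simp: power_add mult.assoc)
qed

lemma integrable_rapidly_decreasing:
  fixes f :: "'a::euclidean_space \<Rightarrow> 'b::{banach, second_countable_topology}"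
  assumes [measurable]: "f \<in> borel_measurable borel" and "rapidly_decreasing f"
  shows "integrable lborel f"
proof -
  obtain C where C: "\<And>x. (1 + norm x) ^ (DIM('a) + 1) * norm (f x) \<le> C"
    using rapidly_decreasingE[OF assms(2)] by metis
  show ?thesis
  proof (rule Bochner_Integration.integrable_bound)
    show "integrable lborel (\<lambda>x::'a. C * (1 / (1 + norm x) ^ (DIM('a) + 1)))"
      by (intro integrable_mult_right integrable_inverse_power)
    have "norm (f x) \<le> norm (C * (1 / (1 + norm x) ^ (DIM('a) + 1)))" for x
    proof -
      have "(0::real) < (1 + norm x) ^ (DIM('a) + 1)" by (intro zero_less_power) (simp add: add_pos_nonneg)
      then have "norm (f x) \<le> C / (1 + norm x) ^ (DIM('a) + 1)"
        using C[of x] by (simp add: pos_le_divide_eq mult.commute del: power_Suc)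
      then show ?thesis using abs_ge_self[of "C / (1 + norm x) ^ (DIM('a) + 1)"] by simp
    qed
    then show "AE x in lborel. norm (f x) \<le> norm (C * (1 / (1 + norm x) ^ (DIM('a) + 1)))"
      by simp
  qed simp
qed

section \<open>Schwartz functions\<close>

lemma schwartz_coinduct:
  assumes "f \<in> F"
    and "\<And>f. f \<in> F \<Longrightarrow>
      \<exists>D. (\<forall>x. (f has_derivative D x) (at x)) \<and> (\<forall>b\<in>Basis. (\<lambda>x. D x b) \<in> F)"
    and "\<And>f. f \<in> F \<Longrightarrow> rapidly_decreasing f"
  shows "f \<in> schwartz"
proof -
  have "iter_partial bs f \<in> F" if "set bs \<subseteq> Basis" for bs
  proof (rule iter_partial_in_family[OF _ assms(1) that])
    fix g b assume "g \<in> F" "b \<in> (Basis :: 'a set)"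
    then obtain D where D: "\<And>x. (g has_derivative D x) (at x)" "(\<lambda>x. D x b) \<in> F"
      using assms(2)[of g] by blast
    show "partial_deriv b g \<in> F" unfolding partial_deriv_eqI[OF D(1)] by (rule D(2))
  qed
  then have rd: "rapidly_decreasing (iter_partial bs f)" if "set bs \<subseteq> Basis" for bs
    using assms(3) that by blast
  have "bounded (range (\<lambda>x. (1 + norm x) ^ n * norm (iter_partial bs f x)))"
    if bs: "set bs \<subseteq> Basis" for n bs
  proof -
    obtain C where "\<And>x. (1 + norm x) ^ n * norm (iter_partial bs f x) \<le> C"
      using rapidly_decreasingE[OF rd[OF bs], of n] by metis
    then show ?thesis unfolding bounded_iff by (auto intro!: exI[of _ C])
  qed
  moreover have "smooth f" by (rule smooth_coinduct[OF assms(1,2)])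
  ultimately show ?thesis by (simp add: schwartz_def)
qed

lemma schwartz_iter_partial_rapidly_decreasing:
  assumes "\<phi> \<in> schwartz" "set bs \<subseteq> Basis"
  shows "rapidly_decreasing (iter_partial bs \<phi>)"
  unfolding rapidly_decreasing_def
proof
  fix n
  have "bounded (range (\<lambda>x. (1 + norm x) ^ n * norm (iter_partial bs \<phi> x)))"
    using assms unfolding schwartz_def by blast
  then obtain C where "\<And>x. norm ((1 + norm x) ^ n * norm (iter_partial bs \<phi> x)) \<le> C"
    unfolding bounded_iff by blast
  then show "\<exists>C. \<forall>x. (1 + norm x) ^ n * norm (iter_partial bs \<phi> x) \<le> C"
    by (metis abs_le_D1 real_norm_def)
qed

lemma schwartz_rapidly_decreasing: "\<phi> \<in> schwartz \<Longrightarrow> rapidly_decreasing \<phi>"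
  using schwartz_iter_partial_rapidly_decreasing[of \<phi> "[]"] by simp

lemma schwartz_smooth: "\<phi> \<in> schwartz \<Longrightarrow> smooth \<phi>"
  by (simp add: schwartz_def)

lemma integrable_schwartz: "\<phi> \<in> schwartz \<Longrightarrow> integrable lborel \<phi>"
  by (intro integrable_rapidly_decreasing smooth_borel_measurable schwartz_smooth
      schwartz_rapidly_decreasing)

lemma rapidly_decreasing_compact_support:
  assumes "\<And>x. norm x > r \<Longrightarrow> f x = 0" "\<And>x. norm (f x) \<le> B"
  shows "rapidly_decreasing f"
  unfolding rapidly_decreasing_def
proof (intro allI)
  fix n
  have "B \<ge> 0" using norm_ge_zero order_trans assms(2) by blast
  have "(1 + norm x) ^ n * norm (f x) \<le> (1 + \<bar>r\<bar>) ^ n * B" for x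
  proof (cases "norm x > r")
    case True
    then show ?thesis using assms(1) \<open>B \<ge> 0\<close> by simp
  next
    case False
    then show ?thesis by (intro mult_mono power_mono assms(2)) auto
  qed
  then show "\<exists>C. \<forall>x. (1 + norm x) ^ n * norm (f x) \<le> C" by blast
qed

lemma test_functions_rapidly_decreasing:
  assumes "\<phi> \<in> test_functions"
  shows "rapidly_decreasing \<phi>"
proof -
  obtain B where "\<And>x. norm (\<phi> x) \<le> B" using test_functions_bounded[OF assms] by metis
  moreover obtain r where "\<And>x. norm x > r \<Longrightarrow> \<phi> x = 0" using assms unfolding test_functions_iff by blast
  ultimately show ?thesis by (intro rapidly_decreasing_compact_support) auto
qed

lemma frechet_derivative_eq_sum_partial_deriv:
  assumes "smooth f"
  shows "frechet_derivative f (at x) v = (\<Sum>b\<in>Basis. (v \<bullet> b) *\<^sub>R partial_deriv b f x)"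
proof -
  interpret bounded_linear "frechet_derivative f (at x)"
    by (rule has_derivative_bounded_linear[OF smooth_has_derivative[OF assms]])
  have "frechet_derivative f (at x) (\<Sum>b\<in>Basis. (v \<bullet> b) *\<^sub>R b)
      = (\<Sum>b\<in>Basis. (v \<bullet> b) *\<^sub>R partial_deriv b f x)"
    by (simp add: sum scaleR partial_deriv_def)
  then show ?thesis by (simp add: euclidean_representation)
qed

lemma test_functions_derivative_bounded:
  fixes \<phi> :: "'a::euclidean_space \<Rightarrow> complex"
  assumes "\<phi> \<in> test_functions"
  obtains B where "\<And>x v. norm (frechet_derivative \<phi> (at x) v) \<le> B * norm v"
proof -
  have "\<exists>B. \<forall>x. norm (partial_deriv b \<phi> x) \<le> B" if "b \<in> Basis" for b
    using test_functions_bounded[OF test_functions_partial_deriv[OF assms that]] by metis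
  then obtain B where B: "\<And>b x. b \<in> Basis \<Longrightarrow> norm (partial_deriv b \<phi> x) \<le> B b" by metis
  have "norm (frechet_derivative \<phi> (at x) v) \<le> (\<Sum>b\<in>Basis. B b) * norm v" for x v
  proof -
    have "norm (frechet_derivative \<phi> (at x) v) \<le> (\<Sum>b\<in>Basis. norm ((v \<bullet> b) *\<^sub>R partial_deriv b \<phi> x))"
      unfolding frechet_derivative_eq_sum_partial_deriv[OF test_functions_smooth[OF assms]]
      by (rule norm_sum)
    also have "\<dots> \<le> (\<Sum>b\<in>Basis. norm v * B b)"
      by (intro sum_mono) (auto intro!: mult_mono B Basis_le_norm)
    finally show ?thesis by (simp add: sum_distrib_left mult.commute)
  qed
  then show ?thesis using that by blast
qed

lemma borel_measurable_frechet_derivative: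
  assumes "smooth f"
  shows "(\<lambda>x. frechet_derivative f (at x) v) \<in> borel_measurable borel"
  unfolding frechet_derivative_eq_sum_partial_deriv[OF assms]
  by (intro borel_measurable_sum borel_measurable_scaleR borel_measurable_const
      smooth_borel_measurable smooth_partial_deriv assms)

section \<open>Convolutions, plateau functions and Schwartz majorants\<close>

text \<open>All derivatives are put on \<open>h\<close>, so the convolutions of one fixed
  \<open>g\<close> with varying test functions form a closed family. As \<open>g\<close> may be
  rough, Schwartz functions can be made out of indicator functions and of monotone
  envelopes.\<close>

lemma schwartz_convolution:
  fixes g :: "'a::euclidean_space \<Rightarrow> real"
  assumes [measurable]: "g \<in> borel_measurable borel" and rd: "rapidly_decreasing g"
    and h: "h \<in> test_functions"
  shows "(\<lambda>x. LINT y|lborel. of_real (g y) * h (x - y)) \<in> schwartz"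
proof (rule schwartz_coinduct[where F = "(\<lambda>h x. LINT y|lborel. of_real (g y) * h (x - y)) ` test_functions"])
  have intg: "integrable lborel g" by (rule integrable_rapidly_decreasing[OF assms(1) rd])
  have int: "integrable lborel (\<lambda>y. of_real (g y) * h (x - y))"
    if h: "h \<in> test_functions" for h and x :: 'a
  proof -
    obtain B where B: "\<And>x. norm (h x) \<le> B" "B \<ge> 0" using test_functions_bounded[OF h] by metis
    have [measurable]: "h \<in> borel_measurable borel"
      by (intro smooth_borel_measurable test_functions_smooth h)
    show ?thesis
      by (rule Bochner_Integration.integrable_bound[OF integrable_mult_left[OF integrable_norm[OF intg], of B]])
        (auto simp: norm_mult B abs_mult intro!: AE_I2 mult_left_mono)
  qed
  show "(\<lambda>x. LINT y|lborel. of_real (g y) * h (x - y)) \<in>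
      (\<lambda>h x. LINT y|lborel. of_real (g y) * h (x - y)) ` test_functions" using h by blast
  fix f assume "f \<in> (\<lambda>h x. LINT y|lborel. of_real (g y) * h (x - y)) ` test_functions"
  then obtain h where h: "h \<in> test_functions" and f: "f = (\<lambda>x. LINT y|lborel. of_real (g y) * h (x - y))"
    by blast
  have sm: "smooth h" by (rule test_functions_smooth[OF h])
  obtain B where B: "\<And>x v. norm (frechet_derivative h (at x) v) \<le> B * norm v"
    using test_functions_derivative_bounded[OF h] by metis
  note [measurable] = borel_measurable_frechet_derivative[OF sm]
  have "(f has_derivative (\<lambda>v. LINT y|lborel. of_real (g y) * frechet_derivative h (at (x - y)) v)) (at x)" for x
    unfolding f
  proof (rule has_derivative_integral[where B = "\<lambda>y. norm (g y) * B"])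
    fix x y
    have "((\<lambda>x. h (x - y)) has_derivative frechet_derivative h (at (x - y))) (at x)"
      by (rule has_derivative_compose[of "\<lambda>x. x - y" "\<lambda>v. v" x UNIV h])
        (auto intro!: derivative_eq_intros smooth_has_derivative[OF sm])
    then show "((\<lambda>x. of_real (g y) * h (x - y)) has_derivative
        (\<lambda>v. of_real (g y) * frechet_derivative h (at (x - y)) v)) (at x)"
      by (rule has_derivative_mult_right)
    show "norm (of_real (g y) * frechet_derivative h (at (x - y)) v) \<le> norm (g y) * B * norm v" for v
      using mult_left_mono[OF B[of "x - y" v] abs_ge_zero[of "g y"]] by (simp add: norm_mult mult.assoc)
  qed (auto intro!: int[OF h] integrable_mult_left integrable_norm intg)
  moreover have "(\<lambda>x. LINT y|lborel. of_real (g y) * frechet_derivative h (at (x - y)) b)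
      \<in> (\<lambda>h x. LINT y|lborel. of_real (g y) * h (x - y)) ` test_functions" if "b \<in> Basis" for b
    using test_functions_partial_deriv[OF h that]
    by (intro image_eqI[of _ _ "partial_deriv b h"]) (simp_all add: partial_deriv_def)
  ultimately show "\<exists>D. (\<forall>x. (f has_derivative D x) (at x)) \<and>
      (\<forall>b\<in>Basis. (\<lambda>x. D x b) \<in> (\<lambda>h x. LINT y|lborel. of_real (g y) * h (x - y)) ` test_functions)"
    by (intro exI[of _ "\<lambda>x v. LINT y|lborel. of_real (g y) * frechet_derivative h (at (x - y)) v"]) blast
  show "rapidly_decreasing f"
    unfolding rapidly_decreasing_def
  proof
    fix n
    obtain C where C: "C > 0" "\<And>x. (1 + norm x) ^ n * norm (h x) \<le> C"
      using rapidly_decreasingE[OF test_functions_rapidly_decreasing[OF h]] by metis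
    have intw: "integrable lborel (\<lambda>y. (1 + norm y) ^ n * norm (g y) * C)"
      by (intro integrable_mult_left integrable_rapidly_decreasing rapidly_decreasing_weight rd) measurable
    have "(1 + norm x) ^ n * norm (f x) \<le> (LINT y|lborel. (1 + norm y) ^ n * norm (g y) * C)" for x
    proof -
      have "(1 + norm x) ^ n * norm (f x) \<le> (1 + norm x) ^ n * (LINT y|lborel. norm (of_real (g y) * h (x - y)))"
        unfolding f by (intro mult_left_mono integral_norm_bound) auto
      also have "\<dots> = (LINT y|lborel. (1 + norm x) ^ n * norm (of_real (g y) * h (x - y)))" by simp
      also have "\<dots> \<le> (LINT y|lborel. (1 + norm y) ^ n * norm (g y) * C)"
      proof (rule integral_mono)
        show "integrable lborel (\<lambda>y. (1 + norm x) ^ n * norm (of_real (g y) * h (x - y)))"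
          by (intro integrable_mult_right integrable_norm int h)
        fix y
        have "(1 + norm x) ^ n \<le> (1 + norm y) ^ n * (1 + norm (x - y)) ^ n"
          unfolding power_mult_distrib[symmetric] by (intro power_mono one_plus_norm_le_mult) auto
        then have "(1 + norm x) ^ n * (norm (g y) * norm (h (x - y)))
            \<le> (1 + norm y) ^ n * (1 + norm (x - y)) ^ n * (norm (g y) * norm (h (x - y)))"
          by (intro mult_right_mono) auto
        also have "\<dots> = (1 + norm y) ^ n * norm (g y) * ((1 + norm (x - y)) ^ n * norm (h (x - y)))"
          by simp
        also have "\<dots> \<le> (1 + norm y) ^ n * norm (g y) * C"
          by (intro mult_left_mono C) auto
        finally show "(1 + norm x) ^ n * norm (of_real (g y) * h (x - y)) \<le> (1 + norm y) ^ n * norm (g y) * C"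
          by (simp add: norm_mult)
      qed (rule intw)
      finally show ?thesis .
    qed
    then show "\<exists>C. \<forall>x. (1 + norm x) ^ n * norm (f x) \<le> C" by blast
  qed
qed

lemma integral_reflect_shift:
  fixes h :: "'a::euclidean_space \<Rightarrow> 'b::{banach, second_countable_topology}"
  shows "(LINT y|lborel. h (x - y)) = (LINT y|lborel. h y)"
  using integral_lborel_affine[of "-1" h x] by simp

text \<open>The indicator of the ball of radius 2 is mollified at unit scale, so nothing changes
  inside radius 1 and nothing is left outside radius 3.\<close>

lemma plateau_exists:
  obtains \<eta> :: "'a::euclidean_space \<Rightarrow> complex"
  where "\<eta> \<in> test_functions" "\<And>x. norm x \<le> 1 \<Longrightarrow> \<eta> x = 1" "\<And>x. norm x \<ge> 3 \<Longrightarrow> \<eta> x = 0"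
proof -
  obtain h :: "'a \<Rightarrow> real" where h: "(\<lambda>x. complex_of_real (h x)) \<in> test_functions"
    "\<And>x. norm x \<ge> 1 \<Longrightarrow> h x = 0" "(LINT x|lborel. h x) = 1" using mollifier_exists by metis
  define \<eta> where "\<eta> = (\<lambda>x. LINT y|lborel. complex_of_real (indicator (ball 0 2) y) * of_real (h (x - y)))"
  have "\<eta> \<in> schwartz"
    unfolding \<eta>_def
    by (rule schwartz_convolution[OF _ _ h(1)])
      (auto intro!: rapidly_decreasing_compact_support[of 2 _ 1] simp: indicator_def)
  moreover have zero: "\<eta> x = 0" if "norm x \<ge> 3" for x
  proof -
    have *: "complex_of_real (indicator (ball 0 2) y) * of_real (h (x - y)) = 0" for y
    proof (cases "norm y < 2")
      case True
      then have "norm (x - y) \<ge> 1" using that norm_triangle_sub[of x y] by simp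
      then show ?thesis using h(2) by simp
    qed (simp add: indicator_def)
    show ?thesis unfolding \<eta>_def * by simp
  qed
  moreover have "\<eta> x = 1" if "norm x \<le> 1" for x
  proof -
    have *: "complex_of_real (indicator (ball 0 2) y) * of_real (h (x - y)) = of_real (h (x - y))" for y
    proof (cases "norm y < 2")
      case False
      then have "norm (x - y) \<ge> 1" using that norm_triangle_sub[of y x] by (simp add: norm_minus_commute)
      then show ?thesis using h(2) by simp
    qed (simp add: indicator_def)
    have "\<eta> x = (LINT y|lborel. of_real (h (x - y)))" unfolding \<eta>_def * ..
    also have "\<dots> = of_real (LINT y|lborel. h (x - y))" by (rule integral_complex_of_real)
    finally show ?thesis using h(3) by (simp add: integral_reflect_shift)
  qed
  ultimately show ?thesis
    by (intro that[of \<eta>]) (auto simp: test_functions_iff schwartz_smooth intro!: exI[of _ 3])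
qed

text \<open>The envelope \<open>R t\<close>, the supremum of \<open>r\<close> from radius
  \<open>t\<close> on, is antitone and therefore measurable even if \<open>r\<close> is not.
  Evaluating it at \<open>norm y - 1\<close> compensates for the averaging: every \<open>y\<close>
  within distance 1 of \<open>x\<close> satisfies \<open>r x \<le> g y\<close>, and averaging with
  unit mass keeps this.\<close>

lemma schwartz_majorant:
  fixes r :: "'a::euclidean_space \<Rightarrow> real"
  assumes rd: "rapidly_decreasing r" and nonneg: "\<And>x. r x \<ge> 0"
  obtains \<Phi> where "(\<lambda>x. complex_of_real (\<Phi> x)) \<in> schwartz" "\<And>x. r x \<le> \<Phi> x"
proof -
  obtain h :: "'a \<Rightarrow> real" where h: "(\<lambda>x. complex_of_real (h x)) \<in> test_functions" "\<And>x. h x \<ge> 0"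
    "\<And>x. norm x \<ge> 1 \<Longrightarrow> h x = 0" "(LINT x|lborel. h x) = 1" using mollifier_exists by metis
  define R where "R = (\<lambda>t. SUP z\<in>{z. norm z \<ge> t}. r z)"
  have ne: "{z::'a. norm z \<ge> t} \<noteq> {}" for t
    using vector_choose_size[of "max t 0"] by (metis (mono_tags, lifting) empty_iff max.cobounded1 max.cobounded2 mem_Collect_eq)
  obtain C0 where "\<And>x. (1 + norm x) ^ 0 * norm (r x) \<le> C0"
    using rapidly_decreasingE[OF rd, of 0] by metis
  then have C0: "r x \<le> C0" for x using abs_ge_self[of "r x"] by (auto intro: order_trans)
  have bdd: "bdd_above (r ` A)" for A using C0 by (auto simp: bdd_above_def)
  have R_ge: "r z \<le> R t" if "norm z \<ge> t" for z t
    unfolding R_def by (intro cSUP_upper bdd) (use that in simp)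
  have R_le: "R t \<le> c" if "\<And>z. norm z \<ge> t \<Longrightarrow> r z \<le> c" for t c
    unfolding R_def by (intro cSUP_least ne) (use that in simp)
  have "mono (\<lambda>t. - R t)"
    by (intro monoI) (auto intro!: R_le R_ge)
  from borel_measurable_uminus[OF borel_measurable_mono[OF this]]
  have [measurable]: "R \<in> borel_measurable borel" by simp
  define g where "g = (\<lambda>y::'a. R (norm y - 1))"
  have [measurable]: "g \<in> borel_measurable borel" unfolding g_def by measurable
  have g_nonneg: "g y \<ge> 0" for y
    using R_ge[of "norm y - 1" y] nonneg[of y] by (simp add: g_def)
  have rdg: "rapidly_decreasing g"
    unfolding rapidly_decreasing_def
  proof
    fix n
    obtain C where C: "\<And>x. (1 + norm x) ^ n * norm (r x) \<le> C"
      using rapidly_decreasingE[OF rd, of n] by metis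
    have "(1 + norm y) ^ n * norm (g y) \<le> 2 ^ n * C" for y
    proof -
      have pos: "(1 + norm y) ^ n > 0" by (simp add: add_pos_nonneg)
      have "g y \<le> 2 ^ n * C / (1 + norm y) ^ n"
        unfolding g_def
      proof (rule R_le)
        fix z :: 'a assume "norm y - 1 \<le> norm z"
        then have "1 + norm y \<le> 2 + norm z" by simp
        also have "\<dots> \<le> 2 * (1 + norm z)" by simp
        finally have "1 + norm y \<le> 2 * (1 + norm z)" .
        then have "(1 + norm y) ^ n \<le> (2 * (1 + norm z)) ^ n" by (intro power_mono) auto
        then have "(1 + norm y) ^ n * r z \<le> 2 ^ n * (1 + norm z) ^ n * r z"
          unfolding power_mult_distrib[symmetric] by (intro mult_right_mono nonneg)
        also have "\<dots> \<le> 2 ^ n * C" using C[of z] nonneg[of z] by (simp add: mult.assoc)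
        finally show "r z \<le> 2 ^ n * C / (1 + norm y) ^ n"
          using pos by (simp add: pos_le_divide_eq mult.commute)
      qed
      then show ?thesis using pos g_nonneg[of y] by (simp add: pos_le_divide_eq mult.commute)
    qed
    then show "\<exists>C. \<forall>x. (1 + norm x) ^ n * norm (g x) \<le> C" by blast
  qed
  define \<Phi> where "\<Phi> = (\<lambda>x. LINT y|lborel. g y * h (x - y))"
  have [measurable]: "h \<in> borel_measurable borel"
    using measurable_compose[OF smooth_borel_measurable[OF test_functions_smooth[OF h(1)]]
        borel_measurable_Re] by simp
  obtain B where B: "\<And>x. norm (complex_of_real (h x)) \<le> B" "B \<ge> 0"
    using test_functions_bounded[OF h(1)] by metis
  have int: "integrable lborel (\<lambda>y. g y * h (x - y))" for x
  proof (rule Bochner_Integration.integrable_bound)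
    show "integrable lborel (\<lambda>y. norm (g y) * B)"
      by (intro integrable_mult_left integrable_norm integrable_rapidly_decreasing rdg) measurable
  qed (use B in \<open>auto simp: abs_mult intro!: AE_I2 mult_left_mono\<close>)
  have "(\<lambda>x. complex_of_real (\<Phi> x)) = (\<lambda>x. LINT y|lborel. of_real (g y) * of_real (h (x - y)))"
    unfolding \<Phi>_def by (simp flip: integral_complex_of_real)
  also have "\<dots> \<in> schwartz" by (rule schwartz_convolution[OF _ rdg h(1)]) measurable
  finally have "(\<lambda>x. complex_of_real (\<Phi> x)) \<in> schwartz" .
  moreover have "r x \<le> \<Phi> x" for x
  proof -
    have "r x = (LINT y|lborel. r x * h (x - y))" using h(4) by (simp add: integral_reflect_shift)
    also have "\<dots> \<le> \<Phi> x"
      unfolding \<Phi>_def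
    proof (rule integral_mono[OF _ int])
      have "integrable lborel h" using integrable_Re[OF integrable_test_function[OF h(1)]] by simp
      then show "integrable lborel (\<lambda>y. r x * h (x - y))"
        using integrable_lborel_affine[of "-1" h x] by simp
      show "r x * h (x - y) \<le> g y * h (x - y)" for y
      proof (cases "norm (x - y) \<ge> 1")
        case False
        then have "norm x \<ge> norm y - 1" using norm_triangle_sub[of y x] by (simp add: norm_minus_commute)
        then show ?thesis unfolding g_def by (intro mult_right_mono R_ge h(2))
      qed (simp add: h(3))
    qed
    finally show ?thesis .
  qed
  ultimately show ?thesis using that by blast
qed

section \<open>The Fourier transform of test functions\<close>

abbreviation character :: "'a::euclidean_space \<Rightarrow> 'a \<Rightarrow> complex" where
  "character x \<xi> \<equiv> exp (- 2 * of_real pi * \<i> * of_real (inner x \<xi>))"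

lemma norm_character [simp]: "norm (character x \<xi>) = 1"
proof -
  have "character x \<xi> = cis (- 2 * pi * (x \<bullet> \<xi>))" by (simp add: cis_conv_exp mult_ac)
  then show ?thesis by simp
qed

lemma integrable_mult_character:
  assumes "integrable lborel f"
  shows "integrable lborel (\<lambda>x. f x * character x \<xi>)"
  by (rule Bochner_Integration.integrable_bound[OF assms])
    (use assms in \<open>auto simp: norm_mult\<close>)

lemma norm_fourier_le: "norm (fourier \<phi> \<xi>) \<le> (LINT x|lborel. norm (\<phi> x))"
  unfolding fourier_def
  using integral_norm_bound[of lborel "\<lambda>x. \<phi> x * character x \<xi>"] by (simp add: norm_mult)

lemma fourier_diff:
  assumes "integrable lborel \<phi>" "integrable lborel \<psi>"
  shows "fourier (\<lambda>x. \<phi> x - \<psi> x) = (\<lambda>\<xi>. fourier \<phi> \<xi> - fourier \<psi> \<xi>)"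
  unfolding fourier_def
  using integrable_mult_character[OF assms(1)] integrable_mult_character[OF assms(2)]
  by (simp add: algebra_simps)

lemma has_derivative_character:
  "((\<lambda>\<xi>. character x \<xi>) has_derivative
     (\<lambda>v. - 2 * of_real pi * \<i> * of_real (x \<bullet> v) * character x \<xi>)) (at \<xi>)"
proof -
  have "((\<lambda>\<xi>. - 2 * of_real pi * \<i> * of_real (x \<bullet> \<xi>)) has_derivative
      (\<lambda>v. - 2 * of_real pi * \<i> * of_real (x \<bullet> v))) (at \<xi>)"
    by (auto intro!: derivative_eq_intros)
  from has_derivative_compose[OF this has_field_derivative_imp_has_derivative[OF DERIV_exp]]
  show ?thesis by (simp add: mult.commute)
qed

lemma fourier_has_derivative:
  assumes \<phi>: "\<phi> \<in> test_functions"
  shows "(fourier \<phi> has_derivative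
    (\<lambda>v. fourier (\<lambda>x. (- 2 * of_real pi * \<i> * of_real (x \<bullet> v)) * \<phi> x) \<xi>)) (at \<xi>)"
  unfolding fourier_def
proof (rule has_derivative_eq_rhs[OF has_derivative_integral[where B = "\<lambda>x. 2 * pi * norm x * norm (\<phi> x)"
      and D = "\<lambda>\<xi> x v. \<phi> x * (- 2 * of_real pi * \<i> * of_real (x \<bullet> v) * character x \<xi>)"]])
  note [measurable] = smooth_borel_measurable[OF test_functions_smooth[OF \<phi>]]
  show "((\<lambda>\<xi>. \<phi> x * character x \<xi>) has_derivative
     (\<lambda>v. \<phi> x * (- 2 * of_real pi * \<i> * of_real (x \<bullet> v) * character x \<xi>))) (at \<xi>)" for x \<xi>
    by (intro has_derivative_mult_right has_derivative_character)
  show "integrable lborel (\<lambda>x. \<phi> x * character x \<xi>)" for \<xi>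
    by (intro integrable_mult_character integrable_test_function \<phi>)
  show "norm (\<phi> x * (- 2 * of_real pi * \<i> * of_real (x \<bullet> v) * character x \<xi>))
      \<le> 2 * pi * norm x * norm (\<phi> x) * norm v" for x \<xi> v
  proof -
    have "norm (\<phi> x) * (2 * pi * \<bar>x \<bullet> v\<bar>) \<le> norm (\<phi> x) * (2 * pi * (norm x * norm v))"
      by (intro mult_left_mono Cauchy_Schwarz_ineq2) auto
    then show ?thesis by (simp add: norm_mult mult_ac)
  qed
  have "integrable lborel (\<lambda>x. (1 + norm x) ^ 1 * norm (\<phi> x))"
    by (intro integrable_rapidly_decreasing rapidly_decreasing_weight
        test_functions_rapidly_decreasing \<phi>) measurable
  then have "integrable lborel (\<lambda>x. 2 * pi * ((1 + norm x) * norm (\<phi> x)))"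
    by (intro integrable_mult_right) simp
  then show "integrable lborel (\<lambda>x. 2 * pi * norm x * norm (\<phi> x))"
    by (rule Bochner_Integration.integrable_bound) (auto simp: abs_mult distrib_right intro!: AE_I2)
qed (auto simp: mult_ac borel_measurable_continuous_onI
    intro!: smooth_borel_measurable[OF test_functions_smooth[OF \<phi>]] borel_measurable_times)

text \<open>Translation invariance takes the place of integration by parts: the integral
  \<open>F\<close> of translates of \<open>\<phi>\<close> in direction \<open>b\<close> against the
  character is differentiated at 0 twice, under the integral sign and after the translation has been
  shifted onto the character.\<close>

lemma fourier_partial_deriv:
  assumes \<phi>: "\<phi> \<in> test_functions" and b: "b \<in> Basis"
  shows "fourier (partial_deriv b \<phi>) \<xi> = 2 * of_real pi * \<i> * of_real (b \<bullet> \<xi>) * fourier \<phi> \<xi>"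
proof -
  have sm: "smooth \<phi>" by (rule test_functions_smooth[OF \<phi>])
  note [measurable] = smooth_borel_measurable[OF sm] borel_measurable_frechet_derivative[OF sm]
  obtain r where r: "\<And>x. norm x > r \<Longrightarrow> \<phi> x = 0" using \<phi> unfolding test_functions_iff by blast
  obtain B where B: "\<And>x v. norm (frechet_derivative \<phi> (at x) v) \<le> B * norm v"
    using test_functions_derivative_bounded[OF \<phi>] by metis
  have B0: "B \<ge> 0" using order_trans[OF norm_ge_zero B[of 0 b]] b by simp
  have zero: "frechet_derivative \<phi> (at x) v = 0" if "norm x > r" for x v
    using r that by (rule frechet_derivative_eq_0_outside_cball)
  \<comment> \<open>Moving by \<open>sin t\<close> instead of \<open>t\<close> keeps all translates in one ball, which gives the dominating function.\<close>
  define F where "F = (\<lambda>t::real. LINT x|lborel. \<phi> (x + sin t *\<^sub>R b) * character x \<xi>)"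
  have "(F has_derivative (\<lambda>s. LINT x|lborel. frechet_derivative \<phi> (at (x + sin 0 *\<^sub>R b))
      ((cos 0 * s) *\<^sub>R b) * character x \<xi>)) (at 0)"
    unfolding F_def
  proof (rule has_derivative_integral[where B = "\<lambda>x. B * indicator (cball 0 (r + 1)) x"])
    show "((\<lambda>t. \<phi> (x + sin t *\<^sub>R b) * character x \<xi>) has_derivative
        (\<lambda>s. frechet_derivative \<phi> (at (x + sin t *\<^sub>R b)) ((cos t * s) *\<^sub>R b) * character x \<xi>)) (at t)"
      for t :: real and x
    proof (rule has_derivative_mult_left)
      show "((\<lambda>t. \<phi> (x + sin t *\<^sub>R b)) has_derivative
        (\<lambda>s. frechet_derivative \<phi> (at (x + sin t *\<^sub>R b)) ((cos t * s) *\<^sub>R b))) (at t)"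
        by (rule has_derivative_compose[of "\<lambda>t. x + sin t *\<^sub>R b" "\<lambda>s. (cos t * s) *\<^sub>R b" t UNIV \<phi>])
          (auto intro!: derivative_eq_intros smooth_has_derivative[OF sm])
    qed
    show "integrable lborel (\<lambda>x. \<phi> (x + sin t *\<^sub>R b) * character x \<xi>)" for t :: real
      using integrable_mult_character[OF integrable_test_function[OF test_functions_affine[OF \<phi>, of 1 "sin t *\<^sub>R b"]]]
      by simp
    show "(\<lambda>x. frechet_derivative \<phi> (at (x + sin t *\<^sub>R b)) ((cos t * s) *\<^sub>R b) * character x \<xi>)
        \<in> borel_measurable lborel" for t s :: real
      by measurable
    show "norm (frechet_derivative \<phi> (at (x + sin t *\<^sub>R b)) ((cos t * s) *\<^sub>R b) * character x \<xi>)
        \<le> B * indicator (cball 0 (r + 1)) x * norm s" for t s :: real and x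
    proof (cases "norm x \<le> r + 1")
      case True
      have "norm (frechet_derivative \<phi> (at (x + sin t *\<^sub>R b)) ((cos t * s) *\<^sub>R b)) \<le> B * norm ((cos t * s) *\<^sub>R b)"
        by (rule B)
      also have "\<dots> \<le> B * \<bar>s\<bar>"
        using b B0 mult_right_mono[OF abs_cos_le_one[of t], of "\<bar>s\<bar>"]
        by (intro mult_left_mono) (auto simp: abs_mult)
      finally show ?thesis using True by (simp add: norm_mult)
    next
      case False
      have "norm (sin t *\<^sub>R b) \<le> 1" using b by simp
      then have "norm (x + sin t *\<^sub>R b) > r" using False norm_diff_ineq[of x "sin t *\<^sub>R b"] by linarith
      then show ?thesis using B0 by (simp add: zero)
    qed
    show "integrable lborel (\<lambda>x::'a. B * indicator (cball 0 (r + 1)) x)"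
      by (intro integrable_mult_right integrable_real_indicator)
        (simp, rule emeasure_lborel_cball_finite)
  qed
  then have "(F has_derivative (\<lambda>s. LINT x|lborel. frechet_derivative \<phi> (at x) (s *\<^sub>R b) * character x \<xi>)) (at 0)"
    by simp
  moreover have "F = (\<lambda>t. exp (2 * of_real pi * \<i> * of_real (sin t * (b \<bullet> \<xi>))) * fourier \<phi> \<xi>)"
  proof
    fix t
    have "F t = (LINT x|lborel. \<phi> x * character (x - sin t *\<^sub>R b) \<xi>)"
      unfolding F_def
      using integral_lborel_affine[of 1 "\<lambda>x. \<phi> x * character (x - sin t *\<^sub>R b) \<xi>" "sin t *\<^sub>R b"]
      by (simp add: add.commute)
    also have "(\<lambda>x. \<phi> x * character (x - sin t *\<^sub>R b) \<xi>)
        = (\<lambda>x. exp (2 * of_real pi * \<i> * of_real (sin t * (b \<bullet> \<xi>))) * (\<phi> x * character x \<xi>))"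
      by (auto simp: inner_diff_left algebra_simps exp_diff exp_add[symmetric] intro!: ext)
    finally show "F t = exp (2 * of_real pi * \<i> * of_real (sin t * (b \<bullet> \<xi>))) * fourier \<phi> \<xi>"
      by (simp add: fourier_def)
  qed
  moreover have "((\<lambda>t::real. exp (2 * of_real pi * \<i> * of_real (sin t * (b \<bullet> \<xi>))) * fourier \<phi> \<xi>)
      has_derivative (\<lambda>s. 2 * of_real pi * \<i> * of_real (s * (b \<bullet> \<xi>)) * fourier \<phi> \<xi>)) (at 0)"
  proof -
    have "((\<lambda>t::real. 2 * of_real pi * \<i> * of_real (sin t * (b \<bullet> \<xi>)))
      has_derivative (\<lambda>s. 2 * of_real pi * \<i> * of_real (s * (b \<bullet> \<xi>)))) (at 0)"
      by (auto intro!: derivative_eq_intros)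
    from has_derivative_compose[OF this has_field_derivative_imp_has_derivative[OF DERIV_exp]]
    show ?thesis by (intro has_derivative_mult_left) simp
  qed
  ultimately have "(\<lambda>s. LINT x|lborel. frechet_derivative \<phi> (at x) (s *\<^sub>R b) * character x \<xi>)
      = (\<lambda>s. 2 * of_real pi * \<i> * of_real (s * (b \<bullet> \<xi>)) * fourier \<phi> \<xi>)"
    using has_derivative_unique by blast
  from fun_cong[OF this, of 1] show ?thesis by (simp add: fourier_def partial_deriv_def)
qed

text \<open>A factor |\<xi>| is bounded by the sum of the absolute coordinates, and
  \<open>fourier_partial_deriv\<close> trades each coordinate for a partial derivative of the test
  function; the induction on the power therefore runs over all test functions at once.\<close>

lemma fourier_test_function_rapidly_decreasing:
  fixes \<phi> :: "'a::euclidean_space \<Rightarrow> complex"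
  assumes "\<phi> \<in> test_functions"
  shows "rapidly_decreasing (fourier \<phi>)"
  unfolding rapidly_decreasing_def
proof
  fix n
  show "\<exists>C. \<forall>\<xi>. (1 + norm \<xi>) ^ n * norm (fourier \<phi> \<xi>) \<le> C"
    using assms
  proof (induction n arbitrary: \<phi>)
    case 0
    then show ?case using norm_fourier_le[of \<phi>] by auto
  next
    case (Suc n)
    obtain C where C: "\<And>\<xi>. (1 + norm \<xi>) ^ n * norm (fourier \<phi> \<xi>) \<le> C" using Suc by blast
    have "\<exists>K. \<forall>b\<in>Basis. \<forall>\<xi>. (1 + norm \<xi>) ^ n * norm (fourier (partial_deriv b \<phi>) \<xi>) \<le> K b"
      by (rule bchoice) (use Suc.IH test_functions_partial_deriv[OF Suc.prems] in blast)
    then obtain K where K: "\<And>b \<xi>. b \<in> Basis \<Longrightarrow>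
      (1 + norm \<xi>) ^ n * norm (fourier (partial_deriv b \<phi>) \<xi>) \<le> K b"
      by blast
    have "(1 + norm \<xi>) ^ Suc n * norm (fourier \<phi> \<xi>) \<le> C + (\<Sum>b\<in>Basis. K b)" for \<xi>
    proof -
      have le: "\<bar>\<xi> \<bullet> b\<bar> * norm (fourier \<phi> \<xi>) \<le> norm (fourier (partial_deriv b \<phi>) \<xi>)" if "b \<in> Basis" for b
      proof -
        have "1 * (\<bar>\<xi> \<bullet> b\<bar> * norm (fourier \<phi> \<xi>)) \<le> (2 * pi) * (\<bar>\<xi> \<bullet> b\<bar> * norm (fourier \<phi> \<xi>))"
          using pi_ge_two by (intro mult_right_mono) auto
        then show ?thesis
          unfolding fourier_partial_deriv[OF Suc.prems that] by (simp add: norm_mult inner_commute mult_ac)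
      qed
      have "norm \<xi> * norm (fourier \<phi> \<xi>) \<le> (\<Sum>b\<in>Basis. \<bar>\<xi> \<bullet> b\<bar>) * norm (fourier \<phi> \<xi>)"
        by (intro mult_right_mono norm_le_l1) auto
      also have "\<dots> \<le> (\<Sum>b\<in>Basis. norm (fourier (partial_deriv b \<phi>) \<xi>))"
        unfolding sum_distrib_right by (intro sum_mono le)
      finally have "(1 + norm \<xi>) ^ n * (norm \<xi> * norm (fourier \<phi> \<xi>))
          \<le> (1 + norm \<xi>) ^ n * (\<Sum>b\<in>Basis. norm (fourier (partial_deriv b \<phi>) \<xi>))"
        by (intro mult_left_mono) auto
      also have "\<dots> \<le> (\<Sum>b\<in>Basis. K b)"
        unfolding sum_distrib_left by (intro sum_mono K)
      finally show ?thesis using C[of \<xi>] by (simp add: algebra_simps)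
    qed
    then show ?case by blast
  qed
qed

lemma fourier_test_function_schwartz:
  fixes \<phi> :: "'a::euclidean_space \<Rightarrow> complex"
  assumes "\<phi> \<in> test_functions"
  shows "fourier \<phi> \<in> schwartz"
proof (rule schwartz_coinduct[where F = "fourier ` test_functions"])
  fix f :: "'a \<Rightarrow> complex" assume "f \<in> fourier ` test_functions"
  then obtain \<phi> where \<phi>: "\<phi> \<in> test_functions" and f: "f = fourier \<phi>" by blast
  have "(\<lambda>x. (- 2 * of_real pi * \<i> * of_real (x \<bullet> v)) * \<phi> x) \<in> test_functions" for v
    by (intro test_functions_mult \<phi> smooth_mult smooth_const smooth_inner)
  then show "\<exists>D. (\<forall>\<xi>. (f has_derivative D \<xi>) (at \<xi>)) \<and> (\<forall>b\<in>Basis. (\<lambda>\<xi>. D \<xi> b) \<in> fourier ` test_functions)"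
    unfolding f using fourier_has_derivative[OF \<phi>]
    by (intro exI[of _ "\<lambda>\<xi> v. fourier (\<lambda>x. (- 2 * of_real pi * \<i> * of_real (x \<bullet> v)) * \<phi> x) \<xi>"])
      blast
  show "rapidly_decreasing f" unfolding f by (rule fourier_test_function_rapidly_decreasing[OF \<phi>])
qed (use assms in blast)

text \<open>Read backwards, this identifies the kernels of the reproducing formula:
  \<open>R^d K(R (y - x))\<close> is the transform of a test function, with the dilation of
  \<open>\<eta>\<close> giving the scale and the modulation giving the centre \<open>x\<close>. Its
  spectrum is thus explicit.\<close>

lemma fourier_scaled_modulated:
  fixes \<phi> :: "'a::euclidean_space \<Rightarrow> complex"
  assumes "R > 0"
  shows "fourier (\<lambda>\<xi>. \<phi> (\<xi> /\<^sub>R R) * exp (2 * of_real pi * \<i> * of_real (\<xi> \<bullet> x))) y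
    = of_real (R ^ DIM('a)) * fourier \<phi> (R *\<^sub>R (y - x))"
proof -
  have "fourier (\<lambda>\<xi>. \<phi> (\<xi> /\<^sub>R R) * exp (2 * of_real pi * \<i> * of_real (\<xi> \<bullet> x))) y
      = (LINT \<xi>|lborel. \<phi> (\<xi> /\<^sub>R R) * character \<xi> (y - x))"
    unfolding fourier_def
    by (intro Bochner_Integration.integral_cong)
      (auto simp: inner_diff_right right_diff_distrib exp_add[symmetric] mult.assoc)
  also have "\<dots> = R ^ DIM('a) *\<^sub>R (LINT \<xi>|lborel. \<phi> \<xi> * character (R *\<^sub>R \<xi>) (y - x))"
    using assms integral_lborel_affine[of R "\<lambda>\<xi>. \<phi> (\<xi> /\<^sub>R R) * character \<xi> (y - x)" 0] by simp
  finally show ?thesis by (simp add: fourier_def scaleR_conv_of_real)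
qed

section \<open>The multiplication formula and approximate identities\<close>

lemma integrable_kernel_product:
  fixes f g :: "'a::euclidean_space \<Rightarrow> complex" and k :: "'a \<Rightarrow> 'a \<Rightarrow> complex"
  assumes f: "integrable lborel f" and g: "integrable lborel g"
    and k [measurable]: "(\<lambda>(x, y). k x y) \<in> borel_measurable (borel \<Otimes>\<^sub>M borel)"
    and bound: "\<And>x y. norm (k x y) \<le> B"
  shows "integrable (lborel \<Otimes>\<^sub>M lborel) (\<lambda>(x, y). f x * g y * k x y)"
proof (rule Bochner_Integration.integrable_bound)
  have [measurable]: "f \<in> borel_measurable borel" "g \<in> borel_measurable borel" using f g by auto
  show "integrable (lborel \<Otimes>\<^sub>M lborel) (\<lambda>p. f (fst p) * g (snd p) * of_real B)"
  proof (rule lborel_pair.Fubini_integrable)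
    show "integrable lborel (\<lambda>x. LINT y|lborel. norm (f (fst (x, y)) * g (snd (x, y)) * of_real B))"
      using f by (simp add: norm_mult)
    show "AE x in lborel. integrable lborel (\<lambda>y. f (fst (x, y)) * g (snd (x, y)) * of_real B)"
      using g by simp
  qed measurable
  show "(\<lambda>(x, y). f x * g y * k x y) \<in> borel_measurable (lborel \<Otimes>\<^sub>M lborel)"
    by measurable
  have "norm (f x * g y * k x y) \<le> norm (f x * g y * of_real B)" for x y
    using bound[of x y] by (simp add: norm_mult mult_left_mono)
  then show "AE p in lborel \<Otimes>\<^sub>M lborel. norm (case p of (x, y) \<Rightarrow> f x * g y * k x y)
      \<le> norm (f (fst p) * g (snd p) * of_real B)"
    by (auto simp: split_beta)
qed

lemma integral_fourier_mult:
  assumes "integrable lborel \<phi>" "integrable lborel \<psi>"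
  shows "(LINT \<xi>|lborel. fourier \<phi> \<xi> * \<psi> \<xi>) = (LINT x|lborel. \<phi> x * fourier \<psi> x)"
proof -
  have "integrable (lborel \<Otimes>\<^sub>M lborel) (\<lambda>(x, \<xi>). \<phi> x * \<psi> \<xi> * character x \<xi>)"
    by (rule integrable_kernel_product[OF assms, where B = 1]) (auto simp: norm_character)
  from lborel_pair.Fubini_integral[OF this]
  have "(LINT \<xi>|lborel. LINT x|lborel. \<phi> x * \<psi> \<xi> * character x \<xi>)
      = (LINT x|lborel. LINT \<xi>|lborel. \<phi> x * \<psi> \<xi> * character x \<xi>)" .
  moreover have "(LINT x|lborel. \<phi> x * \<psi> \<xi> * character x \<xi>) = fourier \<phi> \<xi> * \<psi> \<xi>" for \<xi>
  proof -
    have "(\<lambda>x. \<phi> x * \<psi> \<xi> * character x \<xi>) = (\<lambda>x. (\<phi> x * character x \<xi>) * \<psi> \<xi>)" by auto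
    then show ?thesis unfolding fourier_def by simp
  qed
  moreover have "(LINT \<xi>|lborel. \<phi> x * \<psi> \<xi> * character x \<xi>) = \<phi> x * fourier \<psi> x" for x
  proof -
    have "(\<lambda>\<xi>. \<phi> x * \<psi> \<xi> * character x \<xi>) = (\<lambda>\<xi>. \<phi> x * (\<psi> \<xi> * character \<xi> x))"
      by (auto simp: inner_commute)
    then show ?thesis unfolding fourier_def by simp
  qed
  ultimately show ?thesis by simp
qed

text \<open>An approximate identity after substitution: the dilation sits in \<open>g\<close> and
  not in the kernel, so that \<open>B * norm (K z)\<close> dominates for all \<open>n\<close> at
  once. \<open>K\<close> is not normalised, which is why its integral remains in the limit.\<close>

lemma tendsto_integral_dilate:
  fixes g :: "'a::euclidean_space \<Rightarrow> complex" and K :: "'a \<Rightarrow> complex"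
  assumes K: "integrable lborel K" and g [measurable]: "g \<in> borel_measurable borel"
    and cont: "isCont g x" and bound: "\<And>x. norm (g x) \<le> B"
  shows "(\<lambda>n. LINT z|lborel. g (x + z /\<^sub>R real (Suc n)) * K z) \<longlonglongrightarrow> g x * (LINT z|lborel. K z)"
proof -
  have [measurable]: "K \<in> borel_measurable borel" using K by auto
  have "(\<lambda>n. LINT z|lborel. g (x + z /\<^sub>R real (Suc n)) * K z) \<longlonglongrightarrow> (LINT z|lborel. g x * K z)"
  proof (rule integral_dominated_convergence[where w = "\<lambda>z. B * norm (K z)"])
    show "AE z in lborel. (\<lambda>n. g (x + z /\<^sub>R real (Suc n)) * K z) \<longlonglongrightarrow> g x * K z"
    proof (intro AE_I2 tendsto_mult_right)
      fix z :: 'a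
      have "(\<lambda>n. x + inverse (real (Suc n)) *\<^sub>R z) \<longlonglongrightarrow> x + 0 *\<^sub>R z"
        by (intro tendsto_intros LIMSEQ_inverse_real_of_nat)
      then show "(\<lambda>n. g (x + z /\<^sub>R real (Suc n))) \<longlonglongrightarrow> g x"
        using isCont_tendsto_compose[OF cont] by simp
    qed
    show "AE z in lborel. norm (g (x + z /\<^sub>R real (Suc n)) * K z) \<le> B * norm (K z)" for n
      by (intro AE_I2) (auto simp: norm_mult intro!: mult_right_mono bound)
  qed (use K in auto)
  then show ?thesis by simp
qed

lemma smooth_isCont: "smooth f \<Longrightarrow> isCont f x"
  using smooth_has_derivative has_derivative_continuous by blast

text \<open>If the integral of \<open>fourier \<eta>\<close> vanished, then so would the integral of
  \<open>|fourier h|\<^sup>2\<close> for every real test function \<open>h\<close>: with \<open>\<eta>(\<epsilon>\<xi>)\<close> inserted as a convergence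
  factor it equals a double integral of \<open>h(u) h(u - \<epsilon>z)\<close> against \<open>fourier \<eta> (z)\<close>.\<close>

lemma integral_fourier_nonzero:
  fixes \<eta> :: "'a::euclidean_space \<Rightarrow> complex"
  assumes \<eta>: "\<eta> \<in> test_functions" and "\<eta> 0 = 1"
  shows "(LINT z|lborel. fourier \<eta> z) \<noteq> 0"
proof
  assume zero: "(LINT z|lborel. fourier \<eta> z) = 0"
  obtain h0 :: "'a \<Rightarrow> real" where h0: "(\<lambda>x. complex_of_real (h0 x)) \<in> test_functions"
    "(LINT x|lborel. h0 x) = 1" using mollifier_exists by metis
  define h where "h = (\<lambda>x. complex_of_real (h0 x))"
  define H where "H = fourier h"
  define K where "K = fourier \<eta>"
  have h: "h \<in> test_functions" using h0 by (simp add: h_def)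
  have H: "H \<in> schwartz" unfolding H_def by (rule fourier_test_function_schwartz[OF h])
  have K: "integrable lborel K"
    unfolding K_def by (intro integrable_schwartz fourier_test_function_schwartz \<eta>)
  have sm: "smooth \<eta>" "smooth h" "smooth H" using \<eta> h H by (auto intro: test_functions_smooth schwartz_smooth)
  note [measurable] = sm[THEN smooth_borel_measurable]
  have [measurable]: "K \<in> borel_measurable borel" using K by auto
  obtain B where B: "B \<ge> 0" "\<And>x. norm (h x) \<le> B" using test_functions_bounded[OF h] by metis
  obtain E where E: "E \<ge> 0" "\<And>x. norm (\<eta> x) \<le> E" using test_functions_bounded[OF \<eta>] by metis
  define h' where "h' = (\<lambda>x. h (- x))"
  have h': "h' \<in> test_functions" using test_functions_affine[OF h, of "-1" 0] by (simp add: h'_def)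
  \<comment> \<open>As \<open>h\<close> is real, conjugating the transform reflects
    \<open>h\<close>; hence \<open>cnj (H \<xi>)\<close> is again the transform of a test function
    and the multiplication formula applies to it.\<close>
  have cnjH: "cnj (H \<xi>) = fourier h' \<xi>" for \<xi>
  proof -
    have "cnj (H \<xi>) = (LINT x|lborel. cnj (h x * character x \<xi>))"
      unfolding H_def fourier_def by (rule Bochner_Integration.integral_cnj[symmetric])
    also have "\<dots> = (LINT x|lborel. h x * character (- x) \<xi>)"
      by (intro Bochner_Integration.integral_cong) (auto simp: h_def exp_cnj)
    also have "\<dots> = fourier h' \<xi>"
      unfolding fourier_def h'_def
      using integral_lborel_affine[of "-1" "\<lambda>x. h x * character (- x) \<xi>" 0] by simp
    finally show ?thesis .
  qed
  define R where "R = (\<lambda>n. real (Suc n))"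
  have R: "R n > 0" for n by (simp add: R_def)
  \<comment> \<open>Pairing \<open>\<psi> n\<close> with \<open>H\<close> gives |H|^2 times a
    convergence factor that tends to \<open>\<eta> 0 = 1\<close>.\<close>
  define \<psi> where "\<psi> = (\<lambda>n \<xi>. \<eta> (\<xi> /\<^sub>R R n) * cnj (H \<xi>))"
  have cH: "integrable lborel (\<lambda>\<xi>. cnj (H \<xi>))" using integrable_schwartz[OF H] by simp
  have [measurable]: "(\<lambda>\<xi>. cnj (H \<xi>)) \<in> borel_measurable borel"
    by (intro smooth_borel_measurable smooth_cnj sm)
  have \<psi>_int: "integrable lborel (\<psi> n)" for n
    unfolding \<psi>_def
    by (rule Bochner_Integration.integrable_bound[OF integrable_mult_right[OF cH, of "of_real E"]])
      (use E in \<open>auto simp: norm_mult intro!: AE_I2 mult_right_mono\<close>)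
  have F\<psi>: "fourier (\<psi> n) u = (LINT z|lborel. h (u + (- z) /\<^sub>R R n) * K z)" for n u
  proof -
    define \<theta> where "\<theta> = (\<lambda>\<xi>. \<eta> (\<xi> /\<^sub>R R n) * exp (2 * of_real pi * \<i> * of_real (\<xi> \<bullet> (- u))))"
    have "(\<lambda>\<xi>. \<eta> (inverse (R n) *\<^sub>R \<xi> + 0)) \<in> test_functions"
      by (rule test_functions_affine[OF \<eta>]) (use R[of n] in simp)
    then have \<theta>: "\<theta> \<in> test_functions"
      unfolding \<theta>_def by (intro test_functions_mult' smooth_exp_inner) simp
    have "fourier (\<psi> n) u = (LINT \<xi>|lborel. \<psi> n \<xi> * character \<xi> u)"
      by (simp only: fourier_def)
    also have "\<dots> = (LINT \<xi>|lborel. fourier h' \<xi> * \<theta> \<xi>)"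
      unfolding \<psi>_def \<theta>_def cnjH
      by (intro Bochner_Integration.integral_cong) (auto simp: mult_ac)
    also have "\<dots> = (LINT x|lborel. h' x * fourier \<theta> x)"
      by (intro integral_fourier_mult integrable_test_function h' \<theta>)
    also have "fourier \<theta> = (\<lambda>x. of_real (R n ^ DIM('a)) * K (R n *\<^sub>R (x + u)))"
      unfolding \<theta>_def K_def using fourier_scaled_modulated[OF R[of n], of \<eta> "- u"] by auto
    also have "(LINT x|lborel. h' x * (of_real (R n ^ DIM('a)) * K (R n *\<^sub>R (x + u))))
        = of_real (R n ^ DIM('a)) * (LINT x|lborel. h' x * K (R n *\<^sub>R (x + u)))"
      by (subst integral_mult_right_zero[symmetric]) (simp add: mult_ac)
    also have "\<dots> = (LINT z|lborel. h (u + (- z) /\<^sub>R R n) * K z)"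
      using R[of n] integral_lborel_affine[of "inverse (R n)" "\<lambda>x. h' x * K (R n *\<^sub>R (x + u))" "- u"]
      by (simp add: h'_def scaleR_conv_of_real power_inverse flip: of_real_power of_real_mult)
    finally show ?thesis .
  qed
  have "(\<lambda>n. LINT \<xi>|lborel. H \<xi> * \<psi> n \<xi>) \<longlonglongrightarrow> (LINT \<xi>|lborel. of_real ((norm (H \<xi>))\<^sup>2))"
  proof -
    have HH: "integrable lborel (\<lambda>\<xi>. H \<xi> * cnj (H \<xi>))"
    proof -
      obtain C where C: "\<And>x. (1 + norm x) ^ 0 * norm (H x) \<le> C"
        using rapidly_decreasingE[OF schwartz_rapidly_decreasing[OF H], of 0] by metis
      have "norm (H x) \<le> \<bar>C\<bar>" for x using C[of x] by simp
      then show ?thesis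
        by (intro Bochner_Integration.integrable_bound[OF integrable_mult_right[OF cH, of "of_real C"]])
          (auto simp: norm_mult intro!: AE_I2 mult_right_mono)
    qed
    have "(\<lambda>n. LINT \<xi>|lborel. \<eta> (0 + \<xi> /\<^sub>R real (Suc n)) * (H \<xi> * cnj (H \<xi>)))
        \<longlonglongrightarrow> \<eta> 0 * (LINT \<xi>|lborel. H \<xi> * cnj (H \<xi>))"
      by (rule tendsto_integral_dilate[OF HH _ smooth_isCont[OF sm(1)] E(2)]) measurable
    then show ?thesis using assms(2) unfolding complex_norm_square
      by (simp add: \<psi>_def R_def mult_ac)
  qed
  \<comment> \<open>The same integrals, rewritten by the multiplication formula:
    \<open>fourier (\<psi> n)\<close> is \<open>h\<close> smoothed with the kernel \<open>K\<close>
    at scale \<open>1 / R n\<close>, which converges to \<open>h u\<close> times the integral of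
    \<open>K\<close>, that is, to 0.\<close>
  moreover have "(\<lambda>n. LINT \<xi>|lborel. H \<xi> * \<psi> n \<xi>) \<longlonglongrightarrow> 0"
  proof -
    have "(\<lambda>n. LINT u|lborel. h u * fourier (\<psi> n) u) \<longlonglongrightarrow> (LINT u|(lborel :: 'a measure). 0)"
    proof (rule integral_dominated_convergence[where w = "\<lambda>u. norm (h u) * (B * (LINT z|lborel. norm (K z)))"])
      have K': "integrable lborel (\<lambda>z. K (- z))"
        using K integrable_lborel_affine[of "-1" K 0] by simp
      have F\<psi>': "fourier (\<psi> n) u = (LINT z|lborel. h (u + z /\<^sub>R real (Suc n)) * K (- z))" for n u
        unfolding F\<psi> R_def
        using integral_lborel_affine[of "-1" "\<lambda>z. h (u + (- z) /\<^sub>R real (Suc n)) * K z" 0] by simp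
      have "(LINT z|lborel. K (- z)) = 0"
        using zero integral_lborel_affine[of "-1" K 0] by (simp add: K_def)
      then have "(\<lambda>n. fourier (\<psi> n) u) \<longlonglongrightarrow> 0" for u
        using tendsto_integral_dilate[OF K' _ smooth_isCont[OF sm(2)] B(2), of u] by (simp add: F\<psi>')
      then show "AE u in lborel. (\<lambda>n. h u * fourier (\<psi> n) u) \<longlonglongrightarrow> 0"
        by (intro AE_I2 tendsto_mult_right_zero)
      show "AE u in lborel. norm (h u * fourier (\<psi> n) u) \<le> norm (h u) * (B * (LINT z|lborel. norm (K z)))" for n
      proof (rule AE_I2)
        fix u
        have "norm (fourier (\<psi> n) u) \<le> (LINT z|lborel. norm (h (u + (- z) /\<^sub>R R n) * K z))"
          unfolding F\<psi> by (rule integral_norm_bound)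
        also have "\<dots> \<le> (LINT z|lborel. B * norm (K z))"
          by (rule integral_mono') (use K B in \<open>auto simp: norm_mult intro!: mult_right_mono\<close>)
        finally show "norm (h u * fourier (\<psi> n) u) \<le> norm (h u) * (B * (LINT z|lborel. norm (K z)))"
          by (simp add: norm_mult mult_left_mono)
      qed
      have "fourier (\<psi> n) \<in> borel_measurable borel" for n
        unfolding F\<psi> by measurable
      then show "(\<lambda>u. h u * fourier (\<psi> n) u) \<in> borel_measurable lborel" for n by simp
    qed (use integrable_test_function[OF h] in auto)
    then show ?thesis
      unfolding H_def using integral_fourier_mult[OF integrable_test_function[OF h] \<psi>_int] by simp
  qed
  ultimately have "(LINT \<xi>|lborel. complex_of_real ((norm (H \<xi>))\<^sup>2)) = 0" by (rule LIMSEQ_unique)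
  then have I0: "(LINT \<xi>|lborel. (norm (H \<xi>))\<^sup>2) = 0"
    by (metis integral_complex_of_real of_real_eq_0_iff)
  have "rapidly_decreasing (\<lambda>\<xi>. (norm (H \<xi>))\<^sup>2)"
    unfolding rapidly_decreasing_def
  proof
    fix n
    obtain C where C: "\<And>x. (1 + norm x) ^ n * norm (H x) \<le> C" "C > 0"
      using rapidly_decreasingE[OF schwartz_rapidly_decreasing[OF H], of n] by metis
    obtain D where D: "\<And>x. (1 + norm x) ^ 0 * norm (H x) \<le> D"
      using rapidly_decreasingE[OF schwartz_rapidly_decreasing[OF H], of 0] by metis
    have "(1 + norm x) ^ n * norm ((norm (H x))\<^sup>2) \<le> C * D" for x
      using mult_mono[OF C(1)[of x] D[of x]] C(2) by (simp add: power2_eq_square mult.assoc)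
    then show "\<exists>C. \<forall>x. (1 + norm x) ^ n * norm ((norm (H x))\<^sup>2) \<le> C" by blast
  qed
  then have "integrable lborel (\<lambda>\<xi>. (norm (H \<xi>))\<^sup>2)"
    by (intro integrable_rapidly_decreasing) measurable
  \<comment> \<open>The value at 0 is the mass of the mollifier; it keeps |H|^2 from integrating to
    0.\<close>
  moreover have "H 0 = 1"
    using h0(2) by (simp add: H_def fourier_def h_def)
  ultimately have "(LINT \<xi>|lborel. (norm (H \<xi>))\<^sup>2) > 0"
    by (intro integral_pos_continuous[where a = 0])
      (auto intro!: continuous_intros smooth_continuous_on[OF sm(3)])
  with I0 show False by simp
qed

section \<open>Reproducing formula for band-limited functions\<close>

text \<open>The support is the complement of the union of all open sets on which \<open>T\<close>
  vanishes; the content is that \<open>T\<close> also vanishes on test functions supported in that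
  union but in no single member of it. Compactness leaves finitely many balls, and compatibility
  with differences allows splitting a test function into a localised piece and the rest.\<close>

lemma zero_off_distribution_support:
  fixes T :: "('a::euclidean_space \<Rightarrow> complex) \<Rightarrow> complex"
  assumes diff: "\<And>\<phi> \<psi>. \<phi> \<in> test_functions \<Longrightarrow> \<psi> \<in> test_functions \<Longrightarrow> T (\<lambda>x. \<phi> x - \<psi> x) = T \<phi> - T \<psi>"
    and \<phi>: "\<phi> \<in> test_functions" and disj: "closure {x. \<phi> x \<noteq> 0} \<inter> distribution_support T = {}"
  shows "T \<phi> = 0"
proof -
  define null where "null = (\<lambda>U. open U \<and>
    (\<forall>\<phi>\<in>test_functions. closure {x. \<phi> x \<noteq> 0} \<subseteq> U \<longrightarrow> T \<phi> = 0))"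
  \<comment> \<open>The factor 3 is the ratio of the two radii of the plateau function: it is 1 on
    the small ball that takes part in the covering and vanishes outside a ball that still lies in
    \<open>U\<close>.\<close>
  have "\<exists>s>0. \<exists>U. null U \<and> cball p (3 * s) \<subseteq> U" if p: "p \<in> closure {x. \<phi> x \<noteq> 0}" for p
  proof -
    obtain U where U: "p \<in> U" "null U"
      using p disj unfolding distribution_support_def null_def by blast
    obtain e where e: "e > 0" "cball p e \<subseteq> U"
      using U unfolding null_def by (meson open_contains_cball)
    then show ?thesis using U by (intro exI[of _ "e / 3"]) auto
  qed
  then obtain s where s: "\<And>p. p \<in> closure {x. \<phi> x \<noteq> 0} \<Longrightarrow> s p > 0 \<and> (\<exists>U. null U \<and> cball p (3 * s p) \<subseteq> U)"
    by metis
  obtain \<eta> :: "'a \<Rightarrow> complex" where \<eta>: "\<eta> \<in> test_functions" "\<And>x. norm x \<le> 1 \<Longrightarrow> \<eta> x = 1"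
    "\<And>x. norm x \<ge> 3 \<Longrightarrow> \<eta> x = 0" using plateau_exists by metis
  \<comment> \<open>Peeling off one ball at a time with a plateau function replaces a partition of unity.\<close>
  have "T \<psi> = 0" if "finite D" "D \<subseteq> closure {x. \<phi> x \<noteq> 0}" "\<psi> \<in> test_functions"
    "closure {x. \<psi> x \<noteq> 0} \<subseteq> (\<Union>p\<in>D. ball p (s p))" for D \<psi>
    using that
  proof (induction D arbitrary: \<psi> rule: finite_induct)
    case empty
    then have "\<psi> = (\<lambda>x. \<psi> x - \<psi> x)" using closure_subset[of "{x. \<psi> x \<noteq> 0}"] by auto
    then show ?case using diff[OF empty.prems(2) empty.prems(2)] by simp
  next
    case (insert p D)
    have sp: "s p > 0" using s insert.prems(1) by blast
    define \<theta> where "\<theta> = (\<lambda>x. \<eta> ((x - p) /\<^sub>R s p))"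
    have \<theta>: "\<theta> x = 1" if "x \<in> ball p (s p)" for x
      unfolding \<theta>_def using that sp
      by (intro \<eta>(2)) (simp add: dist_norm norm_minus_commute divide_simps)
    have \<theta>': "\<theta> x = 0" if "x \<notin> cball p (3 * s p)" for x
      unfolding \<theta>_def using that sp
      by (intro \<eta>(3)) (simp add: dist_norm norm_minus_commute divide_simps)
    have "(\<lambda>x. \<eta> (inverse (s p) *\<^sub>R x + (- p) /\<^sub>R s p)) \<in> test_functions"
      by (rule test_functions_affine[OF \<eta>(1)]) (use sp in simp)
    then have \<theta>_smooth: "smooth \<theta>"
      by (simp add: \<theta>_def scaleR_diff_right test_functions_smooth)
    have \<psi>\<theta>: "(\<lambda>x. \<psi> x * \<theta> x) \<in> test_functions"
      by (rule test_functions_mult'[OF insert.prems(2) \<theta>_smooth])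
    obtain U where U: "null U" "cball p (3 * s p) \<subseteq> U" using s insert.prems(1) by blast
    have "closure {x. \<psi> x * \<theta> x \<noteq> 0} \<subseteq> cball p (3 * s p)"
      by (rule closure_minimal) (use \<theta>' in force)+
    then have "closure {x. \<psi> x * \<theta> x \<noteq> 0} \<subseteq> U" using U(2) by (rule order_trans)
    moreover have "\<forall>\<phi>\<in>test_functions. closure {x. \<phi> x \<noteq> 0} \<subseteq> U \<longrightarrow> T \<phi> = 0"
      using U(1) by (simp add: null_def)
    ultimately have T1: "T (\<lambda>x. \<psi> x * \<theta> x) = 0" using bspec[OF _ \<psi>\<theta>] by blast
    have sub: "closure {x. \<psi> x - \<psi> x * \<theta> x \<noteq> 0} \<subseteq> closure {x. \<psi> x \<noteq> 0} \<inter> - ball p (s p)"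
    proof (rule closure_minimal)
      show "{x. \<psi> x - \<psi> x * \<theta> x \<noteq> 0} \<subseteq> closure {x. \<psi> x \<noteq> 0} \<inter> - ball p (s p)"
      proof
        fix x assume "x \<in> {x. \<psi> x - \<psi> x * \<theta> x \<noteq> 0}"
        then show "x \<in> closure {x. \<psi> x \<noteq> 0} \<inter> - ball p (s p)"
          using \<theta>[of x] closure_subset[of "{x. \<psi> x \<noteq> 0}"] by (cases "x \<in> ball p (s p)") auto
      qed
    qed (intro closed_Int closed_closure closed_Compl open_ball)
    have "T (\<lambda>x. \<psi> x - \<psi> x * \<theta> x) = 0"
    proof (rule insert.IH)
      show "closure {x. \<psi> x - \<psi> x * \<theta> x \<noteq> 0} \<subseteq> (\<Union>p\<in>D. ball p (s p))"
        using sub insert.prems(3) by blast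
    qed (use insert.prems(1) test_functions_diff[OF insert.prems(2) \<psi>\<theta>] in auto)
    then show ?case using diff[OF insert.prems(2) \<psi>\<theta>] T1 by simp
  qed
  moreover obtain D where "finite D" "D \<subseteq> closure {x. \<phi> x \<noteq> 0}" "closure {x. \<phi> x \<noteq> 0} \<subseteq> (\<Union>p\<in>D. ball p (s p))"
  proof (rule compactE_image)
    show "compact (closure {x. \<phi> x \<noteq> 0})" using \<phi> by (simp add: test_functions_def)
    show "closure {x. \<phi> x \<noteq> 0} \<subseteq> (\<Union>p\<in>closure {x. \<phi> x \<noteq> 0}. ball p (s p))" using s by force
  qed auto
  ultimately show ?thesis using \<phi> by blast
qed

lemma integrable_bandlimited_mult_schwartz:
  assumes "f \<in> bandlimited \<rho>" "\<phi> \<in> schwartz"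
  shows "integrable lborel (\<lambda>x. f x * \<phi> x)"
proof -
  have "\<forall>\<phi>\<in>schwartz. integrable lborel (\<lambda>x. f x * \<phi> x)" using assms(1) by (simp add: bandlimited_def)
  from bspec[OF this assms(2)] show ?thesis .
qed

text \<open>The strict inequality \<open>r > 2 * \<rho>\<close> separates the complement of the open
  ball of radius \<open>r\<close>, a closed set, from the closed ball that contains the
  spectrum.\<close>

lemma bandlimited_annihilates:
  fixes f :: "'a::euclidean_space \<Rightarrow> complex"
  assumes f: "f \<in> bandlimited \<rho>" and \<phi>: "\<phi> \<in> test_functions"
    and r: "r > 2 * \<rho>" "\<And>\<xi>. norm \<xi> < r \<Longrightarrow> \<phi> \<xi> = 0"
  shows "(LINT y|lborel. f y * fourier \<phi> y) = 0"
proof -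
  have "fourier_distribution (distribution_of f) \<phi> = 0"
  proof (rule zero_off_distribution_support[OF _ \<phi>])
    fix \<phi> \<psi> :: "'a \<Rightarrow> complex"
    assume \<phi>: "\<phi> \<in> test_functions" and \<psi>: "\<psi> \<in> test_functions"
    have "integrable lborel (\<lambda>x. f x * fourier \<phi> x)" "integrable lborel (\<lambda>x. f x * fourier \<psi> x)"
      using \<phi> \<psi> by (auto intro!: integrable_bandlimited_mult_schwartz[OF f] fourier_test_function_schwartz)
    then show "fourier_distribution (distribution_of f) (\<lambda>x. \<phi> x - \<psi> x) =
       fourier_distribution (distribution_of f) \<phi> - fourier_distribution (distribution_of f) \<psi>"
      unfolding fourier_distribution_def distribution_of_def
      by (simp add: fourier_diff integrable_test_function \<phi> \<psi> right_diff_distrib)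
  next
    have "closure {x. \<phi> x \<noteq> 0} \<subseteq> - ball 0 r"
      by (rule closure_minimal) (use r(2) in force)+
    moreover have "distribution_support (fourier_distribution (distribution_of f)) \<subseteq> cball 0 (2 * \<rho>)"
      using f unfolding bandlimited_def by (auto simp: cball_def)
    ultimately show "closure {x. \<phi> x \<noteq> 0} \<inter> distribution_support (fourier_distribution (distribution_of f)) = {}"
      using r(1) by force
  qed
  then show ?thesis by (simp add: fourier_distribution_def distribution_of_def)
qed

text \<open>The convolution of \<open>f\<close> with \<open>R^d K(R x)\<close> does not depend on \<open>R\<close> once \<open>R > 2\<rho>\<close>,
  because the difference of two of the kernels has a Fourier transform that vanishes near the
  spectrum of \<open>f\<close>; letting \<open>R\<close> tend to infinity gives \<open>f\<close>. At this point \<open>f\<close> is only known to be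
  integrable against Schwartz functions, so the part of the integral away from \<open>x\<close> is dominated by
  a Schwartz majorant of all the kernels with \<open>R \<ge> 1\<close>.\<close>

lemma bandlimited_reproducing:
  fixes f :: "'a::euclidean_space \<Rightarrow> complex" and \<eta> :: "'a \<Rightarrow> complex"
  defines "K \<equiv> fourier \<eta>"
  assumes f: "f \<in> bandlimited \<rho>" and \<eta>: "\<eta> \<in> test_functions" "\<And>x. norm x \<le> 1 \<Longrightarrow> \<eta> x = 1"
    and R: "R > 0" "R > 2 * \<rho>"
  shows "(LINT y|lborel. f y * (of_real (R ^ DIM('a)) * K (R *\<^sub>R (y - x)))) = f x * (LINT z|lborel. K z)"
proof -
  define I where "I = (\<lambda>R. LINT y|lborel. f y * (of_real (R ^ DIM('a)) * K (R *\<^sub>R (y - x))))"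
  define \<theta> where "\<theta> = (\<lambda>R \<xi>. \<eta> (\<xi> /\<^sub>R R) * exp (2 * of_real pi * \<i> * of_real (\<xi> \<bullet> x)))"
  have sm: "smooth f" using f by (simp add: bandlimited_def)
  have KS: "K \<in> schwartz" unfolding K_def by (rule fourier_test_function_schwartz[OF \<eta>(1)])
  have K: "integrable lborel K" by (rule integrable_schwartz[OF KS])
  note [measurable] = smooth_borel_measurable[OF sm] smooth_borel_measurable[OF schwartz_smooth[OF KS]]
  have \<theta>: "\<theta> R \<in> test_functions" if "R > 0" for R
  proof -
    have "(\<lambda>\<xi>. \<eta> (inverse R *\<^sub>R \<xi> + 0)) \<in> test_functions"
      by (rule test_functions_affine[OF \<eta>(1)]) (use that in simp)
    then show ?thesis unfolding \<theta>_def by (intro test_functions_mult' smooth_exp_inner) simp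
  qed
  have F: "fourier (\<theta> R) = (\<lambda>y. of_real (R ^ DIM('a)) * K (R *\<^sub>R (y - x)))" if "R > 0" for R
    unfolding \<theta>_def K_def using fourier_scaled_modulated[OF that] by blast
  have int: "integrable lborel (\<lambda>y. f y * (of_real (R ^ DIM('a)) * K (R *\<^sub>R (y - x))))" if "R > 0" for R
    using integrable_bandlimited_mult_schwartz[OF f fourier_test_function_schwartz[OF \<theta>[OF that]]]
    unfolding F[OF that] .
  have const: "I S = I R" if S: "S > 0" "S > 2 * \<rho>" for S
  proof -
    have "(LINT y|lborel. f y * fourier (\<lambda>\<xi>. \<theta> S \<xi> - \<theta> R \<xi>) y) = 0"
    proof (rule bandlimited_annihilates[OF f, where r = "min S R"])
      show "(\<lambda>\<xi>. \<theta> S \<xi> - \<theta> R \<xi>) \<in> test_functions" by (intro test_functions_diff \<theta> S R)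
      show "\<theta> S \<xi> - \<theta> R \<xi> = 0" if "norm \<xi> < min S R" for \<xi>
        using that S R \<eta>(2)[of "\<xi> /\<^sub>R S"] \<eta>(2)[of "\<xi> /\<^sub>R R"] by (simp add: \<theta>_def divide_simps)
    qed (use S R in simp)
    then have "(LINT y|lborel. f y * fourier (\<theta> S) y - f y * fourier (\<theta> R) y) = 0"
      by (simp add: fourier_diff integrable_test_function \<theta> S R right_diff_distrib)
    then show ?thesis
      unfolding F[OF S(1)] F[OF R(1)] I_def using int[OF S(1)] int[OF R(1)] by simp
  qed
  define L where "L = (\<lambda>n. real (Suc n))"
  have L: "L n > 0" "L n \<ge> 1" for n by (simp_all add: L_def)
  define k where "k = (\<lambda>n z. of_real (L n ^ DIM('a)) * K (L n *\<^sub>R z))"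
  have intk: "integrable lborel (\<lambda>z. f (x + z) * k n z)" for n
    using int[OF L(1)[of n]] integrable_lborel_affine[of 1 "\<lambda>y. f y * (of_real (L n ^ DIM('a)) * K (L n *\<^sub>R (y - x)))" x]
    by (simp add: k_def)
  have Ik: "I (L n) = (LINT z|lborel. f (x + z) * k n z)" for n
    unfolding I_def k_def
    using integral_lborel_affine[of 1 "\<lambda>y. f y * (of_real (L n ^ DIM('a)) * K (L n *\<^sub>R (y - x)))" x]
    by simp
  have near: "(\<lambda>n. LINT z|lborel. indicator (ball 0 1) z *\<^sub>R (f (x + z) * k n z)) \<longlonglongrightarrow> f x * (LINT z|lborel. K z)"
  proof -
    \<comment> \<open>Cutting \<open>f\<close> off outside the unit ball around \<open>x\<close>
      yields a bounded function with the same germ at \<open>x\<close>, as the approximate identity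
      requires.\<close>
    define g where "g = (\<lambda>y. indicator (ball x 1) y *\<^sub>R f y)"
    have "compact (f ` cball x 1)"
      by (rule compact_continuous_image) (use smooth_continuous_on[OF sm] continuous_on_subset in auto)
    from compact_imp_bounded[OF this] obtain B where "\<forall>y\<in>f ` cball x 1. norm y \<le> B"
      unfolding bounded_iff by auto
    then have B: "norm (f y) \<le> B" if "dist x y < 1" for y using that by simp
    have "B \<ge> 0" using order_trans[OF norm_ge_zero B[of x]] by simp
    then have g: "norm (g y) \<le> B" for y using B[of y] by (simp add: g_def indicator_def)
    have "isCont f x = isCont g x"
      by (rule isCont_cong, rule eventually_mono[OF eventually_nhds_ball[of 1]]) (auto simp: g_def)
    then have "isCont g x" using smooth_isCont[OF sm] by simp
    moreover have "g \<in> borel_measurable borel"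
      unfolding g_def
      by (intro borel_measurable_scaleR borel_measurable_indicator smooth_borel_measurable sm) simp
    ultimately have "(\<lambda>n. LINT z|lborel. g (x + z /\<^sub>R real (Suc n)) * K z) \<longlonglongrightarrow> g x * (LINT z|lborel. K z)"
      by (intro tendsto_integral_dilate[where B = B] K g)
    moreover have "(LINT z|lborel. g (x + z /\<^sub>R real (Suc n)) * K z)
        = (LINT z|lborel. indicator (ball 0 1) z *\<^sub>R (f (x + z) * k n z))" for n
    proof -
      have "(LINT z|lborel. g (x + z /\<^sub>R L n) * K z)
          = L n ^ DIM('a) *\<^sub>R (LINT z|lborel. g (x + z) * K (L n *\<^sub>R z))"
        using L[of n] integral_lborel_affine[of "L n" "\<lambda>z. g (x + z /\<^sub>R L n) * K z" 0] by simp
      also have "\<dots> = (LINT z|lborel. L n ^ DIM('a) *\<^sub>R (g (x + z) * K (L n *\<^sub>R z)))" by simp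
      also have "\<dots> = (LINT z|lborel. indicator (ball 0 1) z *\<^sub>R (f (x + z) * k n z))"
        by (intro Bochner_Integration.integral_cong)
          (auto simp: g_def k_def indicator_def dist_norm scaleR_conv_of_real)
      finally show ?thesis by (simp add: L_def)
    qed
    ultimately show ?thesis by (simp add: g_def)
  qed
  have far: "(\<lambda>n. LINT z|lborel. indicator (- ball 0 1) z *\<^sub>R (f (x + z) * k n z)) \<longlonglongrightarrow> 0"
  proof -
    \<comment> \<open>Both \<open>norm z\<close> and \<open>L n\<close> are at most
      \<open>norm (L n *\<^sub>R z)\<close> here. Of the N + d + 1 powers of decay, N cover the
      weight, d cancel the factor \<open>L n ^ DIM('a)\<close> in \<open>k\<close>, and the last one
      yields \<open>1 / L n\<close>.\<close>
    have kle: "(1 + norm z) ^ N * norm (k n z) \<le> C / L n"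
      if C: "\<And>x. (1 + norm x) ^ (N + DIM('a) + 1) * norm (K x) \<le> C" and z: "norm z \<ge> 1" for C N n z
    proof -
      have "norm z \<le> L n * norm z" "L n \<le> L n * norm z"
        using L[of n] z mult_right_mono[of 1 "L n" "norm z"] mult_left_mono[of 1 "norm z" "L n"] by auto
      moreover have "norm (L n *\<^sub>R z) = L n * norm z" using L(1)[of n] by simp
      ultimately have *: "1 + norm z \<le> 1 + norm (L n *\<^sub>R z)" "L n \<le> 1 + norm (L n *\<^sub>R z)"
        by linarith+
      have "(1 + norm z) ^ N * L n ^ (DIM('a) + 1) \<le> (1 + norm (L n *\<^sub>R z)) ^ N * (1 + norm (L n *\<^sub>R z)) ^ (DIM('a) + 1)"
        by (intro mult_mono power_mono *) (use L[of n] in auto)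
      then have "(1 + norm z) ^ N * L n ^ (DIM('a) + 1) * norm (K (L n *\<^sub>R z))
          \<le> (1 + norm (L n *\<^sub>R z)) ^ (N + DIM('a) + 1) * norm (K (L n *\<^sub>R z))"
        unfolding power_add[symmetric] add.assoc[symmetric] by (rule mult_right_mono) simp
      also have "\<dots> \<le> C" by (rule C)
      finally have "(1 + norm z) ^ N * norm (k n z) * L n \<le> C"
        using L(1)[of n] by (simp add: k_def norm_mult norm_power mult_ac)
      then show ?thesis using L(1)[of n] by (simp add: pos_le_divide_eq)
    qed
    define r where "r = (\<lambda>z::'a. if norm z \<ge> 1 then (SUP n. norm (k n z)) else 0)"
    have kC: "\<exists>C>0. \<forall>z n. norm z \<ge> 1 \<longrightarrow> (1 + norm z) ^ N * norm (k n z) \<le> C / L n" for N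
      using kle rapidly_decreasingE[OF schwartz_rapidly_decreasing[OF KS], of "N + DIM('a) + 1"] by metis
    have kC': "\<exists>C>0. \<forall>z n. norm z \<ge> 1 \<longrightarrow> (1 + norm z) ^ N * norm (k n z) \<le> C" for N
    proof -
      obtain C where C: "C > 0" "\<And>z n. norm z \<ge> 1 \<Longrightarrow> (1 + norm z) ^ N * norm (k n z) \<le> C / L n"
        using kC by blast
      have "C / L n \<le> C" for n using C(1) L[of n] by (simp add: divide_le_eq)
      then show ?thesis using C order_trans by blast
    qed
    have r_ge: "norm (k n z) \<le> r z" if "norm z \<ge> 1" for n z
    proof -
      obtain C where "\<forall>z n. norm z \<ge> 1 \<longrightarrow> (1 + norm z) ^ 0 * norm (k n z) \<le> C" using kC'[of 0] by blast
      then have "norm (k n z) \<le> C" for n using that by simp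
      then have "bdd_above (range (\<lambda>n. norm (k n z)))" by (auto simp: bdd_above_def)
      then show ?thesis using that by (auto simp: r_def intro: cSUP_upper)
    qed
    have r_nonneg: "r z \<ge> 0" for z
      using order_trans[OF norm_ge_zero r_ge[of z 0]] by (cases "norm z \<ge> 1") (auto simp: r_def)
    have "rapidly_decreasing r"
      unfolding rapidly_decreasing_def
    proof
      fix N
      obtain C where C: "C > 0" "\<And>z n. norm z \<ge> 1 \<Longrightarrow> (1 + norm z) ^ N * norm (k n z) \<le> C"
        using kC' by blast
      have "(1 + norm z) ^ N * norm (r z) \<le> C" for z
      proof (cases "norm z \<ge> 1")
        case True
        have pos: "(1 + norm z) ^ N > 0" by (simp add: add_pos_nonneg)
        have "(SUP n. norm (k n z)) \<le> C / (1 + norm z) ^ N"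
          using C(2)[OF True] pos by (intro cSUP_least) (auto simp: pos_le_divide_eq mult.commute)
        then show ?thesis using pos r_nonneg[of z] True by (simp add: r_def pos_le_divide_eq mult.commute)
      qed (use C in \<open>simp add: r_def\<close>)
      then show "\<exists>C. \<forall>z. (1 + norm z) ^ N * norm (r z) \<le> C" by blast
    qed
    then have "rapidly_decreasing (\<lambda>y. r (y - x))"
      unfolding rapidly_decreasing_def
    proof (intro allI)
      fix N assume "\<forall>n. \<exists>C. \<forall>x. (1 + norm x) ^ n * norm (r x) \<le> C"
      then obtain C where C: "\<And>x. (1 + norm x) ^ N * norm (r x) \<le> C" by blast
      have "(1 + norm y) ^ N * norm (r (y - x)) \<le> (1 + norm x) ^ N * C" for y
      proof -
        have "(1 + norm y) ^ N \<le> ((1 + norm x) * (1 + norm (y - x))) ^ N"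
          by (intro power_mono one_plus_norm_le_mult) auto
        then have "(1 + norm y) ^ N * norm (r (y - x)) \<le> ((1 + norm x) * (1 + norm (y - x))) ^ N * norm (r (y - x))"
          by (rule mult_right_mono) simp
        also have "\<dots> = (1 + norm x) ^ N * ((1 + norm (y - x)) ^ N * norm (r (y - x)))"
          by (simp add: power_mult_distrib)
        also have "\<dots> \<le> (1 + norm x) ^ N * C" by (intro mult_left_mono C) auto
        finally show ?thesis .
      qed
      then show "\<exists>C. \<forall>y. (1 + norm y) ^ N * norm (r (y - x)) \<le> C" by blast
    qed
    then obtain \<Phi> where \<Phi>: "(\<lambda>x. complex_of_real (\<Phi> x)) \<in> schwartz" "\<And>y. r (y - x) \<le> \<Phi> y"
      using schwartz_majorant r_nonneg by metis
    have "integrable lborel (\<lambda>y. f y * of_real (\<Phi> y))"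
      by (rule integrable_bandlimited_mult_schwartz[OF f \<Phi>(1)])
    then have int\<Phi>: "integrable lborel (\<lambda>z. norm (f (x + z) * of_real (\<Phi> (x + z))))"
      using integrable_lborel_affine[of 1 "\<lambda>y. f y * of_real (\<Phi> y)" x] by simp
    have "(\<lambda>n. LINT z|lborel. indicator (- ball 0 1) z *\<^sub>R (f (x + z) * k n z)) \<longlonglongrightarrow> (LINT z|(lborel :: 'a measure). 0)"
    proof (rule integral_dominated_convergence[OF _ _ int\<Phi>])
      show "AE z in lborel. (\<lambda>n. indicator (- ball 0 1) z *\<^sub>R (f (x + z) * k n z)) \<longlonglongrightarrow> 0"
      proof (rule AE_I2)
        fix z :: 'a
        show "(\<lambda>n. indicator (- ball 0 1) z *\<^sub>R (f (x + z) * k n z)) \<longlonglongrightarrow> 0"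
        proof (cases "norm z \<ge> 1")
          case True
          obtain C where "\<forall>z n. norm z \<ge> 1 \<longrightarrow> (1 + norm z) ^ 0 * norm (k n z) \<le> C / L n"
            using kC[of 0] by blast
          then have C: "norm (k n z) \<le> C / L n" for n using True by simp
          have "(\<lambda>n. k n z) \<longlonglongrightarrow> 0"
          proof (rule Lim_null_comparison)
            show "\<forall>\<^sub>F n in sequentially. norm (k n z) \<le> C / L n" using C by simp
            show "(\<lambda>n. C / L n) \<longlonglongrightarrow> 0"
              using tendsto_mult_right_zero[OF LIMSEQ_inverse_real_of_nat, of C]
              by (simp add: L_def divide_inverse)
          qed
          from tendsto_mult_right_zero[OF this, of "indicator (- ball 0 1) z *\<^sub>R f (x + z)"]
          show ?thesis by simp
        qed (simp add: indicator_def)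
      qed
      show "AE z in lborel. norm (indicator (- ball 0 1) z *\<^sub>R (f (x + z) * k n z))
          \<le> norm (f (x + z) * of_real (\<Phi> (x + z)))" for n
      proof (rule AE_I2)
        fix z :: 'a
        have "norm (k n z) \<le> \<bar>\<Phi> (x + z)\<bar>" if "norm z \<ge> 1"
          using r_ge[OF that, of n] \<Phi>(2)[of "x + z"] by simp
        then show "norm (indicator (- ball 0 1) z *\<^sub>R (f (x + z) * k n z))
          \<le> norm (f (x + z) * of_real (\<Phi> (x + z)))"
          by (auto simp: indicator_def norm_mult intro!: mult_left_mono)
      qed
      show "(\<lambda>z. indicator (- ball 0 1) z *\<^sub>R (f (x + z) * k n z)) \<in> borel_measurable lborel" for n
        unfolding k_def by measurable
    qed simp
    then show ?thesis by simp
  qed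
  have "I (L n) = (LINT z|lborel. indicator (ball 0 1) z *\<^sub>R (f (x + z) * k n z))
      + (LINT z|lborel. indicator (- ball 0 1) z *\<^sub>R (f (x + z) * k n z))" for n
  proof -
    have "integrable lborel (\<lambda>z. indicator S z *\<^sub>R (f (x + z) * k n z))" if "S \<in> sets lborel" for S
      using integrable_mult_indicator[OF that intk] by simp
    then have "(LINT z|lborel. indicator (ball 0 1) z *\<^sub>R (f (x + z) * k n z))
      + (LINT z|lborel. indicator (- ball 0 1) z *\<^sub>R (f (x + z) * k n z))
      = (LINT z|lborel. indicator (ball 0 1) z *\<^sub>R (f (x + z) * k n z)
      + indicator (- ball 0 1) z *\<^sub>R (f (x + z) * k n z))"
      by (intro Bochner_Integration.integral_add[symmetric]) auto
    also have "\<dots> = I (L n)"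
      unfolding Ik by (intro Bochner_Integration.integral_cong) (auto simp: indicator_def)
    finally show ?thesis ..
  qed
  with tendsto_add[OF near far] have "(\<lambda>n. I (L n)) \<longlonglongrightarrow> f x * (LINT z|lborel. K z)" by simp
  moreover have "(\<lambda>n. I (L n)) \<longlonglongrightarrow> I R"
  proof (rule tendsto_eventually)
    obtain m :: nat where m: "real m > 2 * \<rho>" using reals_Archimedean2 by blast
    show "\<forall>\<^sub>F n in sequentially. I (L n) = I R"
      using eventually_ge_at_top[of m]
      by (rule eventually_mono) (use m L in \<open>auto intro!: const simp: L_def\<close>)
  qed
  ultimately show ?thesis unfolding I_def by (rule LIMSEQ_unique[symmetric])
qed

section \<open>Polynomial growth from temperedness\<close>

lemma iter_partial_translate:
  assumes "smooth g" "set bs \<subseteq> Basis"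
  shows "iter_partial bs (\<lambda>y. g (y - x)) = (\<lambda>y. iter_partial bs g (y - x))"
  using assms(2)
proof (induction bs)
  case (Cons b bs)
  have sm: "smooth (iter_partial bs g)" by (rule smooth_iter_partial) (use assms Cons in auto)
  have "((\<lambda>y. iter_partial bs g (y - x)) has_derivative
      frechet_derivative (iter_partial bs g) (at (y - x))) (at y)" for y
    by (rule has_derivative_compose[of "\<lambda>y. y - x" "\<lambda>v. v" y UNIV "iter_partial bs g"])
      (auto intro!: derivative_eq_intros smooth_has_derivative[OF sm])
  from partial_deriv_eqI[OF this, of b] Cons show ?case by (simp add: partial_deriv_def)
qed simp

text \<open>Moving the weight from \<open>y\<close> to \<open>y - x\<close> costs (1 + |x|)^N, and
  only finitely many derivatives enter, so their bounds can be added up. The lower bound 0 is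
  recorded because the seminorm is a supremum of reals, whose sign is known only once it is bounded;
  it lets the continuity constant be replaced by its absolute value.\<close>

lemma schwartz_seminorm_translate_le:
  fixes g :: "'a::euclidean_space \<Rightarrow> complex"
  assumes g: "g \<in> schwartz"
  obtains B where "\<And>x. 0 \<le> schwartz_seminorm N (\<lambda>y. g (y - x)) \<and>
    schwartz_seminorm N (\<lambda>y. g (y - x)) \<le> B * (1 + norm x) ^ N"
proof -
  define M where "M = {bs::'a list. set bs \<subseteq> Basis \<and> length bs \<le> N}"
  have fin: "finite M" unfolding M_def by (rule finite_lists_length_le) simp
  have "\<exists>B. \<forall>y. (1 + norm y) ^ N * norm (iter_partial bs g y) \<le> B" if "bs \<in> M" for bs
    using schwartz_iter_partial_rapidly_decreasing[OF g, of bs] that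
    unfolding rapidly_decreasing_def M_def by blast
  then obtain B where B: "\<And>bs y. bs \<in> M \<Longrightarrow> (1 + norm y) ^ N * norm (iter_partial bs g y) \<le> B bs"
    by metis
  have Bpos: "B bs \<ge> 0" if "bs \<in> M" for bs using order_trans[OF _ B[OF that, of 0]] by simp
  define S where "S = (\<Sum>bs\<in>M. B bs)"
  have BS: "B bs \<le> S" if "bs \<in> M" for bs
    unfolding S_def by (rule member_le_sum) (use fin Bpos that in auto)
  show ?thesis
  proof (rule that)
    fix x
    have le: "(1 + norm y) ^ N * norm (iter_partial bs (\<lambda>y. g (y - x)) y) \<le> S * (1 + norm x) ^ N"
      if "bs \<in> M" for bs y
    proof -
      have "(1 + norm y) ^ N \<le> ((1 + norm x) * (1 + norm (y - x))) ^ N"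
        by (intro power_mono one_plus_norm_le_mult) auto
      then have "(1 + norm y) ^ N * norm (iter_partial bs g (y - x))
          \<le> ((1 + norm x) * (1 + norm (y - x))) ^ N * norm (iter_partial bs g (y - x))"
        by (rule mult_right_mono) simp
      also have "\<dots> = (1 + norm x) ^ N * ((1 + norm (y - x)) ^ N * norm (iter_partial bs g (y - x)))"
        by (simp add: power_mult_distrib)
      also have "\<dots> \<le> (1 + norm x) ^ N * S"
        by (intro mult_left_mono order_trans[OF B BS] that) auto
      finally show ?thesis
        using iter_partial_translate[OF schwartz_smooth[OF g], of bs x] that
        by (simp add: M_def mult.commute)
    qed
    have bdd: "bdd_above ((\<lambda>(bs, y). (1 + norm y) ^ N * norm (iter_partial bs (\<lambda>y. g (y - x)) y)) ` (M \<times> UNIV))"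
      using le by (intro bdd_aboveI[of _ "S * (1 + norm x) ^ N"]) auto
    have "[] \<in> M" by (simp add: M_def)
    then have "0 \<le> schwartz_seminorm N (\<lambda>y. g (y - x))"
      unfolding schwartz_seminorm_def M_def[symmetric]
      by (intro cSUP_upper2[OF bdd, where x = "([], 0)"]) auto
    moreover have "schwartz_seminorm N (\<lambda>y. g (y - x)) \<le> S * (1 + norm x) ^ N"
      unfolding schwartz_seminorm_def M_def[symmetric]
      by (intro cSUP_least) (use \<open>[] \<in> M\<close> le in auto)
    ultimately show "0 \<le> schwartz_seminorm N (\<lambda>y. g (y - x)) \<and>
      schwartz_seminorm N (\<lambda>y. g (y - x)) \<le> S * (1 + norm x) ^ N" by blast
  qed
qed

text \<open>By the reproducing formula \<open>f x\<close> times a nonzero constant is the value of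
  the distribution at the translate by \<open>x\<close> of one Schwartz function, and continuity
  bounds it by a seminorm of that translate.\<close>

lemma bandlimited_polynomial_growth:
  fixes f :: "'a::euclidean_space \<Rightarrow> complex"
  assumes f: "f \<in> bandlimited \<rho>"
  obtains B N where "\<And>x. norm (f x) \<le> B * (1 + norm x) ^ N"
proof -
  obtain \<eta> :: "'a \<Rightarrow> complex" where \<eta>: "\<eta> \<in> test_functions" "\<And>x. norm x \<le> 1 \<Longrightarrow> \<eta> x = 1"
    using plateau_exists by metis
  define c where "c = (LINT z|lborel. fourier \<eta> z)"
  have c: "c \<noteq> 0" unfolding c_def by (rule integral_fourier_nonzero) (use \<eta> in auto)
  \<comment> \<open>\<open>\<rho>\<close> may be any real number: one entry of the maximum secures
    positivity, the other exceeds \<open>2 * \<rho>\<close>.\<close>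
  define R where "R = max 1 (2 * \<rho> + 1)"
  have R: "R > 0" "R > 2 * \<rho>" by (auto simp: R_def)
  define G where "G = (\<lambda>y. of_real (R ^ DIM('a)) * fourier \<eta> (R *\<^sub>R y))"
  have "(\<lambda>\<xi>. \<eta> (inverse R *\<^sub>R \<xi> + 0)) \<in> test_functions"
    by (rule test_functions_affine[OF \<eta>(1)]) (use R in simp)
  then have "(\<lambda>\<xi>. \<eta> (\<xi> /\<^sub>R R) * exp (2 * of_real pi * \<i> * of_real (\<xi> \<bullet> x))) \<in> test_functions" for x
    by (intro test_functions_mult' smooth_exp_inner) simp
  from fourier_test_function_schwartz[OF this]
  have GS: "(\<lambda>y. G (y - x)) \<in> schwartz" for x
    unfolding G_def fourier_scaled_modulated[OF R(1)] .
  have G: "G \<in> schwartz" using GS[of 0] by simp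
  obtain C N where T: "\<And>\<phi>. \<phi> \<in> schwartz \<Longrightarrow> norm (distribution_of f \<phi>) \<le> C * schwartz_seminorm N \<phi>"
    using f unfolding bandlimited_def tempered_distribution_def by blast
  obtain B where B: "\<And>x. 0 \<le> schwartz_seminorm N (\<lambda>y. G (y - x)) \<and>
    schwartz_seminorm N (\<lambda>y. G (y - x)) \<le> B * (1 + norm x) ^ N"
    using schwartz_seminorm_translate_le[OF G] by metis
  have "norm (f x) \<le> (\<bar>C\<bar> * B / norm c) * (1 + norm x) ^ N" for x
  proof -
    have "f x * c = distribution_of f (\<lambda>y. G (y - x))"
      unfolding distribution_of_def G_def c_def
      by (rule bandlimited_reproducing[OF f \<eta> R, symmetric])
    then have "norm (f x) * norm c \<le> C * schwartz_seminorm N (\<lambda>y. G (y - x))"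
      using T[OF GS[of x]] by (metis norm_mult)
    also have "\<dots> \<le> \<bar>C\<bar> * (B * (1 + norm x) ^ N)"
      using B[of x] by (intro mult_mono) auto
    finally show ?thesis using c by (simp add: field_simps)
  qed
  then show ?thesis using that by blast
qed

section \<open>Averages over dyadic cubes\<close>

text \<open>For \<open>l > 0\<close> this is the cell containing \<open>z\<close> of the grid of
  mesh \<open>l\<close> through the origin. Selecting it by floors makes lying in the same cell a
  symmetric relation given by integer equations.\<close>

definition lattice_cube :: "real \<Rightarrow> 'a::euclidean_space \<Rightarrow> 'a set" where
  "lattice_cube l z = half_open_cube (\<Sum>b\<in>Basis. (l * of_int \<lfloor>z \<bullet> b / l\<rfloor>) *\<^sub>R b) l"

lemma mem_lattice_cube:
  assumes "l > 0"
  shows "u \<in> lattice_cube l z \<longleftrightarrow> (\<forall>b\<in>Basis. \<lfloor>u \<bullet> b / l\<rfloor> = \<lfloor>z \<bullet> b / l\<rfloor>)"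
proof -
  have "(\<Sum>i\<in>Basis. (l * of_int \<lfloor>z \<bullet> i / l\<rfloor>) *\<^sub>R i) \<bullet> b = l * of_int \<lfloor>z \<bullet> b / l\<rfloor>"
    if "b \<in> Basis" for b :: 'a
    using that by simp
  moreover have "l * of_int m \<le> s \<and> s < l * of_int m + l \<longleftrightarrow> \<lfloor>s / l\<rfloor> = m" for m :: int and s
    using assms by (auto simp: floor_eq_iff field_simps)
  ultimately show ?thesis unfolding lattice_cube_def half_open_cube_def by simp
qed

lemma lattice_cube_dyadic: "lattice_cube (2 powi (- k)) z \<in> dyadic_cubes"
  unfolding lattice_cube_def dyadic_cubes_def
  by (intro CollectI exI[of _ k] exI[of _ "\<lambda>b. \<lfloor>z \<bullet> b / 2 powi (- k)\<rfloor>"] refl)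

lemma dist_lattice_cube:
  fixes z u :: "'a::euclidean_space" and l :: real
  assumes l: "l > 0" and u: "u \<in> lattice_cube l z"
  shows "norm (u - z) \<le> DIM('a) * l"
proof -
  have "\<bar>(u - z) \<bullet> b\<bar> \<le> l" if b: "b \<in> Basis" for b
  proof -
    have "\<lfloor>u \<bullet> b / l\<rfloor> = \<lfloor>z \<bullet> b / l\<rfloor>" using u b mem_lattice_cube[OF l] by blast
    then have "\<bar>u \<bullet> b / l - z \<bullet> b / l\<bar> \<le> 1" by linarith
    then show ?thesis using l by (simp add: inner_diff_left diff_divide_distrib[symmetric])
  qed
  then have "(\<Sum>b\<in>Basis. \<bar>(u - z) \<bullet> b\<bar>) \<le> (\<Sum>b\<in>(Basis::'a set). l)" by (rule sum_mono)
  then show ?thesis using norm_le_l1[of "u - z"] by simp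
qed

lemma sets_half_open_cube [measurable, simp]: "half_open_cube a l \<in> sets borel"
  unfolding half_open_cube_def by measurable

lemma emeasure_half_open_cube:
  fixes a :: "'a::euclidean_space"
  assumes l: "l > 0"
  shows "emeasure lborel (half_open_cube a l) = ennreal (l ^ DIM('a))"
proof -
  define e where "e = (\<Sum>b\<in>Basis. l *\<^sub>R b :: 'a)"
  have e: "e \<bullet> b = l" if "b \<in> Basis" for b using that by (simp add: e_def)
  have "box a (a + e) \<subseteq> half_open_cube a l" "half_open_cube a l \<subseteq> cbox a (a + e)"
    using e by (auto simp: half_open_cube_def box_def cbox_def inner_add_left)
  then have "emeasure lborel (box a (a + e)) \<le> emeasure lborel (half_open_cube a l)"
    "emeasure lborel (half_open_cube a l) \<le> emeasure lborel (cbox a (a + e))"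
    by (auto intro!: emeasure_mono)
  moreover have "emeasure lborel (box a (a + e)) = ennreal (l ^ DIM('a))"
    "emeasure lborel (cbox a (a + e)) = ennreal (l ^ DIM('a))"
    using e l by (auto simp: emeasure_lborel_box_eq emeasure_lborel_cbox_eq inner_add_left)
  ultimately show ?thesis by simp
qed

text \<open>A sum over cells is avoided. The indicator \<open>S z u\<close> of lying in the same
  cell is symmetric and has integral l^d in either variable; inserting it, exchanging
  \<open>w z\<close> for \<open>\<kappa> * w u\<close> within the cell and swapping the integrals
  leaves the integral of \<open>g\<close> over the cell of \<open>u\<close>.\<close>

lemma nn_integral_le_lattice_averages:
  fixes g w :: "'a::euclidean_space \<Rightarrow> ennreal"
  assumes [measurable]: "g \<in> borel_measurable borel" "w \<in> borel_measurable borel" and l: "l > 0"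
    and avg: "\<And>z. (\<integral>\<^sup>+u\<in>lattice_cube l z. g u \<partial>lborel) \<le> s * ennreal (l ^ DIM('a))"
    and w: "\<And>u z. u \<in> lattice_cube l z \<Longrightarrow> w z \<le> \<kappa> * w u"
  shows "(\<integral>\<^sup>+z. g z * w z \<partial>lborel) \<le> \<kappa> * s * (\<integral>\<^sup>+z. w z \<partial>lborel)"
proof -
  define S where "S = (\<lambda>(z::'a) u. (indicator (lattice_cube l z) u :: ennreal))"
  have S: "S z u = (if \<forall>b\<in>Basis. \<lfloor>u \<bullet> b / l\<rfloor> = \<lfloor>z \<bullet> b / l\<rfloor> then 1 else 0)" for z u
    unfolding S_def indicator_def mem_lattice_cube[OF l] by simp
  have sym: "S z u = S u z" for z u unfolding S by (simp add: eq_commute)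
  have [measurable]: "(\<lambda>(z, u). S z u) \<in> borel_measurable (borel \<Otimes>\<^sub>M borel)"
    unfolding S by measurable
  define L where "L = ennreal (l ^ DIM('a))"
  have L: "L \<noteq> 0" "L \<noteq> top" using l by (auto simp: L_def)
  have S1: "(\<integral>\<^sup>+u. S z u \<partial>lborel) = L" for z
    unfolding S_def L_def lattice_cube_def by (simp add: emeasure_half_open_cube[OF l])
  have Sg: "(\<integral>\<^sup>+z. g z * S u z \<partial>lborel) \<le> s * L" for u
    using avg[of u] by (simp add: S_def L_def)
  have "L * (\<integral>\<^sup>+z. g z * w z \<partial>lborel) = (\<integral>\<^sup>+z. \<integral>\<^sup>+u. g z * w z * S z u \<partial>lborel \<partial>lborel)"
    by (simp add: nn_integral_cmult S1 nn_integral_multc mult.commute)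
  also have "\<dots> \<le> (\<integral>\<^sup>+z. \<integral>\<^sup>+u. \<kappa> * w u * (g z * S u z) \<partial>lborel \<partial>lborel)"
  proof (intro nn_integral_mono)
    fix z u
    have "w z * S z u \<le> \<kappa> * w u * S z u"
      using w[of u z] by (auto simp: S_def indicator_def)
    from mult_left_mono[OF this, of "g z"] show "g z * w z * S z u \<le> \<kappa> * w u * (g z * S u z)"
      unfolding sym[of u z] by (simp add: mult_ac)
  qed
  also have "\<dots> = (\<integral>\<^sup>+u. \<integral>\<^sup>+z. \<kappa> * w u * (g z * S u z) \<partial>lborel \<partial>lborel)"
    by (rule lborel_pair.Fubini') measurable
  also have "\<dots> = (\<integral>\<^sup>+u. \<kappa> * w u * (\<integral>\<^sup>+z. g z * S u z \<partial>lborel) \<partial>lborel)"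
    by (intro nn_integral_cong nn_integral_cmult) measurable
  also have "\<dots> \<le> (\<integral>\<^sup>+u. \<kappa> * w u * (s * L) \<partial>lborel)"
    by (intro nn_integral_mono mult_left_mono Sg) simp
  also have "\<dots> = L * (\<kappa> * s * (\<integral>\<^sup>+u. w u \<partial>lborel))"
    by (simp add: nn_integral_cmult nn_integral_multc mult_ac)
  finally show ?thesis using L by (simp add: ennreal_mult_le_mult_iff)
qed

section \<open>Integrable weights at scale \<open>1 / R\<close>\<close>

lemma one_plus_scaled_norm_le_mult:
  assumes "R > 0"
  shows "1 + R * norm (x - z) \<le> (1 + R * norm (x - y)) * (1 + R * norm (y - z))"
  using one_plus_norm_le_mult[of "R *\<^sub>R (x - z)" "R *\<^sub>R (x - y)"] assms
  by (simp add: scaleR_diff_right[symmetric])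

text \<open>The factor \<open>R ^ DIM('a)\<close> normalises the weight: for \<open>R > 0\<close>
  its integral over \<open>z\<close> depends neither on \<open>R\<close> nor on
  \<open>y\<close>.\<close>

definition decay_weight :: "real \<Rightarrow> 'a::euclidean_space \<Rightarrow> 'a \<Rightarrow> real" where
  "decay_weight R y z = R ^ DIM('a) / (1 + R * norm (z - y)) ^ (DIM('a) + 1)"

lemma decay_weight_integrable:
  fixes y :: "'a::euclidean_space"
  assumes R: "R > 0"
  shows "integrable lborel (decay_weight R y)"
    and "(LINT z|lborel. decay_weight R y z) = (LINT z|(lborel::'a measure). 1 / (1 + norm z) ^ (DIM('a) + 1))"
proof -
  have eq: "decay_weight R y z = R ^ DIM('a) * (1 / (1 + norm (R *\<^sub>R (z - y))) ^ (DIM('a) + 1))" for z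
    using R by (simp add: decay_weight_def)
  define J where "J = (\<lambda>z::'a. 1 / (1 + norm z) ^ (DIM('a) + 1))"
  have "integrable lborel (\<lambda>z. J (- (R *\<^sub>R y) + R *\<^sub>R z))"
    using integrable_lborel_affine[of R J] integrable_inverse_power R unfolding J_def by blast
  moreover have eqJ: "decay_weight R y = (\<lambda>z. R ^ DIM('a) * J (- (R *\<^sub>R y) + R *\<^sub>R z))"
    unfolding J_def eq by (auto simp: scaleR_diff_right)
  ultimately show "integrable lborel (decay_weight R y)" by simp
  show "(LINT z|lborel. decay_weight R y z) = (LINT z|(lborel::'a measure). 1 / (1 + norm z) ^ (DIM('a) + 1))"
  proof -
    have "(LINT z|lborel. decay_weight R y z) = R ^ DIM('a) * (LINT z|lborel. J (- (R *\<^sub>R y) + R *\<^sub>R z))"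
      unfolding eqJ by simp
    also have "\<dots> = (LINT z|lborel. J z)"
      using integral_lborel_affine[of R J "- (R *\<^sub>R y)"] R by simp
    finally show ?thesis by (simp only: J_def)
  qed
qed

text \<open>The first factor of \<open>D\<close> bounds the variation of the weight over one cell,
  whose points are at distance at most d * l from each other; the second is the integral of the
  weight. The scales enter only through \<open>R * l\<close>.\<close>

lemma integral_decay_weight_le:
  fixes f :: "'a::euclidean_space \<Rightarrow> complex" and R l s q :: real
  assumes [measurable]: "f \<in> borel_measurable borel" and R: "R > 0" and l: "l > 0" and s: "s \<ge> 0"
    and avg: "\<And>z. (\<integral>\<^sup>+u\<in>lattice_cube l z. ennreal (norm (f u) powr q) \<partial>lborel) \<le> ennreal s * ennreal (l ^ DIM('a))"
  defines "D \<equiv> (1 + R * (DIM('a) * l)) ^ (DIM('a) + 1) * (LINT z|(lborel::'a measure). 1 / (1 + norm z) ^ (DIM('a) + 1))"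
  shows "integrable lborel (\<lambda>z. norm (f z) powr q * decay_weight R y z)"
    and "(LINT z|lborel. norm (f z) powr q * decay_weight R y z) \<le> D * s"
proof -
  note [measurable] = borel_measurable_integrable[OF decay_weight_integrable(1)[OF R, of y]]
  have pos: "decay_weight R y z \<ge> 0" for z using R by (simp add: decay_weight_def)
  define \<kappa> where "\<kappa> = (1 + R * (DIM('a) * l)) ^ (DIM('a) + 1)"
  have \<kappa>: "\<kappa> \<ge> 0" using R l by (simp add: \<kappa>_def)
  have w: "decay_weight R y z \<le> \<kappa> * decay_weight R y u" if u: "u \<in> lattice_cube l z" for u z
  proof -
    have p: "1 + R * norm (z - y) > 0" "1 + R * norm (u - y) > 0" using R by (auto intro: add_pos_nonneg)
    have "1 + R * norm (u - y) \<le> (1 + R * norm (u - z)) * (1 + R * norm (z - y))"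
      by (rule one_plus_scaled_norm_le_mult[OF R])
    also have "\<dots> \<le> (1 + R * (DIM('a) * l)) * (1 + R * norm (z - y))"
      using R p dist_lattice_cube[OF l u] by (intro mult_right_mono add_left_mono mult_left_mono) auto
    finally have "(1 + R * norm (u - y)) ^ (DIM('a) + 1) \<le> ((1 + R * (DIM('a) * l)) * (1 + R * norm (z - y))) ^ (DIM('a) + 1)"
      using p by (intro power_mono) auto
    then have "(1 + R * norm (u - y)) ^ (DIM('a) + 1) \<le> \<kappa> * (1 + R * norm (z - y)) ^ (DIM('a) + 1)"
      unfolding power_mult_distrib \<kappa>_def .
    moreover have "(1 + R * norm (u - y)) ^ (DIM('a) + 1) > 0" "(1 + R * norm (z - y)) ^ (DIM('a) + 1) > 0"
      using p by (auto simp del: power_Suc)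
    ultimately have "1 / (1 + R * norm (z - y)) ^ (DIM('a) + 1) \<le> \<kappa> / (1 + R * norm (u - y)) ^ (DIM('a) + 1)"
      by (simp add: field_simps del: power_Suc)
    from mult_left_mono[OF this, of "R ^ DIM('a)"] R show ?thesis
      by (simp add: decay_weight_def mult.commute)
  qed
  have "(\<integral>\<^sup>+z. ennreal (norm (f z) powr q) * ennreal (decay_weight R y z) \<partial>lborel)
      \<le> ennreal \<kappa> * ennreal s * (\<integral>\<^sup>+z. ennreal (decay_weight R y z) \<partial>lborel)"
  proof (rule nn_integral_le_lattice_averages[OF _ _ l])
    show "(\<integral>\<^sup>+u\<in>lattice_cube l z. ennreal (norm (f u) powr q) \<partial>lborel) \<le> ennreal s * ennreal (l ^ DIM('a))" for z
      by (rule avg)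
    show "ennreal (decay_weight R y z) \<le> ennreal \<kappa> * ennreal (decay_weight R y u)" if "u \<in> lattice_cube l z" for u z
      using w[OF that] \<kappa> pos[of u] by (simp flip: ennreal_mult)
  qed measurable
  also have "(\<integral>\<^sup>+z. ennreal (decay_weight R y z) \<partial>lborel) = ennreal (LINT z|lborel. decay_weight R y z)"
    by (rule nn_integral_eq_integral[OF decay_weight_integrable(1)[OF R]]) (use pos in simp)
  also have "ennreal \<kappa> * ennreal s * \<dots> = ennreal (D * s)"
  proof -
    have "(LINT z|(lborel::'a measure). 1 / (1 + norm z) ^ (DIM('a) + 1)) \<ge> 0"
      by (intro Bochner_Integration.integral_nonneg) auto
    then show ?thesis
      unfolding decay_weight_integrable(2)[OF R] D_def \<kappa>_def[symmetric] using \<kappa> s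
      by (simp add: mult_ac flip: ennreal_mult)
  qed
  finally have le: "(\<integral>\<^sup>+z. ennreal (norm (f z) powr q * decay_weight R y z) \<partial>lborel) \<le> ennreal (D * s)"
    using pos by (simp add: ennreal_mult)
  show int: "integrable lborel (\<lambda>z. norm (f z) powr q * decay_weight R y z)"
  proof (rule integrableI_nonneg)
    show "(\<integral>\<^sup>+z. ennreal (norm (f z) powr q * decay_weight R y z) \<partial>lborel) < \<infinity>"
      using le by (rule order.strict_trans1) simp
  qed (use pos in auto)
  have "(LINT z|(lborel::'a measure). 1 / (1 + norm z) ^ (DIM('a) + 1)) \<ge> 0"
      by (intro Bochner_Integration.integral_nonneg) auto
  then have "D * s \<ge> 0" using R l s by (simp add: D_def)
  then show "(LINT z|lborel. norm (f z) powr q * decay_weight R y z) \<le> D * s"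
    using le nn_integral_eq_integral[OF int] pos by simp
qed

section \<open>The uniform bound\<close>

text \<open>For \<open>q < 1\<close> one writes \<open>|f| = |f|^q |f|^(1 - q)\<close> and absorbs the second factor into the
  weighted supremum, which must be known to be finite; polynomial growth provides this for large \<open>M\<close>.\<close>

lemma weighted_sup_bound:
  fixes f :: "'a::euclidean_space \<Rightarrow> complex" and R t q c C D B :: real
  assumes q: "0 < q" "q < 1" and t: "t > 0" and R: "R > 0" and c: "c > 0" and C: "C \<ge> 0"
    and int: "\<And>y. integrable lborel (\<lambda>z. norm (f z) powr q * decay_weight R y z)"
    and le: "\<And>y. (LINT z|lborel. norm (f z) powr q * decay_weight R y z) \<le> D * t powr q"
    and rep: "\<And>y. c * norm (f y) \<le> (LINT z|lborel. norm (f z) * k y z)"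
    and k: "\<And>y z. 0 \<le> k y z" "\<And>y z. (1 + R * norm (z - y)) ^ M * k y z \<le> C * decay_weight R y z"
    and growth: "\<And>y. norm (f y) \<le> B * (1 + R * norm (y - x)) ^ M"
  shows "norm (f x) \<le> (C * D / c) powr (1 / q) * t"
proof -
  \<comment> \<open>The weight is centred at the point of interest, so that \<open>w x = 1\<close>
    and \<open>F\<close> bounds \<open>norm (f x)\<close>.\<close>
  define w where "w = (\<lambda>y. (1 + R * norm (y - x)) ^ M)"
  have w: "w y \<ge> 1" for y using R by (simp add: w_def)
  define F where "F = (SUP y. norm (f y) / w y)"
  have "norm (f y) / w y \<le> B" for y
  proof -
    have "norm (f y) \<le> B * w y" using growth[of y] by (simp add: w_def)
    then show ?thesis using w[of y] by (simp add: pos_divide_le_eq)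
  qed
  then have bdd: "bdd_above (range (\<lambda>y. norm (f y) / w y))" by (auto simp: bdd_above_def)
  have F: "norm (f y) \<le> F * w y" for y
  proof -
    have "norm (f y) / w y \<le> F" unfolding F_def by (rule cSUP_upper[OF _ bdd]) simp
    then show ?thesis using w[of y] by (simp add: pos_divide_le_eq)
  qed
  have "w x = 1" by (simp add: w_def)
  have fxF: "norm (f x) \<le> F" using F[of x] \<open>w x = 1\<close> by simp
  then have F0: "F \<ge> 0" using norm_ge_zero order_trans by blast
  have D: "D \<ge> 0"
  proof -
    have "0 \<le> (LINT z|lborel. norm (f z) powr q * decay_weight R x z)"
      using R by (intro Bochner_Integration.integral_nonneg) (auto simp: decay_weight_def)
    then have "0 \<le> D * t powr q" using le[of x] by linarith
    then show ?thesis using t by (simp add: zero_le_mult_iff)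
  qed
  have main: "c * norm (f y) \<le> F powr (1 - q) * w y * C * (D * t powr q)" for y
  proof -
    have "c * norm (f y) \<le> (LINT z|lborel. norm (f z) * k y z)" by (rule rep)
    also have "\<dots> \<le> (LINT z|lborel. (F powr (1 - q) * w y * C) * (norm (f z) powr q * decay_weight R y z))"
    proof (rule integral_mono')
      show "integrable lborel (\<lambda>z. (F powr (1 - q) * w y * C) * (norm (f z) powr q * decay_weight R y z))"
        by (intro integrable_mult_right int)
      fix z
      have pos: "0 \<le> (1 + R * norm (z - y)) ^ M" using R by simp
      have "norm (f z) = norm (f z) powr q * norm (f z) powr (1 - q)"
        by (cases "f z = 0") (auto simp: powr_add[symmetric])
      also have "\<dots> \<le> norm (f z) powr q * (F powr (1 - q) * w z)"
      proof (rule mult_left_mono)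
        have "norm (f z) powr (1 - q) \<le> (F * w z) powr (1 - q)"
          using F[of z] q by (intro powr_mono2) auto
        also have "\<dots> = F powr (1 - q) * w z powr (1 - q)"
          using F0 w[of z] by (simp add: powr_mult)
        \<comment> \<open>Since \<open>w z \<ge> 1\<close> and the exponent 1 - q is below 1, the
          power on the weight may be raised to 1.\<close>
        also have "\<dots> \<le> F powr (1 - q) * w z powr 1"
          using w[of z] q by (intro mult_left_mono powr_mono) auto
        finally show "norm (f z) powr (1 - q) \<le> F powr (1 - q) * w z" using w[of z] by simp
      qed simp
      finally have 1: "norm (f z) \<le> norm (f z) powr q * (F powr (1 - q) * w z)" .
      \<comment> \<open>Moving the weight from \<open>z\<close> to \<open>y\<close> costs M powers
        of \<open>1 + R * norm (z - y)\<close>, for which the decay of \<open>k\<close> pays; the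
        remaining \<open>w y\<close> is divided out when the supremum over \<open>y\<close> is
        taken.\<close>
      have "w z \<le> (1 + R * norm (z - y)) ^ M * w y"
        unfolding w_def power_mult_distrib[symmetric]
        using R by (intro power_mono one_plus_scaled_norm_le_mult) auto
      then have "norm (f z) \<le> norm (f z) powr q * (F powr (1 - q) * ((1 + R * norm (z - y)) ^ M * w y))"
        by (intro order_trans[OF 1] mult_left_mono) auto
      then have "norm (f z) * k y z \<le> norm (f z) powr q * (F powr (1 - q) * ((1 + R * norm (z - y)) ^ M * w y)) * k y z"
        using k(1) by (rule mult_right_mono)
      also have "\<dots> = norm (f z) powr q * (F powr (1 - q) * w y) * ((1 + R * norm (z - y)) ^ M * k y z)"
        by simp
      also have "\<dots> \<le> norm (f z) powr q * (F powr (1 - q) * w y) * (C * decay_weight R y z)"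
        using w[of y] by (intro mult_left_mono k(2)) auto
      finally show "norm (f z) * k y z \<le> (F powr (1 - q) * w y * C) * (norm (f z) powr q * decay_weight R y z)"
        by (simp add: mult_ac)
      show "0 \<le> (F powr (1 - q) * w y * C) * (norm (f z) powr q * decay_weight R y z)"
        using w[of y] C R by (simp add: decay_weight_def)
    qed
    also have "\<dots> = (F powr (1 - q) * w y * C) * (LINT z|lborel. norm (f z) powr q * decay_weight R y z)"
      by simp
    also have "\<dots> \<le> (F powr (1 - q) * w y * C) * (D * t powr q)"
      using w[of y] C by (intro mult_left_mono le) auto
    finally show ?thesis .
  qed
  \<comment> \<open>Taking the supremum over \<open>y\<close> makes \<open>F\<close> appear on both
    sides; as \<open>F\<close> is a finite number, \<open>F powr (1 - q)\<close> can be cancelled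
    when \<open>F > 0\<close>.\<close>
  have "F \<le> F powr (1 - q) * (C * D / c * t powr q)"
    unfolding F_def
  proof (rule cSUP_least, simp)
    fix y
    have "norm (f y) \<le> (F powr (1 - q) * (C * D / c * t powr q)) * w y"
      using main[of y] c by (simp add: field_simps)
    then show "norm (f y) / w y \<le> (SUP y. norm (f y) / w y) powr (1 - q) * (C * D / c * t powr q)"
      unfolding F_def[symmetric] using w[of y] by (simp add: pos_divide_le_eq)
  qed
  moreover have "F = F powr (1 - q) * F powr q" using F0 by (cases "F = 0") (auto simp: powr_add[symmetric])
  ultimately have "F powr q \<le> C * D / c * t powr q" if "F > 0"
    using that by (metis mult_le_cancel_left_pos powr_gt_zero less_irrefl)
  then have "(F powr q) powr (1 / q) \<le> (C * D / c * t powr q) powr (1 / q)" if "F > 0"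
    using q that by (intro powr_mono2) auto
  also have "(C * D / c * t powr q) powr (1 / q) = (C * D / c) powr (1 / q) * t"
    by (subst powr_mult) (use q t C D c in \<open>auto simp: powr_powr\<close>)
  finally have "F \<le> (C * D / c) powr (1 / q) * t" if "F > 0"
    using that q by (simp add: powr_powr)
  then have "F \<le> (C * D / c) powr (1 / q) * t" using F0 t by (cases "F = 0") auto
  then show ?thesis using fxF by linarith
qed

text \<open>The cube averages are compared with \<open>t powr q\<close> for a free
  \<open>t > 0\<close>, which keeps the estimate homogeneous and avoids a zero bound. For
  \<open>q < 1\<close> it goes through the weighted supremum, for \<open>q \<ge> 1\<close> through a
  pointwise splitting at height \<open>t\<close>.\<close>

lemma bandlimited_sup_bound:
  fixes A q :: real
  assumes A: "A > 0" and q: "q > 0"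
  shows "\<exists>C>0. \<forall>(k::int) (f :: 'a::euclidean_space \<Rightarrow> complex) t x.
    f \<in> bandlimited (A * 2 powi k) \<longrightarrow> t > 0 \<longrightarrow>
    (\<forall>z. (\<integral>\<^sup>+u\<in>lattice_cube (2 powi (- k)) z. ennreal (norm (f u) powr q) \<partial>lborel)
       \<le> ennreal (t powr q) * ennreal ((2 powi (- k)) ^ DIM('a))) \<longrightarrow>
    norm (f x) \<le> C * t"
proof -
  obtain \<eta> :: "'a \<Rightarrow> complex" where \<eta>: "\<eta> \<in> test_functions" "\<And>x. norm x \<le> 1 \<Longrightarrow> \<eta> x = 1"
    using plateau_exists by metis
  define K where "K = fourier \<eta>"
  define c where "c = norm (LINT z|lborel. K z)"
  have c: "c > 0" unfolding c_def K_def using integral_fourier_nonzero[OF \<eta>(1)] \<eta>(2)[of 0] by simp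
  have KS: "K \<in> schwartz" unfolding K_def by (rule fourier_test_function_schwartz[OF \<eta>(1)])
  have Kint: "integrable lborel K" by (rule integrable_schwartz[OF KS])
  \<comment> \<open>The reproducing formula with \<open>R = \<Lambda> * 2 powi k\<close> demands
    that \<open>\<Lambda>\<close> exceed \<open>2 * A\<close>; against cubes of side
    \<open>2 powi (- k)\<close> this gives \<open>R * l = \<Lambda>\<close>, so \<open>D\<close> is
    free of \<open>k\<close>.\<close>
  define \<Lambda> where "\<Lambda> = 2 * A + 1"
  have \<Lambda>: "\<Lambda> > 0" using A by (simp add: \<Lambda>_def)
  define D where "D = (1 + \<Lambda> * DIM('a)) ^ (DIM('a) + 1) * (LINT z|(lborel::'a measure). 1 / (1 + norm z) ^ (DIM('a) + 1))"
  have D: "D \<ge> 0"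
    unfolding D_def using \<Lambda> by (intro mult_nonneg_nonneg Bochner_Integration.integral_nonneg) auto
  have "\<exists>C>0. \<forall>x. (1 + norm x) ^ (M + DIM('a) + 1) * norm (K x) \<le> C" for M
    using rapidly_decreasingE[OF schwartz_rapidly_decreasing[OF KS], of "M + DIM('a) + 1"] by metis
  then obtain C where C: "\<And>M. C M > 0" "\<And>M x. (1 + norm x) ^ (M + DIM('a) + 1) * norm (K x) \<le> C M"
    by metis
  \<comment> \<open>The branches are what the two cases below produce; the added 1 secures
    positivity.\<close>
  define C' where "C' = (if q < 1 then (C 0 * D / c) powr (1 / q) + 1 else ((LINT z|lborel. norm (K z)) + C 0 * D) / c + 1)"
  have IK: "(LINT z|lborel. norm (K z)) \<ge> 0" by simp
  have C': "C' > 0"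
    using c C(1)[of 0] D IK unfolding C'_def by (auto intro!: add_nonneg_pos divide_nonneg_pos)
  have "norm (f x) \<le> C' * t"
    if f: "f \<in> bandlimited (A * 2 powi k)" and t: "t > 0"
      and avg: "\<forall>z. (\<integral>\<^sup>+u\<in>lattice_cube (2 powi (- k)) z. ennreal (norm (f u) powr q) \<partial>lborel)
       \<le> ennreal (t powr q) * ennreal ((2 powi (- k)) ^ DIM('a))"
    for k and f :: "'a \<Rightarrow> complex" and t x
  proof -
    define l :: real where "l = 2 powi (- k)"
    define R where "R = \<Lambda> * 2 powi k"
    have l: "l > 0" by (simp add: l_def)
    have R: "R > 0" "R > 2 * (A * 2 powi k)" using \<Lambda> by (auto simp: R_def \<Lambda>_def)
    have "R * l = \<Lambda>" by (simp add: R_def l_def power_int_minus)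
    then have Rl: "R * (DIM('a) * l) = \<Lambda> * DIM('a)" by (simp add: mult_ac)
    have f_meas: "f \<in> borel_measurable borel"
      using f by (auto simp: bandlimited_def intro: smooth_borel_measurable)
    define ker where "ker = (\<lambda>y z. R ^ DIM('a) * norm (K (R *\<^sub>R (z - y))))"
    have int: "integrable lborel (\<lambda>z. norm (f z) powr q * decay_weight R y z)"
      and le: "(LINT z|lborel. norm (f z) powr q * decay_weight R y z) \<le> D * t powr q" for y
      using integral_decay_weight_le[OF f_meas R(1) l _ avg[rule_format, folded l_def], of y] unfolding Rl D_def by auto
    have rep: "c * norm (f y) \<le> (LINT z|lborel. norm (f z) * ker y z)" for y
    proof -
      have "c * norm (f y) = norm (f y * (LINT z|lborel. K z))" by (simp add: c_def norm_mult)
      also have "f y * (LINT z|lborel. K z) = (LINT z|lborel. f z * (of_real (R ^ DIM('a)) * K (R *\<^sub>R (z - y))))"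
        unfolding K_def by (rule bandlimited_reproducing[OF f \<eta> R, symmetric])
      also have "norm \<dots> \<le> (LINT z|lborel. norm (f z * (of_real (R ^ DIM('a)) * K (R *\<^sub>R (z - y)))))"
        by (rule integral_norm_bound)
      also have "\<dots> = (LINT z|lborel. norm (f z) * ker y z)"
        using R(1) by (simp add: ker_def norm_mult norm_power)
      finally show ?thesis .
    qed
    have ker0: "0 \<le> ker y z" for y z using R by (simp add: ker_def)
    have ker: "(1 + R * norm (z - y)) ^ M * ker y z \<le> C M * decay_weight R y z" for M y z
    proof -
      define s where "s = 1 + R * norm (z - y)"
      have s: "s > 0" using R by (simp add: s_def add_pos_nonneg)
      have "s ^ (M + DIM('a) + 1) * norm (K (R *\<^sub>R (z - y))) \<le> C M"
        using C(2)[of "R *\<^sub>R (z - y)" M] R by (simp add: s_def)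
      then have "s ^ M * norm (K (R *\<^sub>R (z - y))) \<le> C M / s ^ (DIM('a) + 1)"
        using s by (simp add: pos_le_divide_eq power_add mult_ac)
      from mult_left_mono[OF this, of "R ^ DIM('a)"] R show ?thesis
        by (simp add: ker_def decay_weight_def s_def mult_ac)
    qed
    show ?thesis
    proof (cases "q < 1")
      case True
      note bound = weighted_sup_bound[OF q True t R(1) c less_imp_le[OF C(1)] int le rep ker0 ker]
      \<comment> \<open>First pass: the exponent \<open>N\<close> comes from the growth of the
        individual \<open>f\<close>, so the constant found with it is not uniform. All that is kept
        is that \<open>f\<close> is bounded.\<close>
      obtain B N where BN: "\<And>y. norm (f y) \<le> B * (1 + norm y) ^ N"
        using bandlimited_polynomial_growth[OF f] by metis
      have B: "B \<ge> 0" using order_trans[OF norm_ge_zero BN[of 0]] by simp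
      have bounded: "norm (f x) \<le> (C N * D / c) powr (1 / q) * t" for x
      proof (rule bound)
        fix y
        \<comment> \<open>The growth bound is weighted around the origin at unit scale; it is
          recentred at \<open>x\<close> and rescaled by \<open>R\<close>, with constants that may
          depend on both.\<close>
        have "1 + norm (y - x) \<le> max 1 (1 / R) * (1 + R * norm (y - x))"
        proof -
          have "norm (y - x) = 1 / R * (R * norm (y - x))" using R by simp
          also have "\<dots> \<le> max 1 (1 / R) * (R * norm (y - x))" using R by (intro mult_right_mono) auto
          finally show ?thesis by (simp add: distrib_left add_mono)
        qed
        then have "1 + norm y \<le> (1 + norm x) * (max 1 (1 / R) * (1 + R * norm (y - x)))"
          by (intro order_trans[OF one_plus_norm_le_mult[of y x]] mult_left_mono) auto
        then have "(1 + norm y) ^ N \<le> ((1 + norm x) * (max 1 (1 / R) * (1 + R * norm (y - x)))) ^ N"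
          by (intro power_mono) auto
        from order_trans[OF BN mult_left_mono[OF this B]]
        show "norm (f y) \<le> (B * ((1 + norm x) * max 1 (1 / R)) ^ N) * (1 + R * norm (y - x)) ^ N"
          by (simp add: power_mult_distrib mult_ac)
      qed
      \<comment> \<open>Second pass: for a bounded \<open>f\<close> the trivial weight,
        \<open>M = 0\<close>, is admissible, and its constant no longer depends on
        \<open>f\<close>.\<close>
      have "norm (f x) \<le> (C 0 * D / c) powr (1 / q) * t"
        by (rule bound[where B = "(C N * D / c) powr (1 / q) * t"]) (use bounded in simp)
      also have "\<dots> \<le> C' * t" using True t by (intro mult_right_mono) (auto simp: C'_def)
      finally show ?thesis .
    next
      case False
      \<comment> \<open>In place of Jensen's inequality: as 1 - q <= 0, values above
        \<open>t\<close> satisfy |f|^(1-q) <= t^(1-q), and values up to \<open>t\<close> are charged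
        to the kernel, whose integral does not depend on the scale.\<close>
      have young: "norm (f z) \<le> t + t powr (1 - q) * norm (f z) powr q" for z
      proof (cases "norm (f z) \<le> t")
        case True
        then show ?thesis by (intro order_trans[OF True]) simp
      next
        case gt: False
        then have "norm (f z) > 0" using t by linarith
        then have "norm (f z) = norm (f z) powr (1 - q) * norm (f z) powr q"
          by (simp add: powr_add[symmetric])
        also have "\<dots> \<le> t powr (1 - q) * norm (f z) powr q"
          using gt t False by (intro mult_right_mono powr_mono2') auto
        finally show ?thesis using t by linarith
      qed
      have kerint: "integrable lborel (ker x)" "(LINT z|lborel. ker x z) = (LINT z|lborel. norm (K z))"
      proof -
        have eq: "ker x = (\<lambda>z. R ^ DIM('a) * norm (K (- (R *\<^sub>R x) + R *\<^sub>R z)))"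
          by (auto simp: ker_def scaleR_diff_right)
        have "integrable lborel (\<lambda>z. K (- (R *\<^sub>R x) + R *\<^sub>R z))"
          using integrable_lborel_affine[of R K] Kint R by blast
        then show "integrable lborel (ker x)" unfolding eq by (intro integrable_mult_right integrable_norm)
        show "(LINT z|lborel. ker x z) = (LINT z|lborel. norm (K z))"
          unfolding eq using integral_lborel_affine[of R "\<lambda>z. norm (K z)" "- (R *\<^sub>R x)"] R by simp
      qed
      have "c * norm (f x) \<le> (LINT z|lborel. norm (f z) * ker x z)" by (rule rep)
      also have "\<dots> \<le> (LINT z|lborel. t * ker x z + t powr (1 - q) * C 0 * (norm (f z) powr q * decay_weight R x z))"
      proof (rule integral_mono')
        show "integrable lborel (\<lambda>z. t * ker x z + t powr (1 - q) * C 0 * (norm (f z) powr q * decay_weight R x z))"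
          by (intro Bochner_Integration.integrable_add integrable_mult_right kerint int)
        fix z
        have "norm (f z) * ker x z \<le> (t + t powr (1 - q) * norm (f z) powr q) * ker x z"
          by (intro mult_right_mono young ker0)
        also have "\<dots> = t * ker x z + t powr (1 - q) * norm (f z) powr q * ker x z" by (simp add: algebra_simps)
        also have "\<dots> \<le> t * ker x z + t powr (1 - q) * norm (f z) powr q * (C 0 * decay_weight R x z)"
          using ker[of z x 0] by (intro add_left_mono mult_left_mono) auto
        finally show "norm (f z) * ker x z \<le> t * ker x z + t powr (1 - q) * C 0 * (norm (f z) powr q * decay_weight R x z)"
          by (simp add: mult_ac)
        show "0 \<le> t * ker x z + t powr (1 - q) * C 0 * (norm (f z) powr q * decay_weight R x z)"
          using t ker0[of x z] C(1)[of 0] R by (intro add_nonneg_nonneg mult_nonneg_nonneg) (auto simp: decay_weight_def)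
      qed
      also have "\<dots> = t * (LINT z|lborel. norm (K z)) + t powr (1 - q) * C 0 * (LINT z|lborel. norm (f z) powr q * decay_weight R x z)"
        using kerint int by simp
      also have "\<dots> \<le> t * (LINT z|lborel. norm (K z)) + t powr (1 - q) * C 0 * (D * t powr q)"
        using C(1)[of 0] by (intro add_left_mono mult_left_mono le) auto
      also have "t powr (1 - q) * C 0 * (D * t powr q) = C 0 * D * (t powr (1 - q) * t powr q)" by simp
      also have "t powr (1 - q) * t powr q = t" using t by (simp add: powr_add[symmetric])
      finally have "norm (f x) \<le> ((LINT z|lborel. norm (K z)) + C 0 * D) / c * t"
        using c by (simp add: field_simps)
      also have "\<dots> \<le> C' * t" using False t by (intro mult_right_mono) (auto simp: C'_def)
      finally show ?thesis .
    qed
  qed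
  with C' show ?thesis by blast
qed

section \<open>From cube averages to \<open>V\<close>, and the conclusion\<close>

lemma infsum_int_atLeast_ennreal:
  fixes g :: "int \<Rightarrow> ennreal"
  shows "infsum g {k. real_of_int j \<le> real_of_int k} = (\<Sum>n. g (j + int n))"
proof -
  have "{k. real_of_int j \<le> real_of_int k} = range (\<lambda>n. j + int n)"
  proof safe
    fix k assume "real_of_int j \<le> real_of_int k"
    then show "k \<in> range (\<lambda>n. j + int n)" by (intro image_eqI[of _ _ "nat (k - j)"]) auto
  qed auto
  then have "infsum g {k. real_of_int j \<le> real_of_int k} = infsum (\<lambda>n. g (j + int n)) UNIV"
    by (subst infsum_reindex[symmetric, unfolded o_def]) (auto intro: inj_onI simp: o_def)
  also have "\<dots> = (\<Sum>n. g (j + int n))"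
    by (rule sums_unique[OF has_sum_imp_sums[OF has_sum_infsum]]) (simp add: nonneg_summable_on_complete)
  finally show ?thesis .
qed

lemma ennreal_powr_le_iff:
  assumes "q > 0" "t \<ge> 0"
  shows "ennreal_powr X (1 / q) \<le> ennreal t \<longleftrightarrow> X \<le> ennreal (t powr q)"
proof (cases X)
  case (real r)
  have "r powr (1 / q) \<le> t \<longleftrightarrow> r \<le> t powr q"
  proof
    assume "r powr (1 / q) \<le> t"
    then have "(r powr (1 / q)) powr q \<le> t powr q" using assms by (intro powr_mono2) auto
    then show "r \<le> t powr q" using assms real by (simp add: powr_powr)
  next
    assume "r \<le> t powr q"
    then have "r powr (1 / q) \<le> (t powr q) powr (1 / q)" using assms real by (intro powr_mono2) auto
    then show "r powr (1 / q) \<le> t" using assms by (simp add: powr_powr)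
  qed
  then show ?thesis using real assms by (simp add: ennreal_powr_def)
qed (simp add: ennreal_powr_def top_unique)

text \<open>One term of the supremum in \<open>V\<close>, freed of root and quotient. Both
  directions serve: integral bounds are extracted from \<open>V\<close> for \<open>q1\<close> and
  returned for \<open>q2\<close>. For side \<open>2 powi (- j)\<close> the logarithm is exactly
  \<open>- j\<close>, so the inner sum is a series starting at \<open>j\<close>.\<close>

lemma dyadic_average_le_iff:
  fixes f :: "int \<Rightarrow> 'a::euclidean_space \<Rightarrow> complex" and a :: 'a
  defines "P \<equiv> \<lambda>j. half_open_cube a (2 powi (- j))"
  assumes "q > 0" "t \<ge> 0"
  shows "ennreal_powr (1 / emeasure lborel (P j) * (\<integral>\<^sup>+x\<in>P j.
      (\<Sum>\<^sub>\<infinity>k\<in>{k. - log 2 (side_length (P j)) \<le> real_of_int k}. ennreal (norm (f k x) powr q)) \<partial>lborel)) (1 / q) \<le> ennreal t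
    \<longleftrightarrow> (\<integral>\<^sup>+x\<in>P j. (\<Sum>n. ennreal (norm (f (j + int n) x) powr q)) \<partial>lborel)
      \<le> ennreal (t powr q) * ennreal ((2 powi (- j)) ^ DIM('a))"
proof -
  define l :: real where "l = 2 powi (- j)"
  have l: "l > 0" by (simp add: l_def)
  have "log 2 l = - real_of_int j" by (simp add: l_def flip: powr_real_of_int')
  then have log: "- log 2 (side_length (P j)) = real_of_int j"
    by (simp add: P_def side_length_half_open_cube flip: l_def) (simp add: side_length_half_open_cube l)
  define X where "X = (\<integral>\<^sup>+x\<in>P j. (\<Sum>n. ennreal (norm (f (j + int n) x) powr q)) \<partial>lborel)"
  have m: "emeasure lborel (P j) = ennreal (l ^ DIM('a))"
    unfolding P_def l_def[symmetric] by (rule emeasure_half_open_cube[OF l])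
  have L: "ennreal (l ^ DIM('a)) \<noteq> 0" "ennreal (l ^ DIM('a)) \<noteq> top" using l by auto
  have "1 / ennreal (l ^ DIM('a)) * X \<le> ennreal (t powr q) \<longleftrightarrow> X \<le> ennreal (t powr q) * ennreal (l ^ DIM('a))"
  proof -
    have "1 / ennreal (l ^ DIM('a)) * X = X / ennreal (l ^ DIM('a))"
      by (simp add: ennreal_times_divide mult.commute)
    moreover have "X / ennreal (l ^ DIM('a)) * ennreal (l ^ DIM('a)) = X"
      using L by (simp add: ennreal_divide_times ennreal_divide_self less_top)
    ultimately show ?thesis
      using L mult_right_mono[of "X / ennreal (l ^ DIM('a))" "ennreal (t powr q)" "ennreal (l ^ DIM('a))"]
      by (auto intro!: divide_le_posI_ennreal simp: zero_less_iff_neq_zero mult.commute)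
  qed
  then show ?thesis
    unfolding ennreal_powr_le_iff[OF assms(2,3)] log infsum_int_atLeast_ennreal m X_def[symmetric]
    by (simp add: l_def)
qed

theorem mainTheorem6:
  fixes q1 q2 A :: real
  assumes "0 < q1" and "q1 < q2" and "A > 0"
  shows "\<exists>C::real. C > 0 \<and>
    (\<forall>(\<mu>::int) (f :: int \<Rightarrow> real ^ 'd \<Rightarrow> complex).
       (\<forall>k. f k \<in> bandlimited (A * 2 powi k)) \<longrightarrow>
       V \<mu> q2 f \<le> ennreal C * V \<mu> q1 f)"
proof -
  from bandlimited_sup_bound[OF assms(3,1), where 'a = "real ^ 'd"]
  obtain C0 where C0: "C0 > 0" and bound: "\<forall>(k::int) (f :: real ^ 'd \<Rightarrow> complex) t x.
    f \<in> bandlimited (A * 2 powi k) \<longrightarrow> t > 0 \<longrightarrow>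
    (\<forall>z. (\<integral>\<^sup>+u\<in>lattice_cube (2 powi (- k)) z. ennreal (norm (f u) powr q1) \<partial>lborel)
       \<le> ennreal (t powr q1) * ennreal ((2 powi (- k)) ^ DIM(real ^ 'd))) \<longrightarrow> norm (f x) \<le> C0 * t"
    by (elim exE conjE) (rule that)
  \<comment> \<open>From |f_k| <= C0 t the \<open>q2\<close>-average is at most
    \<open>(C0 * t) powr (q2 - q1) * t powr q1\<close>, whose root of order \<open>q2\<close> is
    \<open>C * t\<close>.\<close>
  define C where "C = C0 powr ((q2 - q1) / q2)"
  have C: "C > 0" using C0 by (simp add: C_def)
  have q2: "q2 > 0" using assms by simp
  have step: "V \<mu> q2 f \<le> ennreal (C * t)"
    if f: "\<And>k. f k \<in> bandlimited (A * 2 powi k)" and t: "t > 0" and Vt: "V \<mu> q1 f \<le> ennreal t"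
    for \<mu> and f :: "int \<Rightarrow> real ^ 'd \<Rightarrow> complex" and t
  proof -
    have [measurable]: "f k \<in> borel_measurable borel" for k
      using f[of k] by (auto simp: bandlimited_def intro: smooth_borel_measurable)
    define G where "G = (\<lambda>q j x. \<Sum>n. ennreal (norm (f (j + int n) x) powr q))"
    have cubes: "P \<in> dyadic_cubes \<longleftrightarrow> (\<exists>j m. P = half_open_cube (\<Sum>b\<in>Basis. (2 powi (- j) * of_int (m b)) *\<^sub>R b) (2 powi (- j)))"
      for P :: "(real ^ 'd) set" by (simp add: dyadic_cubes_def)
    have side: "side_length (half_open_cube (a :: real ^ 'd) (2 powi (- j))) \<le> 2 powi (- \<mu>) \<longleftrightarrow> \<mu> \<le> j" for a j
    proof -
      have "side_length (half_open_cube a (2 powi (- j))) = (2::real) powi (- j)"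
        by (rule side_length_half_open_cube) simp
      moreover have "(2::real) powi (- j) \<le> 2 powi (- \<mu>) \<longleftrightarrow> - j \<le> - \<mu>"
        using power_int_strict_increasing[of "- \<mu>" "- j" "2::real"] power_int_increasing[of "- j" "- \<mu>" "2::real"]
        by (cases "- j \<le> - \<mu>") auto
      ultimately show ?thesis by simp
    qed
    have avg: "(\<integral>\<^sup>+x\<in>half_open_cube a (2 powi (- j)). G q1 j x \<partial>lborel)
        \<le> ennreal (t powr q1) * ennreal ((2 powi (- j)) ^ DIM(real ^ 'd))"
      if "half_open_cube a (2 powi (- j)) \<in> dyadic_cubes" "\<mu> \<le> j" for a :: "real ^ 'd" and j
    proof -
      have "half_open_cube a (2 powi (- j)) \<in> {P \<in> dyadic_cubes. side_length P \<le> 2 powi (- \<mu>)}"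
        using that side by simp
      from order_trans[OF SUP_upper[OF this] Vt[unfolded V_def]]
      show ?thesis unfolding G_def
        by (subst (asm) dyadic_average_le_iff) (use assms t in auto)
    qed
    \<comment> \<open>The lattice cube of side \<open>2 powi (- k)\<close> is admissible because
      \<open>\<mu> \<le> k\<close>, and the term \<open>n = 0\<close> of \<open>G q1 k\<close> is
      the power of \<open>f k\<close>.\<close>
    have fk: "norm (f k x) \<le> C0 * t" if "\<mu> \<le> k" for k x
    proof (rule bound[rule_format, OF f[of k] t])
      fix z :: "real ^ 'd"
      have "(\<integral>\<^sup>+u\<in>lattice_cube (2 powi (- k)) z. ennreal (norm (f k u) powr q1) \<partial>lborel)
          \<le> (\<integral>\<^sup>+u\<in>lattice_cube (2 powi (- k)) z. G q1 k u \<partial>lborel)"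
      proof (intro nn_integral_mono mult_right_mono)
        fix u
        define g where "g = (\<lambda>n. ennreal (norm (f (k + int n) u) powr q1))"
        have "sum g {0} \<le> suminf g" by (rule sum_le_suminf) auto
        then show "ennreal (norm (f k u) powr q1) \<le> G q1 k u" by (simp add: G_def g_def)
      qed simp
      also have "\<dots> \<le> ennreal (t powr q1) * ennreal ((2 powi (- k)) ^ DIM(real ^ 'd))"
        using avg[OF lattice_cube_dyadic[unfolded lattice_cube_def] that] unfolding lattice_cube_def .
      finally show "(\<integral>\<^sup>+u\<in>lattice_cube (2 powi (- k)) z. ennreal (norm (f k u) powr q1) \<partial>lborel)
          \<le> ennreal (t powr q1) * ennreal ((2 powi (- k)) ^ DIM(real ^ 'd))" .
    qed
    show ?thesis
      unfolding V_def
    proof (rule SUP_least)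
      fix P :: "(real ^ 'd) set" assume P: "P \<in> {P \<in> dyadic_cubes. side_length P \<le> 2 powi (- \<mu>)}"
      then obtain j a where Pa: "P = half_open_cube a (2 powi (- j))" unfolding cubes by blast
      have j: "\<mu> \<le> j" using P side unfolding Pa by blast
      define \<gamma> where "\<gamma> = (C0 * t) powr (q2 - q1)"
      have "(\<integral>\<^sup>+x\<in>P. G q2 j x \<partial>lborel) \<le> (\<integral>\<^sup>+x. ennreal \<gamma> * (G q1 j x * indicator P x) \<partial>lborel)"
      proof (rule nn_integral_mono)
        fix x
        have "norm (f (j + int n) x) powr q2 \<le> \<gamma> * norm (f (j + int n) x) powr q1" for n
        proof -
          have "norm (f (j + int n) x) powr q2 = norm (f (j + int n) x) powr (q2 - q1) * norm (f (j + int n) x) powr q1"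
            by (simp add: powr_add[symmetric])
          also have "\<dots> \<le> \<gamma> * norm (f (j + int n) x) powr q1"
            unfolding \<gamma>_def using fk[of "j + int n" x] j assms by (intro mult_right_mono powr_mono2) auto
          finally show ?thesis .
        qed
        then have "G q2 j x \<le> (\<Sum>n. ennreal \<gamma> * ennreal (norm (f (j + int n) x) powr q1))"
          unfolding G_def by (intro suminf_le) (auto simp: \<gamma>_def simp flip: ennreal_mult intro!: ennreal_leI)
        also have "\<dots> = ennreal \<gamma> * G q1 j x" unfolding G_def by (rule ennreal_suminf_cmult)
        finally show "G q2 j x * indicator P x \<le> ennreal \<gamma> * (G q1 j x * indicator P x)"
          by (simp add: mult_right_mono mult.assoc[symmetric])
      qed
      also have "\<dots> = ennreal \<gamma> * (\<integral>\<^sup>+x\<in>P. G q1 j x \<partial>lborel)"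
        unfolding G_def Pa by (intro nn_integral_cmult) measurable
      also have "\<dots> \<le> ennreal \<gamma> * (ennreal (t powr q1) * ennreal ((2 powi (- j)) ^ DIM(real ^ 'd)))"
        unfolding Pa using P j by (intro mult_left_mono avg) (auto simp: Pa)
      also have "\<dots> = ennreal ((C * t) powr q2) * ennreal ((2 powi (- j)) ^ DIM(real ^ 'd))"
      proof -
        have "\<gamma> * t powr q1 = C0 powr (q2 - q1) * (t powr (q2 - q1) * t powr q1)"
          unfolding \<gamma>_def using C0 t by (simp add: powr_mult)
        also have "t powr (q2 - q1) * t powr q1 = t powr q2" by (simp add: powr_add[symmetric])
        also have "C0 powr (q2 - q1) * t powr q2 = (C * t) powr q2"
          unfolding C_def using C0 t q2 by (simp add: powr_mult powr_powr)
        finally show ?thesis by (simp add: \<gamma>_def mult.assoc[symmetric] flip: ennreal_mult)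
      qed
      finally have le: "(\<integral>\<^sup>+x\<in>P. G q2 j x \<partial>lborel)
        \<le> ennreal ((C * t) powr q2) * ennreal ((2 powi (- j)) ^ DIM(real ^ 'd))" .
      show "ennreal_powr (1 / emeasure lborel P * (\<integral>\<^sup>+x\<in>P.
          (\<Sum>\<^sub>\<infinity>k\<in>{k. - log 2 (side_length P) \<le> real_of_int k}. ennreal (norm (f k x) powr q2)) \<partial>lborel)) (1 / q2)
          \<le> ennreal (C * t)"
        unfolding Pa
        by (rule iffD2[OF dyadic_average_le_iff[OF q2 less_imp_le[OF mult_pos_pos[OF C t]],
              where f = f and a = a and j = j] le[unfolded Pa G_def]])
    qed
  qed
  have "V \<mu> q2 f \<le> ennreal C * V \<mu> q1 f"
    if f: "\<And>k. f k \<in> bandlimited (A * 2 powi k)" for \<mu> and f :: "int \<Rightarrow> real ^ 'd \<Rightarrow> complex"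
  proof (cases "V \<mu> q1 f")
    case (real v)
    show ?thesis
    proof (rule ennreal_le_epsilon)
      \<comment> \<open>\<open>V \<mu> q1 f\<close> may vanish while \<open>step\<close> wants a
        positive bound, so it is applied slightly above; the slack \<open>e / C\<close> becomes
        \<open>e\<close> after multiplication by \<open>C\<close>.\<close>
      fix e :: real assume e: "e > 0"
      have "V \<mu> q2 f \<le> ennreal (C * (v + e / C))"
        by (rule step[OF f]) (use real e C in \<open>auto intro: add_nonneg_pos ennreal_leI\<close>)
      also have "\<dots> = ennreal C * V \<mu> q1 f + ennreal e"
        using real e C by (simp add: distrib_left ennreal_mult)
      finally show "V \<mu> q2 f \<le> ennreal C * V \<mu> q1 f + ennreal e" .
    qed
  next
    case top
    then show ?thesis using C by (simp add: ennreal_mult_top)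
  qed
  then show ?thesis using C by blast
qed

end
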